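(* Let $r\ge 1$ be an integer and $a\in\mathbb{R}$. Let $\mathfrak{S}_r(a)$ be the set of tuples $\boldsymbol{w}=(w_1,\dots,w_r)$ of $\mathbb{R}$-valued $C^\infty$-functions on $\mathbb{C}^*$ (with coordinate $q$) satisfying $$2\,\partial_{\bar q}\partial_q w_i-r^2e^{2(w_i-w_{i-1})}+r^2e^{2(w_{i+1}-w_i)}=0\qquad(i=1,\dots,r),$$ with the convention $w_{r+i}=w_i$, and such that $\sum_{i=1}^r w_i=\bigl(-\tfrac{r(r-1)}{2}-a\bigr)\log|q|$. Let $\mathfrak{R}_{r,r}(a)$ be the set of $(a_1,\dots,a_r)\in\mathbb{R}^r$ such that $a_1\ge a_2\ge\cdots\ge a_r\ge a_1-r$ and $\sum_{i=1}^r a_i=a$. Then the map sending $\boldsymbol{w}\in\mathfrak{S}_r(a)$ to $(a_1,\dots,a_r)$, where $$a_i:=\min\bigl\{c\in\mathbb{R}\;\big|\;|q|^{i-1}e^{w_i}=O(|q|^{-c-\epsilon})\text{ as }q\to 0\text{ for every }\epsilon>0\bigr\},$$ is a well defined bijection $\mathfrak{S}_r(a)\to\mathfrak{R}_{r,r}(a)$. Moreover, for any $\boldsymbol{w}\in\mathfrak{S}_r(a)$, the functions $w_i$ depend only on $|q|$.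
   Context: The displayed system is the Toda lattice with opposite sign $2\partial_{\bar z}\partial_z w_i-e^{2(w_i-w_{i-1})}+e^{2(w_{i+1}-w_i)}=0$ after the coordinate change $z=rq$. The map described in the claim is the "natural" map of the theorem: to $\boldsymbol{w}$ one associates the hermitian metric $h$ on the bundle with frame $e_1,\dots,e_r$ over $\mathbb{C}^*$ such that $h(e_i,e_j)=0$ for $i\neq j$ and $|e_i|_h=|q|^{i-1}e^{w_i}$, and $a_i$ is the parabolic weight of $e_i$ at $q=0$. *)

theory Defs
  imports "HOL-Analysis.Analysis" "HOL-Library.Landau_Symbols" "HOL-Library.FuncSet"
begin

text \<open>Continuous differentiability of order \<open>k\<close>, in the real sense, on an open set \<open>S\<close>
  of a finite-dimensional space, through iterated directional derivatives.\<close>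

fun Ck_on :: "nat \<Rightarrow> 'a::real_normed_vector set \<Rightarrow> ('a \<Rightarrow> 'b::real_normed_vector) \<Rightarrow> bool" where
  "Ck_on 0 S f \<longleftrightarrow> continuous_on S f"
| "Ck_on (Suc k) S f \<longleftrightarrow>
     (\<forall>x\<in>S. f differentiable (at x)) \<and>
     (\<forall>v. Ck_on k S (\<lambda>x. frechet_derivative f (at x) v))"

definition Cinf_on :: "'a::real_normed_vector set \<Rightarrow> ('a \<Rightarrow> 'b::real_normed_vector) \<Rightarrow> bool" where
  "Cinf_on S f \<longleftrightarrow> (\<forall>k. Ck_on k S f)"

text \<open>The Wirtinger operators \<open>(\<partial>\<^sub>x - \<i> \<partial>\<^sub>y) / 2\<close> and \<open>(\<partial>\<^sub>x + \<i> \<partial>\<^sub>y) / 2\<close>;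
  the real Frechet derivative is evaluated in the directions \<open>1\<close> and \<open>\<i>\<close>.\<close>

definition d_q :: "(complex \<Rightarrow> complex) \<Rightarrow> complex \<Rightarrow> complex" where
  "d_q f z = (frechet_derivative f (at z) 1 - \<i> * frechet_derivative f (at z) \<i>) / 2"

definition d_qbar :: "(complex \<Rightarrow> complex) \<Rightarrow> complex \<Rightarrow> complex" where
  "d_qbar f z = (frechet_derivative f (at z) 1 + \<i> * frechet_derivative f (at z) \<i>) / 2"

abbreviation Cstar :: "complex set" where
  "Cstar \<equiv> - {0}"

text \<open>The extension of a tuple indexed by \<open>{1..r}\<close> to all integer indices with period \<open>r\<close>.\<close>

definition cyc :: "nat \<Rightarrow> (nat \<Rightarrow> 'a) \<Rightarrow> int \<Rightarrow> 'a" where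
  "cyc r w k = w (nat ((k - 1) mod int r) + 1)"

text \<open>Tuples and functions on \<open>\<complex>\<^sup>*\<close> are extensional (\<open>undefined\<close> off their domain), so that
  HOL equality of such objects is equality on \<open>{1..r}\<close> and on \<open>\<complex>\<^sup>*\<close>.\<close>

definition toda_solutions :: "nat \<Rightarrow> real \<Rightarrow> (nat \<Rightarrow> complex \<Rightarrow> real) set" where
  "toda_solutions r a =
     {w \<in> {1..r} \<rightarrow>\<^sub>E (Cstar \<rightarrow>\<^sub>E UNIV).
        (\<forall>i\<in>{1..r}. Cinf_on Cstar (w i)) \<and>
        (\<forall>i\<in>{1..r}. \<forall>q\<in>Cstar.
           2 * d_qbar (d_q (\<lambda>z. complex_of_real (w i z))) q
           - complex_of_real (real r ^ 2 * exp (2 * (cyc r w (int i) q - cyc r w (int i - 1) q)))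
           + complex_of_real (real r ^ 2 * exp (2 * (cyc r w (int i + 1) q - cyc r w (int i) q)))
           = 0) \<and>
        (\<forall>q\<in>Cstar. (\<Sum>i=1..r. w i q) = (- (real r * (real r - 1) / 2) - a) * ln (cmod q))}"

definition weight_set :: "nat \<Rightarrow> real \<Rightarrow> (nat \<Rightarrow> real) set" where
  "weight_set r a =
     {b \<in> {1..r} \<rightarrow>\<^sub>E UNIV.
        (\<forall>i\<in>{1..<r}. b i \<ge> b (i + 1)) \<and> b r \<ge> b 1 - real r \<and> (\<Sum>i=1..r. b i) = a}"

text \<open>The exponents \<open>c\<close> with \<open>|e\<^sub>i|\<^sub>h = |q|\<^sup>i\<^sup>-\<^sup>1 exp w\<^sub>i\<close> of order \<open>O(|q|\<^sup>-\<^sup>c\<^sup>-\<^sup>\<epsilon>)\<close> at \<open>0\<close> for all \<open>\<epsilon> > 0\<close>.\<close>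

definition growth_exponents :: "(nat \<Rightarrow> complex \<Rightarrow> real) \<Rightarrow> nat \<Rightarrow> real set" where
  "growth_exponents w i =
     {c. \<forall>\<epsilon>>0. (\<lambda>q. cmod q ^ (i - 1) * exp (w i q)) \<in> O[at 0](\<lambda>q. cmod q powr (- c - \<epsilon>))}"

text \<open>\<open>LEAST\<close> denotes the minimum only when the minimum exists.\<close>

definition parabolic_weights :: "nat \<Rightarrow> (nat \<Rightarrow> complex \<Rightarrow> real) \<Rightarrow> nat \<Rightarrow> real" where
  "parabolic_weights r w = (\<lambda>i\<in>{1..r}. LEAST c. c \<in> growth_exponents w i)"

end

theory Submission
  imports Defs "HOL-Real_Asymp.Real_Asymp" "HOL-Probability.Discrete_Topology"
begin

text \<open>Put \<open>q = exp z\<close> and subtract from every \<open>w\<^sub>i\<close> the average \<open>\<mu> Re z\<close>. The system becomes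
  \<open>\<Delta> v\<^sub>i = 2 r\<^sup>2 exp (2 Re z) (P\<^sub>i - P\<^sub>i\<^sub>+\<^sub>1)\<close> with \<open>P\<^sub>i = exp (2 (v\<^sub>i - v\<^sub>i\<^sub>-\<^sub>1))\<close>, for
  \<open>2 \<pi> \<i>\<close>-periodic functions \<open>v\<^sub>i\<close> on the plane whose sum is \<open>0\<close>, and the weights become the slopes
  \<open>\<nu>\<^sub>i\<close> in \<open>v\<^sub>i \<sim> - \<nu>\<^sub>i Re z\<close> as \<open>Re z \<rightarrow> - \<infinity>\<close>, subject to \<open>\<nu>\<^sub>i - \<nu>\<^sub>i\<^sub>-\<^sub>1 \<le> 1\<close>. The system is
  cooperative, so the largest difference of two solutions obeys a maximum principle.

  The sum \<open>S\<close> of the \<open>P\<^sub>i\<close> satisfies \<open>\<Delta> log S \<ge> c exp (2 Re z) S\<close> where it is large; the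
  Keller--Osserman argument then bounds \<open>exp (2 Re z) S\<close> for \<open>Re z \<le> 0\<close> and forces \<open>v\<^sub>i \<rightarrow> 0\<close> as
  \<open>Re z \<rightarrow> \<infinity>\<close>. Hence solutions that differ by \<open>o(Re z)\<close> at \<open>- \<infinity>\<close> agree. A solution differs from its
  reflection in a horizontal line by a bounded amount, because the difference vanishes on the
  boundary of a strip of width \<open>\<pi>\<close> and has bounded Laplacian there; so it is invariant under all
  these reflections, that is, it depends on \<open>Re z\<close> only. For such a solution the energy
  \<open>H = \<Sum> v\<^sub>i'\<^sup>2 / 2 - r\<^sup>2 exp (2 s) S\<close> is monotone, and so is each \<open>v\<^sub>i' + H\<close>; both are bounded, and
  therefore \<open>v\<^sub>i'\<close> converges at \<open>- \<infinity>\<close>.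

  For existence, the Dirichlet problem on a bounded interval is solved by a contraction after
  clipping the exponential, which the maximum principle makes harmless. Logarithmic sub- and
  supersolutions, which also cover the degenerate case \<open>\<nu>\<^sub>i - \<nu>\<^sub>i\<^sub>-\<^sub>1 = 1\<close>, control the solutions
  on \<open>[- n\<^sup>2, n]\<close>; the comparison principle makes them a Cauchy sequence and identifies the limit
  with the solution of the Dirichlet problem on every interval.\<close>

section \<open>Pointwise Laplacians and the maximum principle\<close>

text \<open>The slope condition has its origin in the blow-up estimate: a bound on
  \<open>exp (2 Re z) S\<close> makes every increment \<open>v i - v (i - 1)\<close> at most C - Re
  z, hence \<open>\<nu> i - \<nu> (i - 1) \<le> 1\<close>. For i = 2..r these inequalities order the
  weights, and the one across the end of the cycle is \<open>a_r \<ge> a_1 - r\<close>. The obstacle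
  is the case of equality. Then \<open>exp (2 s) P_i\<close> is constant along the linear profile
  instead of decaying, so neither a bounded difference of two solutions with equal slopes nor
  integrability of \<open>v i''\<close> at minus infinity is available in advance. This is why the
  comparison principle carries an affine barrier, why approximations are controlled only up to a
  logarithm, and why convergence of \<open>v i'\<close> is read off from a monotone quantity:
  \<open>|v i''|\<close> is at most the rate at which H decreases. Limits of solutions are
  identified by comparison alone, without convergence of derivatives.\<close>

text \<open>Second derivatives and Laplacians at a single point, taken along the coordinate lines only: this
  is all that the second derivative test at a maximum needs.\<close>

definition has_d2 :: "(real \<Rightarrow> real) \<Rightarrow> real \<Rightarrow> real \<Rightarrow> bool" where
  "has_d2 g x d \<longleftrightarrow> (\<exists>g'. (\<forall>\<^sub>F t in nhds x. (g has_real_derivative g' t) (at t)) \<and>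
     (g' has_real_derivative d) (at x))"

lemma has_d2I:
  assumes "open U" "x \<in> U" "\<And>t. t \<in> U \<Longrightarrow> (g has_real_derivative g' t) (at t)"
    "(g' has_real_derivative d) (at x)"
  shows "has_d2 g x d"
  unfolding has_d2_def using assms eventually_nhds by blast

lemma has_d2_add:
  assumes "has_d2 f x a" "has_d2 g x b"
  shows "has_d2 (\<lambda>t. f t + g t) x (a + b)"
proof -
  obtain f' g' where
    f: "\<forall>\<^sub>F t in nhds x. (f has_real_derivative f' t) (at t)" "(f' has_real_derivative a) (at x)" and
    g: "\<forall>\<^sub>F t in nhds x. (g has_real_derivative g' t) (at t)" "(g' has_real_derivative b) (at x)"
    using assms unfolding has_d2_def by blast
  have "\<forall>\<^sub>F t in nhds x. ((\<lambda>t. f t + g t) has_real_derivative f' t + g' t) (at t)"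
    using f(1) g(1) by eventually_elim (rule DERIV_add)
  then show ?thesis
    unfolding has_d2_def using DERIV_add[OF f(2) g(2)] by (intro exI conjI)
qed

lemma has_d2_cmult:
  assumes "has_d2 f x a"
  shows "has_d2 (\<lambda>t. c * f t) x (c * a)"
proof -
  obtain f' where
    f: "\<forall>\<^sub>F t in nhds x. (f has_real_derivative f' t) (at t)" "(f' has_real_derivative a) (at x)"
    using assms unfolding has_d2_def by blast
  have "\<forall>\<^sub>F t in nhds x. ((\<lambda>t. c * f t) has_real_derivative c * f' t) (at t)"
    using f(1) by eventually_elim (rule DERIV_cmult)
  then show ?thesis
    unfolding has_d2_def using DERIV_cmult[OF f(2)] by (intro exI conjI)
qed

lemma has_d2_const: "has_d2 (\<lambda>t. c) x 0"
  by (rule has_d2I[of UNIV x _ "\<lambda>t. 0"]) auto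

lemma has_d2_shift:
  assumes "has_d2 f (x + c) d"
  shows "has_d2 (\<lambda>t. f (t + c)) x d"
proof -
  obtain f' where
    f: "\<forall>\<^sub>F t in nhds (x + c). (f has_real_derivative f' t) (at t)" "(f' has_real_derivative d) (at (x + c))"
    using assms unfolding has_d2_def by blast
  have "filterlim (\<lambda>t. t + c) (nhds (x + c)) (nhds x)"
    by (intro tendsto_intros filterlim_ident)
  then have "\<forall>\<^sub>F t in nhds x. (f has_real_derivative f' (t + c)) (at (t + c))"
    using f(1) unfolding filterlim_iff by blast
  then have "\<forall>\<^sub>F t in nhds x. ((\<lambda>t. f (t + c)) has_real_derivative f' (t + c)) (at t)"
    by eventually_elim (simp add: DERIV_shift)
  then show ?thesis
    unfolding has_d2_def using f(2)[unfolded DERIV_shift] by (intro exI conjI)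
qed

lemma has_d2_reflect:
  assumes "has_d2 f (- x) d"
  shows "has_d2 (\<lambda>t. f (- t)) x d"
proof -
  obtain f' where
    f: "\<forall>\<^sub>F t in nhds (- x). (f has_real_derivative f' t) (at t)" "(f' has_real_derivative d) (at (- x))"
    using assms unfolding has_d2_def by blast
  have "filterlim uminus (nhds (- x)) (nhds x)"
    by (intro tendsto_intros filterlim_ident)
  then have "\<forall>\<^sub>F t in nhds x. (f has_real_derivative f' (- t)) (at (- t))"
    using f(1) unfolding filterlim_iff by blast
  then have "\<forall>\<^sub>F t in nhds x. ((\<lambda>t. f (- t)) has_real_derivative - f' (- t)) (at t)"
    by eventually_elim (simp add: DERIV_mirror)
  moreover have "((\<lambda>t. - f' (- t)) has_real_derivative d) (at x)"
    using DERIV_minus[OF f(2)[unfolded DERIV_mirror]] by simp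
  ultimately show ?thesis
    unfolding has_d2_def by (intro exI conjI)
qed

lemma has_d2_cong:
  assumes "has_d2 f x d" "\<forall>\<^sub>F t in nhds x. f t = g t"
  shows "has_d2 g x d"
proof -
  obtain f' where
    f: "\<forall>\<^sub>F t in nhds x. (f has_real_derivative f' t) (at t)" "(f' has_real_derivative d) (at x)"
    using assms unfolding has_d2_def by blast
  have "\<forall>\<^sub>F t in nhds x. \<forall>\<^sub>F s in nhds t. f s = g s"
    using assms(2) by (simp add: eventually_eventually)
  then have "\<forall>\<^sub>F t in nhds x. (g has_real_derivative f' t) (at t)"
    using f(1) by eventually_elim (use DERIV_cong_ev in blast)
  then show ?thesis
    unfolding has_d2_def using f(2) by (intro exI conjI)
qed

text \<open>With d positive, the derivative would vanish at x and be positive just to the right, so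
  g would exceed its maximal value there.\<close>

lemma has_d2_local_max:
  assumes "has_d2 g x d" "\<forall>\<^sub>F t in nhds x. g t \<le> g x"
  shows "d \<le> 0"
proof (rule ccontr)
  assume "\<not> d \<le> 0"
  obtain g' where
    g: "\<forall>\<^sub>F t in nhds x. (g has_real_derivative g' t) (at t) \<and> g t \<le> g x" "(g' has_real_derivative d) (at x)"
    using assms eventually_conj unfolding has_d2_def by blast
  then obtain e where e: "e > 0" "\<And>t. dist t x < e \<Longrightarrow> (g has_real_derivative g' t) (at t) \<and> g t \<le> g x"
    unfolding eventually_nhds_metric by blast
  have "g' x = 0"
    by (rule DERIV_local_max[of g "g' x" x e]) (use e in \<open>auto simp: dist_real_def\<close>)
  obtain h where h: "h > 0" "\<And>t. 0 < t \<Longrightarrow> t < h \<Longrightarrow> g' x < g' (x + t)"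
    using DERIV_pos_inc_right[OF g(2)] \<open>\<not> d \<le> 0\<close> by auto
  define s where "s = min e h / 2"
  have s: "0 < s" "s < e" "s < h" using e h by (auto simp: s_def)
  have "g x < g (x + s)"
  proof (rule DERIV_pos_imp_increasing_open[of x "x + s" g])
    show "x < x + s" using s by simp
    show "\<exists>y. (g has_real_derivative y) (at t) \<and> 0 < y" if "x < t" "t < x + s" for t
      using that e(2)[of t] h(2)[of "t - x"] s \<open>g' x = 0\<close> by (auto simp: dist_real_def)
  next
    show "continuous_on {x..x + s} g"
    proof (rule continuous_at_imp_continuous_on, rule ballI)
      fix t assume "t \<in> {x..x + s}"
      then have "dist t x < e" using s by (auto simp: dist_real_def)
      then show "isCont g t" using e(2) DERIV_isCont by blast
    qed
  qed
  moreover have "g (x + s) \<le> g x" using e(2)[of "x + s"] s by (auto simp: dist_real_def)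
  ultimately show False by simp
qed

section \<open>Laplacians along the coordinate lines\<close>

definition has_lap :: "(complex \<Rightarrow> real) \<Rightarrow> complex \<Rightarrow> real \<Rightarrow> bool" where
  "has_lap f z l \<longleftrightarrow> (\<exists>a b. has_d2 (\<lambda>t. f (z + of_real t)) 0 a \<and>
     has_d2 (\<lambda>t. f (z + \<i> * of_real t)) 0 b \<and> l = a + b)"

lemma has_lap_add:
  assumes "has_lap f z a" "has_lap g z b"
  shows "has_lap (\<lambda>x. f x + g x) z (a + b)"
proof -
  obtain a1 a2 b1 b2 where
    "has_d2 (\<lambda>t. f (z + of_real t)) 0 a1" "has_d2 (\<lambda>t. g (z + of_real t)) 0 b1"
    "has_d2 (\<lambda>t. f (z + \<i> * of_real t)) 0 a2" "has_d2 (\<lambda>t. g (z + \<i> * of_real t)) 0 b2"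
    "a = a1 + a2" "b = b1 + b2"
    using assms unfolding has_lap_def by blast
  then show ?thesis
    unfolding has_lap_def
    by (intro exI[of _ "a1 + b1"] exI[of _ "a2 + b2"] conjI has_d2_add) auto
qed

lemma has_lap_cmult:
  assumes "has_lap f z a"
  shows "has_lap (\<lambda>x. c * f x) z (c * a)"
  using assms unfolding has_lap_def by (metis has_d2_cmult distrib_left)

lemma has_lap_const: "has_lap (\<lambda>x. c) z 0"
  unfolding has_lap_def using has_d2_const by force

lemma has_lap_diff:
  assumes "has_lap f z a" "has_lap g z b"
  shows "has_lap (\<lambda>x. f x - g x) z (a - b)"
  using has_lap_add[OF assms(1) has_lap_cmult[OF assms(2), of "- 1"]] by simp

lemma has_lap_sum:
  assumes "\<And>i. i \<in> I \<Longrightarrow> has_lap (f i) z (a i)"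
  shows "has_lap (\<lambda>x. \<Sum>i\<in>I. f i x) z (\<Sum>i\<in>I. a i)"
  using assms
  by (induction I rule: infinite_finite_induct) (auto intro: has_lap_const has_lap_add)

lemma has_lap_Re:
  assumes "has_d2 f (Re z) d"
  shows "has_lap (\<lambda>x. f (Re x)) z d"
  unfolding has_lap_def
  using has_d2_shift[of f 0 "Re z" d] assms has_d2_const[of "f (Re z)" 0]
  by (intro exI[of _ d] exI[of _ 0]) (simp add: add.commute)

lemma has_lap_Im:
  assumes "has_d2 f (Im z) d"
  shows "has_lap (\<lambda>x. f (Im x)) z d"
  unfolding has_lap_def
  using has_d2_shift[of f 0 "Im z" d] assms has_d2_const[of "f (Im z)" 0]
  by (intro exI[of _ 0] exI[of _ d]) (simp add: add.commute)

lemma has_d2_linear: "has_d2 (\<lambda>t. a + b * t) x 0"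
  by (rule has_d2I[of UNIV x _ "\<lambda>t. b"]) (auto intro!: derivative_eq_intros)

lemma has_d2_square: "has_d2 (\<lambda>t. (t - c)\<^sup>2) x 2"
  by (rule has_d2I[of UNIV x _ "\<lambda>t. 2 * (t - c)"]) (auto intro!: derivative_eq_intros)

lemma has_lap_square_dist: "has_lap (\<lambda>x. (cmod (x - c))\<^sup>2) z 4"
  using has_lap_add[OF has_lap_Re[OF has_d2_square[of "Re c"], of z] has_lap_Im[OF has_d2_square[of "Im c"], of z]]
  by (simp add: cmod_power2)

lemma has_d2_ln_diff_square:
  assumes "(x::real)\<^sup>2 < m"
  shows "has_d2 (\<lambda>t. ln (m - t\<^sup>2)) x (- 2 * (m + x\<^sup>2) / (m - x\<^sup>2)\<^sup>2)"
proof (rule has_d2I[of "{t. t\<^sup>2 < m}" x _ "\<lambda>t. - 2 * t / (m - t\<^sup>2)"])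
  show "open {t. t\<^sup>2 < m}" by (intro open_Collect_less continuous_intros)
  show "((\<lambda>t. - 2 * t / (m - t\<^sup>2)) has_real_derivative - 2 * (m + x\<^sup>2) / (m - x\<^sup>2)\<^sup>2) (at x)"
  proof -
    have "((\<lambda>t. - 2 * t / (m - t\<^sup>2)) has_real_derivative
        (- 2 * (m - x\<^sup>2) - (- 2 * x) * (- (2 * x))) / ((m - x\<^sup>2) * (m - x\<^sup>2))) (at x)"
    proof (rule DERIV_divide)
      show "((\<lambda>t. - 2 * t) has_real_derivative - 2) (at x)" using DERIV_cmult_Id .
      show "((\<lambda>t. m - t\<^sup>2) has_real_derivative - (2 * x)) (at x)" by (auto intro!: derivative_eq_intros)
    qed (use assms in simp)
    moreover have "- 2 * (m - x\<^sup>2) - (- 2 * x) * (- (2 * x)) = - 2 * (m + x\<^sup>2)"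
      by (simp add: power2_eq_square algebra_simps)
    ultimately show ?thesis by (metis power2_eq_square)
  qed
  show "x \<in> {t. t\<^sup>2 < m}" using assms by simp
  show "((\<lambda>t. ln (m - t\<^sup>2)) has_real_derivative - 2 * t / (m - t\<^sup>2)) (at t)" if "t \<in> {t. t\<^sup>2 < m}" for t
    using that by (auto intro!: derivative_eq_intros)
qed

text \<open>Twice this logarithm is the localizing weight of the Keller--Osserman argument: it tends
  to minus infinity at the boundary circle, while its Laplacian is only as singular as the inverse
  square of the weight function.\<close>

lemma has_lap_ln_ball:
  assumes "cmod (z - c) < R"
  shows "has_lap (\<lambda>x. ln (R\<^sup>2 - (cmod (x - c))\<^sup>2)) z (- 4 * R\<^sup>2 / (R\<^sup>2 - (cmod (z - c))\<^sup>2)\<^sup>2)"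
proof -
  define x y where "x = Re (z - c)" and "y = Im (z - c)"
  have n: "(cmod (z - c))\<^sup>2 = x\<^sup>2 + y\<^sup>2" by (simp add: cmod_power2 x_def y_def)
  have "(cmod (z - c))\<^sup>2 < R\<^sup>2" using assms by (simp add: power_strict_mono)
  then have lt: "x\<^sup>2 < R\<^sup>2 - y\<^sup>2" "y\<^sup>2 < R\<^sup>2 - x\<^sup>2" "R\<^sup>2 - x\<^sup>2 - y\<^sup>2 \<noteq> 0" using n by auto
  have e: "(\<lambda>t. ln (R\<^sup>2 - (cmod (z + of_real t - c))\<^sup>2)) = (\<lambda>t. ln ((R\<^sup>2 - y\<^sup>2) - (t + x)\<^sup>2))"
    "(\<lambda>t. ln (R\<^sup>2 - (cmod (z + \<i> * of_real t - c))\<^sup>2)) = (\<lambda>t. ln ((R\<^sup>2 - x\<^sup>2) - (t + y)\<^sup>2))"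
    by (auto simp: cmod_power2 x_def y_def fun_eq_iff add.commute add_diff_eq diff_diff_eq)
  have "has_d2 (\<lambda>t. ln (R\<^sup>2 - (cmod (z + of_real t - c))\<^sup>2)) 0 (- 2 * (R\<^sup>2 - y\<^sup>2 + x\<^sup>2) / (R\<^sup>2 - y\<^sup>2 - x\<^sup>2)\<^sup>2)"
    unfolding e by (rule has_d2_shift) (use has_d2_ln_diff_square[OF lt(1)] in simp)
  moreover have "has_d2 (\<lambda>t. ln (R\<^sup>2 - (cmod (z + \<i> * of_real t - c))\<^sup>2)) 0 (- 2 * (R\<^sup>2 - x\<^sup>2 + y\<^sup>2) / (R\<^sup>2 - x\<^sup>2 - y\<^sup>2)\<^sup>2)"
    unfolding e by (rule has_d2_shift) (use has_d2_ln_diff_square[OF lt(2)] in simp)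
  moreover have "- 4 * R\<^sup>2 / (R\<^sup>2 - (cmod (z - c))\<^sup>2)\<^sup>2 =
    - 2 * (R\<^sup>2 - y\<^sup>2 + x\<^sup>2) / (R\<^sup>2 - y\<^sup>2 - x\<^sup>2)\<^sup>2 + - 2 * (R\<^sup>2 - x\<^sup>2 + y\<^sup>2) / (R\<^sup>2 - x\<^sup>2 - y\<^sup>2)\<^sup>2"
  proof -
    have "R\<^sup>2 - y\<^sup>2 - x\<^sup>2 = R\<^sup>2 - (x\<^sup>2 + y\<^sup>2)" "R\<^sup>2 - x\<^sup>2 - y\<^sup>2 = R\<^sup>2 - (x\<^sup>2 + y\<^sup>2)"
      "- 4 * R\<^sup>2 = - 2 * (R\<^sup>2 - y\<^sup>2 + x\<^sup>2) + - 2 * (R\<^sup>2 - x\<^sup>2 + y\<^sup>2)" by auto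
    then show ?thesis by (simp only: n add_divide_distrib)
  qed
  ultimately show ?thesis
    unfolding has_lap_def by blast
qed

lemma has_lap_local_max:
  assumes "has_lap f z l" "\<forall>\<^sub>F x in nhds z. f x \<le> f z"
  shows "l \<le> 0"
proof -
  obtain a b where ab: "has_d2 (\<lambda>t. f (z + of_real t)) 0 a" "has_d2 (\<lambda>t. f (z + \<i> * of_real t)) 0 b" "l = a + b"
    using assms(1) unfolding has_lap_def by blast
  have "filterlim (\<lambda>t. z + of_real t) (nhds z) (nhds (0::real))"
    "filterlim (\<lambda>t. z + \<i> * of_real t) (nhds z) (nhds (0::real))"
    by (auto intro!: tendsto_eq_intros filterlim_ident)
  then have "\<forall>\<^sub>F t in nhds (0::real). f (z + of_real t) \<le> f (z + of_real 0)"
    "\<forall>\<^sub>F t in nhds (0::real). f (z + \<i> * of_real t) \<le> f (z + \<i> * of_real 0)"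
    using assms(2) unfolding filterlim_iff by auto
  then have "a \<le> 0" "b \<le> 0"
    using has_d2_local_max[OF ab(1)] has_d2_local_max[OF ab(2)] by auto
  then show ?thesis using ab by simp
qed

lemma has_lap_shift:
  assumes "has_lap f (z + c) l"
  shows "has_lap (\<lambda>x. f (x + c)) z l"
  using assms unfolding has_lap_def by (simp add: add_ac)

lemma has_lap_cnj:
  assumes "has_lap f (cnj z) l"
  shows "has_lap (\<lambda>x. f (cnj x)) z l"
proof -
  obtain a b where ab: "has_d2 (\<lambda>t. f (cnj z + of_real t)) 0 a" "has_d2 (\<lambda>t. f (cnj z + \<i> * of_real t)) 0 b" "l = a + b"
    using assms(1) unfolding has_lap_def by blast
  have "has_d2 (\<lambda>t. f (cnj z + \<i> * of_real (- t))) 0 b"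
    using has_d2_reflect[of "\<lambda>t. f (cnj z + \<i> * of_real t)" 0 b] ab by simp
  then show ?thesis
    unfolding has_lap_def using ab by auto
qed

text \<open>Only a component that is largest at a point has to be subharmonic there, which is all
  that a cooperative system provides. \<open>K\<close> acts as a compact fundamental domain: by
  \<open>rep\<close> every value on \<open>D\<close> occurs on \<open>K\<close> with the same real
  part, so a maximum over \<open>K\<close> is a local maximum in \<open>D\<close>.\<close>

lemma max_principle:
  fixes u :: "'i \<Rightarrow> complex \<Rightarrow> real"
  assumes "finite I" "compact K" "K \<subseteq> D"
    and cont: "\<And>i. i \<in> I \<Longrightarrow> continuous_on K (u i)"
    and rep: "\<And>z. z \<in> D \<Longrightarrow> \<exists>z'\<in>K. Re z' = Re z \<and> (\<forall>i\<in>I. u i z' = u i z)"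
    and sub: "\<And>z i. z \<in> K \<Longrightarrow> i \<in> I \<Longrightarrow> u i z > 0 \<Longrightarrow> (\<And>j. j \<in> I \<Longrightarrow> u j z \<le> u i z) \<Longrightarrow>
       z \<in> interior D \<and> (\<exists>l\<ge>0. has_lap (u i) z l)"
    and "z \<in> D" "i \<in> I"
  shows "u i z \<le> 0"
proof (rule ccontr)
  assume "\<not> u i z \<le> 0"
  obtain z0 where z0: "z0 \<in> K" "u i z0 = u i z" using rep \<open>z \<in> D\<close> \<open>i \<in> I\<close> by blast
  obtain B where B: "B > 0" "\<And>x. x \<in> K \<Longrightarrow> cmod x \<le> B"
    using compact_imp_bounded[OF \<open>compact K\<close>] unfolding bounded_pos by blast
  \<comment> \<open>The perturbation \<open>p\<close> makes the inequality strict. It depends on the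
    real part alone, so \<open>rep\<close> respects it, and it stays below half of
    \<open>u i z\<close> on \<open>K\<close>, so the perturbed maximum is still attained where a
    component is positive.\<close>
  define \<delta> where "\<delta> = u i z / (2 * B\<^sup>2)"
  have \<delta>: "\<delta> > 0" "\<delta> * B\<^sup>2 = u i z / 2" using B \<open>\<not> u i z \<le> 0\<close> by (auto simp: \<delta>_def)
  define p where "p x = \<delta> * (Re x - 0)\<^sup>2" for x
  have p: "0 \<le> p x" "x \<in> K \<Longrightarrow> p x \<le> u i z / 2" for x
  proof -
    show "0 \<le> p x" using \<delta> by (simp add: p_def)
    assume "x \<in> K"
    then have "\<bar>Re x\<bar> \<le> B" using B abs_Re_le_cmod order_trans by blast
    then have "(Re x)\<^sup>2 \<le> B\<^sup>2" using B abs_le_square_iff[of "Re x" B] by simp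
    then show "p x \<le> u i z / 2" using \<delta>(2) mult_left_mono[of "(Re x)\<^sup>2" "B\<^sup>2" \<delta>] less_imp_le[OF \<delta>(1)] unfolding p_def diff_0_right by linarith
  qed
  have "\<exists>x\<in>K. \<forall>y\<in>K. u j y + p y \<le> u j x + p x" if "j \<in> I" for j
    using \<open>compact K\<close> z0 cont[OF that]
    by (intro continuous_attains_sup) (auto simp: p_def intro!: continuous_intros)
  then obtain m where m: "\<And>j. j \<in> I \<Longrightarrow> m j \<in> K" "\<And>j y. j \<in> I \<Longrightarrow> y \<in> K \<Longrightarrow> u j y + p y \<le> u j (m j) + p (m j)"
    by metis
  \<comment> \<open>The largest of the perturbed maxima is taken; as \<open>p\<close> is common to
    all components, \<open>u j\<close> dominates the others at \<open>m j\<close>.\<close>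
  obtain j where j: "j \<in> I" "\<And>i. i \<in> I \<Longrightarrow> u i (m i) + p (m i) \<le> u j (m j) + p (m j)"
  proof -
    let ?g = "\<lambda>i. u i (m i) + p (m i)"
    have "Max (?g ` I) \<in> ?g ` I" using \<open>i \<in> I\<close> \<open>finite I\<close> by (intro Max_in) auto
    then obtain j where "j \<in> I" "?g j = Max (?g ` I)" by auto
    then show ?thesis using that \<open>finite I\<close> by simp
  qed
  have max: "u i y + p y \<le> u j (m j) + p (m j)" if "i \<in> I" "y \<in> K" for i y
    using m(2)[OF that] j(2)[OF that(1)] by simp
  have "u i z \<le> u j (m j) + p (m j)"
    using max[OF \<open>i \<in> I\<close> z0(1)] p(1)[of z0] z0(2) by linarith
  then have "u j (m j) > 0" using p(2)[OF m(1)[OF j(1)]] \<open>\<not> u i z \<le> 0\<close> by linarith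
  moreover have "u i (m j) \<le> u j (m j)" if "i \<in> I" for i
    using max[OF that m(1)[OF j(1)]] by simp
  ultimately obtain l where l: "m j \<in> interior D" "l \<ge> 0" "has_lap (u j) (m j) l"
    using sub[OF m(1)[OF j(1)] j(1)] by blast
  have "has_lap (\<lambda>x. u j x + p x) (m j) (l + \<delta> * 2)"
    unfolding p_def using l(3) has_lap_cmult[OF has_lap_Re[OF has_d2_square]] by (rule has_lap_add)
  moreover have "\<forall>\<^sub>F x in nhds (m j). u j x + p x \<le> u j (m j) + p (m j)"
  proof -
    have "\<forall>\<^sub>F x in nhds (m j). x \<in> interior D"
      using l(1) open_interior eventually_nhds_in_open by blast
    then show ?thesis
    proof eventually_elim
      case (elim x)
      then obtain x' where "x' \<in> K" "Re x' = Re x" "u j x' = u j x"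
        using rep interior_subset j(1) by (metis subsetD)
      then show ?case using max[OF j(1), of x'] by (simp add: p_def)
    qed
  qed
  ultimately have "l + \<delta> * 2 \<le> 0" by (rule has_lap_local_max)
  then show False using l \<delta> by simp
qed

section \<open>Periodic families of reals\<close>

text \<open>Indexing by all integers removes the wrap-around cases from the neighbours i - 1 and i +
  1.\<close>

definition iper :: "nat \<Rightarrow> (int \<Rightarrow> 'a) \<Rightarrow> bool" where
  "iper r x \<longleftrightarrow> (\<forall>i. x (i + int r) = x i)"

lemma iper_add_mult:
  assumes "iper r x"
  shows "x (i + int r * m) = x i"
proof (induction m rule: int_induct[of _ 0])
  case (step1 m)
  have "x (i + int r * (m + 1)) = x (i + int r * m + int r)" by (simp add: algebra_simps)
  then show ?case using step1 assms by (simp add: iper_def)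
next
  case (step2 m)
  have "x (i + int r * m) = x (i + int r * (m - 1) + int r)" by (simp add: algebra_simps)
  then show ?case using step2 assms by (simp add: iper_def)
qed simp

lemma iper_mod:
  assumes "iper r x"
  shows "x (i mod int r) = x i"
  using iper_add_mult[OF assms, of "i mod int r" "i div int r"] by simp

lemma iper_shift: "iper r x \<Longrightarrow> iper r (\<lambda>i. x (i + c))"
  unfolding iper_def by (metis add.assoc add.commute)

lemma iper_range:
  assumes "iper r x" "r \<ge> 1"
  shows "\<exists>j\<in>{0..<int r}. x j = x i"
  using iper_mod[OF assms(1), of i] assms(2) by (intro bexI[of _ "i mod int r"]) auto

lemma iper_sum_window:
  fixes g :: "int \<Rightarrow> real"
  assumes "iper r g" "r \<ge> 1"
  shows "(\<Sum>i\<in>{j..<j + int r}. g i) = (\<Sum>i\<in>{0..<int r}. g i)"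
proof (induction j rule: int_induct[of _ 0])
  case (step1 j)
  have "(\<Sum>i\<in>{j + 1..<j + 1 + int r}. g i) + g j = (\<Sum>i\<in>{j + 1..<j + int r}. g i) + g (j + int r) + g j"
  proof -
    have "{j + 1..<j + 1 + int r} = insert (j + int r) {j + 1..<j + int r}" using assms(2) by auto
    then show ?thesis by simp
  qed
  moreover have "(\<Sum>i\<in>{j..<j + int r}. g i) = (\<Sum>i\<in>{j + 1..<j + int r}. g i) + g j"
  proof -
    have "{j..<j + int r} = insert j {j + 1..<j + int r}" using assms(2) by auto
    then show ?thesis by simp
  qed
  moreover have "g (j + int r) = g j" using assms(1) by (simp add: iper_def)
  ultimately show ?case using step1 by simp
next
  case (step2 j)
  have "(\<Sum>i\<in>{j - 1..<j - 1 + int r}. g i) + g (j - 1 + int r) = (\<Sum>i\<in>{j - 1..<j + int r}. g i)"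
  proof -
    have "{j - 1..<j + int r} = insert (j - 1 + int r) {j - 1..<j - 1 + int r}" using assms(2) by auto
    then show ?thesis by simp
  qed
  moreover have "(\<Sum>i\<in>{j - 1..<j + int r}. g i) = (\<Sum>i\<in>{j..<j + int r}. g i) + g (j - 1)"
  proof -
    have "{j - 1..<j + int r} = insert (j - 1) {j..<j + int r}" using assms(2) by auto
    then show ?thesis by simp
  qed
  moreover have "g (j - 1 + int r) = g (j - 1)" using assms(1) by (simp add: iper_def)
  ultimately show ?case using step2 by simp
qed simp

lemma iper_sum_shift:
  fixes g :: "int \<Rightarrow> real"
  assumes "iper r g" "r \<ge> 1"
  shows "(\<Sum>i\<in>{0..<int r}. g (i + c)) = (\<Sum>i\<in>{0..<int r}. g i)"
proof -
  have "(\<Sum>i\<in>{0..<int r}. g (i + c)) = (\<Sum>i\<in>{c..<c + int r}. g i)"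
    by (rule sum.reindex_bij_witness[of _ "\<lambda>i. i - c" "\<lambda>i. i + c"]) auto
  then show ?thesis using iper_sum_window[OF assms] by simp
qed

text \<open>Every value is reached from j by fewer than r forward steps, along which one-sided
  bounds on increments can be added up.\<close>

lemma iper_diff_window:
  assumes "iper r x" "r \<ge> 1"
  obtains n where "n < r" "x i = x (j + int n)"
proof -
  have "x ((i - j) mod int r + j) = x i"
    using iper_mod[OF iper_shift[OF assms(1), of j], of "i - j"] by simp
  then show ?thesis using that[of "nat ((i - j) mod int r)"] assms(2)
    by (simp add: add.commute nat_less_iff)
qed

lemma iper_diff_le_total_variation:
  fixes x :: "int \<Rightarrow> real"
  assumes "iper r x" "r \<ge> 1"
  shows "x i - x j \<le> (\<Sum>l\<in>{0..<int r}. \<bar>x l - x (l - 1)\<bar>)"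
proof -
  obtain n where n: "n < r" "x i = x (j + int n)" using iper_diff_window[OF assms] by blast
  have "x (j + int n) - x j \<le> (\<Sum>l\<in>{j + 1..<j + 1 + int n}. \<bar>x l - x (l - 1)\<bar>)"
  proof (induction n)
    case (Suc n)
    have "{j + 1..<j + 1 + int (Suc n)} = insert (j + 1 + int n) {j + 1..<j + 1 + int n}" by auto
    moreover have "x (j + int (Suc n)) - x (j + int n) \<le> \<bar>x (j + 1 + int n) - x (j + 1 + int n - 1)\<bar>"
      by (simp add: algebra_simps)
    ultimately show ?case using Suc by simp
  qed simp
  also have "\<dots> \<le> (\<Sum>l\<in>{j + 1..<j + 1 + int r}. \<bar>x l - x (l - 1)\<bar>)"
    using n by (intro sum_mono2) auto
  also have "\<dots> = (\<Sum>l\<in>{0..<int r}. \<bar>x l - x (l - 1)\<bar>)"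
    using assms(1) iper_shift[OF assms(1), of "- 1"]
    by (intro iper_sum_window[OF _ assms(2)]) (simp add: iper_def)
  finally show ?thesis using n by simp
qed

lemma iper_diff_square_le:
  fixes x :: "int \<Rightarrow> real"
  assumes "iper r x" "r \<ge> 1"
  shows "(x i - x j)\<^sup>2 \<le> r * (\<Sum>l\<in>{0..<int r}. (x l - x (l - 1))\<^sup>2)"
proof -
  have "\<bar>x i - x j\<bar> \<le> \<bar>\<Sum>l\<in>{0..<int r}. \<bar>x l - x (l - 1)\<bar>\<bar>"
    using iper_diff_le_total_variation[OF assms, of i j] iper_diff_le_total_variation[OF assms, of j i]
    by linarith
  then have "(x i - x j)\<^sup>2 \<le> (\<Sum>l\<in>{0..<int r}. \<bar>x l - x (l - 1)\<bar>)\<^sup>2"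
    by (simp only: abs_le_square_iff)
  also have "\<dots> \<le> (\<Sum>l\<in>{0..<int r}. \<bar>x l - x (l - 1)\<bar>\<^sup>2) * card {0..<int r}"
    by (rule sum_squared_le_sum_of_squares)
  finally show ?thesis by (simp add: mult.commute)
qed

text \<open>Upper bounds on increments suffice for a two-sided estimate: on a cycle every
  difference, of either sign, is a sum of forward increments. Averaging over j, with zero sum, turns
  differences into values.\<close>

lemma iper_bound_of_increments:
  fixes x :: "int \<Rightarrow> real"
  assumes "iper r x" "r \<ge> 1" "(\<Sum>i\<in>{0..<int r}. x i) = 0" "\<And>i. x i - x (i - 1) \<le> \<eta>" "\<eta> \<ge> 0"
  shows "\<bar>x i\<bar> \<le> r * \<eta>"
proof -
  have *: "x i - x j \<le> r * \<eta>" for i j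
  proof -
    obtain n where n: "n < r" "x i = x (j + int n)" using iper_diff_window[OF assms(1,2)] by blast
    have "x (j + int n) - x j \<le> n * \<eta>"
    proof (induction n)
      case (Suc n)
      have "x (j + int (Suc n)) - x (j + int n) \<le> \<eta>"
        using assms(4)[of "j + int (Suc n)"] by (simp add: algebra_simps)
      then show ?case using Suc by (simp add: algebra_simps)
    qed simp
    also have "n * \<eta> \<le> r * \<eta>" using n assms(5) by (intro mult_right_mono) auto
    finally show ?thesis using n by simp
  qed
  have "r * x i = (\<Sum>j\<in>{0..<int r}. x i - x j)" using assms(3) by (simp add: sum_subtractf)
  also have "\<dots> \<le> (\<Sum>j\<in>{0..<int r}. r * \<eta>)" by (intro sum_mono *)
  finally have 1: "x i \<le> r * \<eta>" using assms(2) by simp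
  have "r * (- x i) = (\<Sum>j\<in>{0..<int r}. x j - x i)" using assms(3) by (simp add: sum_subtractf)
  also have "\<dots> \<le> (\<Sum>j\<in>{0..<int r}. r * \<eta>)" by (intro sum_mono *)
  finally have "- x i \<le> r * \<eta>" using assms(2) mult_le_cancel_left_pos[of "real r" "- x i" "r * \<eta>"] by simp
  with 1 show ?thesis by simp
qed

section \<open>Exponential sums of families with zero sum\<close>

lemma sum_zero_obtains_nonpos:
  fixes p :: "int \<Rightarrow> real"
  assumes "(\<Sum>i\<in>{0..<int r}. p i) = 0" "r \<ge> 1"
  obtains j where "j \<in> {0..<int r}" "p j \<le> 0"
proof (rule ccontr)
  assume "\<not> thesis"
  then have "\<And>j. j \<in> {0..<int r} \<Longrightarrow> p j > 0" using that by force
  then have "(\<Sum>i\<in>{0..<int r}. p i) > 0" using assms(2) by (intro sum_pos) auto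
  then show False using assms by simp
qed

text \<open>The geometric mean of the \<open>P i\<close> is 1, so some \<open>P j\<close> is at most
  1 while another is at least \<open>S / r\<close>. For \<open>S \<ge> 2 * r\<close> the gap is at
  least \<open>S / (2 * r)\<close>, and Cauchy--Schwarz bounds it by the steps around the
  cycle.\<close>

lemma sum_exp_square_le:
  fixes p P :: "int \<Rightarrow> real" and r :: nat and S :: real
  defines "(P :: int \<Rightarrow> real) \<equiv> \<lambda>i. exp (2 * p i)"
  defines "(S :: real) \<equiv> (\<Sum>i\<in>{0..<int r}. P i)"
  assumes "iper r p" "r \<ge> 1" "(\<Sum>i\<in>{0..<int r}. p i) = 0" "S \<ge> 2 * r"
  shows "S\<^sup>2 \<le> 4 * r ^ 3 * (\<Sum>i\<in>{0..<int r}. (P i - P (i - 1))\<^sup>2)"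
proof -
  obtain j where j: "p j \<le> 0" using sum_zero_obtains_nonpos assms(4,5) by metis
  have "(\<Sum>i\<in>{0..<int r}. S / r - P i) = 0" using assms(4) by (simp add: sum_subtractf S_def)
  then obtain i where i: "S / r \<le> P i" using sum_zero_obtains_nonpos[of "\<lambda>i. S / r - P i"] assms(4) by force
  have "iper r P" using assms(3) by (simp add: iper_def P_def)
  have "P j \<le> 1" using j by (simp add: P_def)
  moreover have "S / r - S / (2 * r) \<ge> 1" using assms(4,6) by (simp add: field_simps)
  ultimately have "S / (2 * r) \<le> P i - P j" using i by linarith
  then have "(S / (2 * r))\<^sup>2 \<le> (P i - P j)\<^sup>2" using assms(4,6) by (intro power_mono) auto
  also have "\<dots> \<le> r * (\<Sum>i\<in>{0..<int r}. (P i - P (i - 1))\<^sup>2)"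
    by (rule iper_diff_square_le) fact+
  finally have "(2 * r)\<^sup>2 * (S / (2 * r))\<^sup>2 \<le> (2 * r)\<^sup>2 * (r * (\<Sum>i\<in>{0..<int r}. (P i - P (i - 1))\<^sup>2))"
    by (intro mult_left_mono) auto
  then show ?thesis using assms(4) by (simp add: power2_eq_square power3_eq_cube)
qed

text \<open>The same gap argument without assuming the sum large. It is the tool for the right end
  of the cylinder, where small steps force the sum close to its minimum r.\<close>

lemma sum_exp_le:
  fixes p P :: "int \<Rightarrow> real" and r :: nat
  defines "(P :: int \<Rightarrow> real) \<equiv> \<lambda>i. exp (2 * p i)"
  assumes "iper r p" "r \<ge> 1" "(\<Sum>i\<in>{0..<int r}. p i) = 0"
  shows "(\<Sum>i\<in>{0..<int r}. P i) \<le> r * (1 + sqrt (r * (\<Sum>i\<in>{0..<int r}. (P i - P (i - 1))\<^sup>2)))" (is "_ \<le> r * (1 + sqrt ?D)")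
proof -
  obtain j where j: "p j \<le> 0" using sum_zero_obtains_nonpos assms(3,4) by metis
  have "iper r P" using assms(2) by (simp add: iper_def P_def)
  have "P j \<le> 1" using j by (simp add: P_def)
  have "P i \<le> 1 + sqrt ?D" for i
    using real_le_rsqrt[OF iper_diff_square_le[OF \<open>iper r P\<close> assms(3), of i j]] \<open>P j \<le> 1\<close> by linarith
  then have "(\<Sum>i\<in>{0..<int r}. P i) \<le> (\<Sum>i\<in>{0..<int r}. 1 + sqrt ?D)" by (intro sum_mono)
  then show ?thesis by simp
qed

lemma sum_exp_ge:
  fixes p :: "int \<Rightarrow> real" and r :: nat
  assumes "(\<Sum>i\<in>{0..<int r}. p i) = 0"
  shows "(\<Sum>i\<in>{0..<int r}. exp (2 * p i)) \<ge> r"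
proof -
  have "r = (\<Sum>i\<in>{0..<int r}. 1 + 2 * p i)"
    using assms by (simp add: sum.distrib sum_distrib_left[symmetric])
  also have "\<dots> \<le> (\<Sum>i\<in>{0..<int r}. exp (2 * p i))" by (intro sum_mono exp_ge_add_one_self)
  finally show ?thesis .
qed

text \<open>The excess of the sum over r is a sum of nonnegative terms
  \<open>exp (2 * p) - 1 - 2 * p\<close>, each at least \<open>2 * p^2\<close> when p is
  nonnegative. Control of the positive increments is all that
  \<open>iper_bound_of_increments\<close> asks for.\<close>

lemma square_le_sum_exp:
  fixes p :: "int \<Rightarrow> real" and r :: nat
  assumes "iper r p" "r \<ge> 1" "(\<Sum>i\<in>{0..<int r}. p i) = 0" "p i \<ge> 0"
  shows "2 * (p i)\<^sup>2 \<le> (\<Sum>i\<in>{0..<int r}. exp (2 * p i)) - r"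
proof -
  obtain j where j: "j \<in> {0..<int r}" "p j = p i" using iper_range[OF assms(1,2)] by blast
  have "2 * (p i)\<^sup>2 \<le> exp (2 * p j) - (1 + 2 * p j)"
    using exp_lower_Taylor_quadratic[of "2 * p i"] assms(4) j by (simp add: power2_eq_square)
  also have "\<dots> \<le> (\<Sum>i\<in>{0..<int r}. exp (2 * p i) - (1 + 2 * p i))"
    by (rule member_le_sum[OF j(1)]) (auto simp: exp_ge_add_one_self)
  also have "\<dots> = (\<Sum>i\<in>{0..<int r}. exp (2 * p i)) - r"
    using assms(3) by (simp add: sum_subtractf sum.distrib sum_distrib_left[symmetric])
  finally show ?thesis .
qed

section \<open>The comparison principle and the Keller--Osserman estimate\<close>

text \<open>\<open>G\<close> is a parameter because comparison is needed for the exponential, for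
  its clipped version and, with the identity, as a scalar maximum principle.\<close>

definition toda_term :: "(real \<Rightarrow> real) \<Rightarrow> (int \<Rightarrow> real) \<Rightarrow> int \<Rightarrow> real" where
  "toda_term G x i = G (x i - x (i - 1)) - G (x (i + 1) - x i)"

text \<open>The lifted system has k = 2 r^2. Index periodicity is demanded at every point, so that
  it is available also on the boundary of \<open>U\<close>, where the equation is not
  assumed.\<close>

definition toda_on :: "real \<Rightarrow> nat \<Rightarrow> complex set \<Rightarrow> (int \<Rightarrow> complex \<Rightarrow> real) \<Rightarrow> bool" where
  "toda_on k r U v \<longleftrightarrow> (\<forall>z. iper r (\<lambda>i. v i z)) \<and> (\<forall>z\<in>U. (\<Sum>i\<in>{0..<int r}. v i z) = 0) \<and>
     (\<forall>i. continuous_on U (v i)) \<and>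
     (\<forall>z\<in>U. \<forall>i. has_lap (v i) z (k * exp (2 * Re z) * toda_term (\<lambda>x. exp (2 * x)) (\<lambda>j. v j z) i))"

lemma toda_onD:
  assumes "toda_on k r U v"
  shows "iper r (\<lambda>i. v i z)" "z \<in> U \<Longrightarrow> (\<Sum>i\<in>{0..<int r}. v i z) = 0" "continuous_on U (v i)"
    "z \<in> U \<Longrightarrow> has_lap (v i) z (k * exp (2 * Re z) * toda_term (\<lambda>x. exp (2 * x)) (\<lambda>j. v j z) i)"
  using assms unfolding toda_on_def by auto

lemma toda_on_subset: "toda_on k r U v \<Longrightarrow> V \<subseteq> U \<Longrightarrow> toda_on k r V v"
  unfolding toda_on_def by (meson continuous_on_subset subsetD)

definition strip :: "real \<Rightarrow> real \<Rightarrow> complex set" where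
  "strip a b = {z. a \<le> Re z \<and> Re z \<le> b}"

definition vper :: "(complex \<Rightarrow> real) \<Rightarrow> bool" where
  "vper f \<longleftrightarrow> (\<forall>z. f (z + of_real (2 * pi) * \<i>) = f z)"

lemma vper_int:
  assumes "vper f"
  shows "f (z + of_real (2 * pi * of_int m) * \<i>) = f z"
proof (induction m rule: int_induct[of _ 0])
  case (step1 m)
  have "z + of_real (2 * pi * of_int (m + 1)) * \<i> = (z + of_real (2 * pi * of_int m) * \<i>) + of_real (2 * pi) * \<i>"
    by (simp add: algebra_simps)
  then show ?case using step1 assms by (simp only: vper_def)
next
  case (step2 m)
  have "z + of_real (2 * pi * of_int m) * \<i> = (z + of_real (2 * pi * of_int (m - 1)) * \<i>) + of_real (2 * pi) * \<i>"
    by (simp add: algebra_simps)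
  then show ?case using step2 assms by (metis vper_def)
qed simp

lemma strip_interior: "{z. a < Re z \<and> Re z < b} \<subseteq> interior (strip a b)"
  by (rule interior_maximal)
    (auto simp: strip_def intro!: open_Collect_conj open_Collect_less continuous_intros)

text \<open>Where x i - y i is the largest of the differences, the increment into i is at least as
  large for x as for y, and the increment out of i at most as large; monotonicity of
  \<open>G\<close> then gives the sign of the Laplacian. The affine function on the right is
  harmonic, hence free, and allows for linear growth at one edge.\<close>

lemma comparison:
  fixes x y :: "int \<Rightarrow> complex \<Rightarrow> real"
  assumes "r \<ge> 1" "mono G" "k \<ge> 0"
    and per: "\<And>z. iper r (\<lambda>i. x i z)" "\<And>z. iper r (\<lambda>i. y i z)"
    and vper: "\<And>i. vper (x i)" "\<And>i. vper (y i)"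
    and cont: "\<And>i. continuous_on (strip a b) (x i)" "\<And>i. continuous_on (strip a b) (y i)"
    and sub: "\<And>z i. a < Re z \<Longrightarrow> Re z < b \<Longrightarrow>
      \<exists>l. has_lap (x i) z l \<and> k * exp (2 * Re z) * toda_term G (\<lambda>j. x j z) i \<le> l"
    and super: "\<And>z i. a < Re z \<Longrightarrow> Re z < b \<Longrightarrow>
      \<exists>l. has_lap (y i) z l \<and> l \<le> k * exp (2 * Re z) * toda_term G (\<lambda>j. y j z) i"
    and bdry: "\<And>z i. Re z = a \<or> Re z = b \<Longrightarrow> x i z - y i z \<le> \<alpha> + \<beta> * Re z"
    and "z \<in> strip a b"
  shows "x i z - y i z \<le> \<alpha> + \<beta> * Re z"
proof -
  define u where "u i z = (x i z - y i z) - (\<alpha> + \<beta> * Re z)" for i z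
  have "u j z \<le> 0" if "j \<in> {0..<int r}" for j
  proof (rule max_principle[of "{0..<int r}" "cbox (Complex a 0) (Complex b (2 * pi))" "strip a b" u])
    show "cbox (Complex a 0) (Complex b (2 * pi)) \<subseteq> strip a b"
      by (auto simp: strip_def in_cbox_complex_iff)
    then show "continuous_on (cbox (Complex a 0) (Complex b (2 * pi))) (u i)" for i
      unfolding u_def using cont by (intro continuous_intros) (auto intro: continuous_on_subset)
    show "\<exists>z'\<in>cbox (Complex a 0) (Complex b (2 * pi)). Re z' = Re z \<and> (\<forall>i\<in>{0..<int r}. u i z' = u i z)"
      if "z \<in> strip a b" for z
    proof -
      define m where "m = - \<lfloor>Im z / (2 * pi)\<rfloor>"
      define z' where "z' = z + of_real (2 * pi * of_int m) * \<i>"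
      have "Re z' = Re z" "Im z' = Im z + 2 * pi * of_int m" by (auto simp: z'_def)
      moreover have "0 \<le> Im z + 2 * pi * of_int m" "Im z + 2 * pi * of_int m \<le> 2 * pi"
      proof -
        have "of_int \<lfloor>Im z / (2 * pi)\<rfloor> * (2 * pi) \<le> Im z" "Im z \<le> (of_int \<lfloor>Im z / (2 * pi)\<rfloor> + 1) * (2 * pi)"
          using floor_divide_lower[of "2 * pi" "Im z"] less_imp_le[OF floor_divide_upper[of "2 * pi" "Im z"]] by simp_all
        then show "0 \<le> Im z + 2 * pi * of_int m" "Im z + 2 * pi * of_int m \<le> 2 * pi"
          unfolding m_def of_int_minus mult_minus_right distrib_right mult.commute[of "2 * pi"] by linarith+
      qed
      ultimately have "z' \<in> cbox (Complex a 0) (Complex b (2 * pi))"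
        using that by (auto simp: in_cbox_complex_iff strip_def)
      moreover have "u i z' = u i z" for i
        using vper_int[OF vper(1), of i z m] vper_int[OF vper(2), of i z m] \<open>Re z' = Re z\<close>
        unfolding z'_def u_def by simp
      ultimately show ?thesis using \<open>Re z' = Re z\<close> by blast
    qed
    show "z \<in> interior (strip a b) \<and> (\<exists>l\<ge>0. has_lap (u i) z l)"
      if "z \<in> cbox (Complex a 0) (Complex b (2 * pi))" "i \<in> {0..<int r}" "u i z > 0"
        "\<And>j. j \<in> {0..<int r} \<Longrightarrow> u j z \<le> u i z" for z i
    proof -
      have "Re z \<noteq> a" "Re z \<noteq> b" using bdry[of z i] that(3) by (auto simp: u_def)
      then have z: "a < Re z" "Re z < b" using that(1) by (auto simp: in_cbox_complex_iff)
      obtain l m where l: "has_lap (x i) z l" "k * exp (2 * Re z) * toda_term G (\<lambda>j. x j z) i \<le> l" and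
        m: "has_lap (y i) z m" "m \<le> k * exp (2 * Re z) * toda_term G (\<lambda>j. y j z) i"
        using sub[OF z] super[OF z] by blast
      \<comment> \<open>The hypothesis concerns only r representatives; periodicity extends it to i
        - 1 and i + 1, which may lie outside that window.\<close>
      have le: "u j z \<le> u i z" for j
      proof -
        have "iper r (\<lambda>i. u i z)" using per unfolding iper_def u_def by auto
        then show ?thesis using that(4) iper_range[of r "\<lambda>i. u i z" j] \<open>r \<ge> 1\<close> by force
      qed
      have "toda_term G (\<lambda>j. y j z) i \<le> toda_term G (\<lambda>j. x j z) i"
        unfolding toda_term_def using le[of "i - 1"] le[of "i + 1"]
        by (intro diff_mono[of "G _" "G _"] monoD[OF \<open>mono G\<close>]) (auto simp: u_def)
      then have "k * exp (2 * Re z) * toda_term G (\<lambda>j. y j z) i \<le> k * exp (2 * Re z) * toda_term G (\<lambda>j. x j z) i"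
        using \<open>k \<ge> 0\<close> by (intro mult_left_mono) auto
      then have "l - m - 0 \<ge> 0" using l m by simp
      moreover have "has_lap (u i) z (l - m - 0)"
        unfolding u_def by (intro has_lap_diff l m has_lap_Re[OF has_d2_linear])
      ultimately show ?thesis using z strip_interior by blast
    qed
  qed (use \<open>z \<in> strip a b\<close> that in auto)
  then have "u i z \<le> 0"
  proof -
    have "iper r (\<lambda>i. u i z)" using per unfolding iper_def u_def by auto
    then show ?thesis using \<open>\<And>j. j \<in> {0..<int r} \<Longrightarrow> u j z \<le> 0\<close> iper_range[of r "\<lambda>i. u i z" i] \<open>r \<ge> 1\<close> by force
  qed
  then show ?thesis by (simp add: u_def)
qed

text \<open>Summation by parts around the cycle: the positive discrete Laplacian of
  \<open>P\<close>, paired with \<open>P\<close>, is its Dirichlet energy.\<close>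

lemma sum_log_convexity:
  fixes P :: "int \<Rightarrow> real"
  assumes "iper r P" "r \<ge> 1"
  shows "(\<Sum>i\<in>{0..<int r}. P i * (2 * P i - P (i - 1) - P (i + 1))) = (\<Sum>i\<in>{0..<int r}. (P i - P (i - 1))\<^sup>2)"
proof -
  let ?S = "\<lambda>f. \<Sum>i\<in>{0..<int r}. f i"
  have P: "iper r (\<lambda>i. P (i - 1))" using iper_shift[OF assms(1), of "- 1"] by simp
  have "?S (\<lambda>i. (P (i - 1))\<^sup>2) = ?S (\<lambda>i. (P i)\<^sup>2)"
    using iper_sum_shift[of r "\<lambda>i. (P i)\<^sup>2" "- 1"] assms by (simp add: iper_def)
  moreover have "?S (\<lambda>i. P i * P (i + 1)) = ?S (\<lambda>i. P i * P (i - 1))"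
    using iper_sum_shift[of r "\<lambda>i. P i * P (i - 1)" 1] assms P by (simp add: iper_def mult.commute)
  moreover have "?S (\<lambda>i. P i * (2 * P i - P (i - 1) - P (i + 1))) =
    2 * ?S (\<lambda>i. (P i)\<^sup>2) - ?S (\<lambda>i. P i * P (i - 1)) - ?S (\<lambda>i. P i * P (i + 1))"
    by (simp add: sum_subtractf[symmetric] sum_distrib_left algebra_simps power2_eq_square)
  moreover have "?S (\<lambda>i. (P i - P (i - 1))\<^sup>2) =
    ?S (\<lambda>i. (P i)\<^sup>2) + ?S (\<lambda>i. (P (i - 1))\<^sup>2) - 2 * ?S (\<lambda>i. P i * P (i - 1))"
    by (simp add: sum_subtractf[symmetric] sum.distrib[symmetric] sum_distrib_left power2_diff mult.assoc)
  ultimately show ?thesis by simp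
qed

definition expsum :: "nat \<Rightarrow> (int \<Rightarrow> complex \<Rightarrow> real) \<Rightarrow> complex \<Rightarrow> real" where
  "expsum r v z = (\<Sum>i\<in>{0..<int r}. exp (2 * (v i z - v (i - 1) z)))"

text \<open>The Dirichlet energy of the cyclic sequence whose sum is \<open>expsum\<close>.\<close>

definition expvar :: "nat \<Rightarrow> (int \<Rightarrow> complex \<Rightarrow> real) \<Rightarrow> complex \<Rightarrow> real" where
  "expvar r v z = (\<Sum>i\<in>{0..<int r}. (exp (2 * (v i z - v (i - 1) z)) - exp (2 * (v (i - 1) z - v (i - 2) z)))\<^sup>2)"

lemma expsum_pos: "r \<ge> 1 \<Longrightarrow> expsum r v z > 0"
  unfolding expsum_def by (intro sum_pos) auto

text \<open>Convexity of log-sum-exp, whose gradient at q has the entries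
  \<open>exp (q i) / S q\<close>. It is Gibbs' inequality for two probability vectors, obtained term
  by term from \<open>ln x \<le> x - 1\<close>.\<close>

lemma log_sum_exp_tangent:
  fixes p q :: "int \<Rightarrow> real"
  assumes "finite I" "I \<noteq> {}"
  defines "S \<equiv> \<lambda>p. (\<Sum>i\<in>I. exp (p i) :: real)"
  shows "(\<Sum>i\<in>I. exp (q i) / S q * (p i - q i)) \<le> ln (S p) - ln (S q)"
proof -
  have S: "S p > 0" for p unfolding S_def using assms by (intro sum_pos) auto
  have "exp (q i) / S q * (p i - q i - (ln (S p) - ln (S q))) \<le> exp (p i) / S p - exp (q i) / S q" for i
  proof -
    have "p i - q i - (ln (S p) - ln (S q)) = ln (exp (p i) * S q / (exp (q i) * S p))"
      using S[of p] S[of q] by (simp add: ln_div ln_mult)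
    also have "\<dots> \<le> exp (p i) * S q / (exp (q i) * S p) - 1"
      using S[of p] S[of q] by (intro ln_le_minus_one) simp
    finally have "exp (q i) / S q * (p i - q i - (ln (S p) - ln (S q))) \<le> exp (q i) / S q * (exp (p i) * S q / (exp (q i) * S p) - 1)"
      using S[of q] by (intro mult_left_mono) auto
    also have "\<dots> = exp (p i) / S p - exp (q i) / S q" using S[of p] S[of q] by (simp add: field_simps)
    finally show ?thesis .
  qed
  then have "(\<Sum>i\<in>I. exp (q i) / S q * (p i - q i - (ln (S p) - ln (S q)))) \<le> (\<Sum>i\<in>I. exp (p i) / S p - exp (q i) / S q)"
    by (rule sum_mono)
  also have "\<dots> = 0"
    using S[of p] S[of q] by (simp add: sum_subtractf sum_divide_distrib[symmetric]) (simp add: S_def)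
  finally have "(\<Sum>i\<in>I. exp (q i) / S q * (p i - q i)) \<le> (\<Sum>i\<in>I. exp (q i) / S q * (ln (S p) - ln (S q)))"
    by (simp add: right_diff_distrib sum_subtractf)
  also have "\<dots> = (\<Sum>i\<in>I. exp (q i)) / S q * (ln (S p) - ln (S q))"
    by (simp add: sum_divide_distrib sum_distrib_right)
  also have "\<dots> = ln (S p) - ln (S q)" using S[of q] by (simp add: S_def)
  finally show ?thesis .
qed

text \<open>At the maximum, \<open>log S\<close> is replaced by its tangent, a fixed convex combination of the
  \<open>2 (v\<^sub>i - v\<^sub>i\<^sub>-\<^sub>1)\<close>; so no gradient of \<open>S\<close> appears.\<close>

lemma expsum_at_local_max:
  assumes "r \<ge> 1" "iper r (\<lambda>i. v i z)"
    and lap: "\<And>i. has_lap (v i) z (k * exp (2 * Re z) * toda_term (\<lambda>x. exp (2 * x)) (\<lambda>j. v j z) i)"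
    and b: "has_lap b z m"
    and max: "\<forall>\<^sub>F x in nhds z. ln (expsum r v x) + b x \<le> ln (expsum r v z) + b z"
  shows "2 * k * exp (2 * Re z) * expvar r v z + m * expsum r v z \<le> 0"
proof -
  define P where "P i x = exp (2 * (v i x - v (i - 1) x))" for i x
  define c where "c i = P i z / expsum r v z" for i
  have "iper r (\<lambda>i. v (i - 1) z)" using iper_shift[OF assms(2), of "- 1"] by simp
  then have P: "iper r (\<lambda>i. P i z)" using assms(2) by (simp add: P_def iper_def)
  have "\<forall>\<^sub>F x in nhds z. (\<Sum>i\<in>{0..<int r}. c i * (2 * (v i x - v (i - 1) x))) + b x
      \<le> (\<Sum>i\<in>{0..<int r}. c i * (2 * (v i z - v (i - 1) z))) + b z"
    using max
  proof eventually_elim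
    case (elim x)
    have "(\<Sum>i\<in>{0..<int r}. c i * (2 * (v i x - v (i - 1) x) - 2 * (v i z - v (i - 1) z))) \<le> ln (expsum r v x) - ln (expsum r v z)"
      unfolding c_def P_def expsum_def using assms(1) by (intro log_sum_exp_tangent) auto
    then show ?case using elim by (simp add: right_diff_distrib sum_subtractf)
  qed
  moreover have "has_lap (\<lambda>x. (\<Sum>i\<in>{0..<int r}. c i * (2 * (v i x - v (i - 1) x))) + b x) z
     ((\<Sum>i\<in>{0..<int r}. c i * (2 * (k * exp (2 * Re z) * toda_term (\<lambda>x. exp (2 * x)) (\<lambda>j. v j z) i -
       k * exp (2 * Re z) * toda_term (\<lambda>x. exp (2 * x)) (\<lambda>j. v j z) (i - 1)))) + m)"
    by (intro has_lap_add has_lap_sum has_lap_cmult has_lap_diff lap b)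
  ultimately have "(\<Sum>i\<in>{0..<int r}. c i * (2 * (k * exp (2 * Re z) * toda_term (\<lambda>x. exp (2 * x)) (\<lambda>j. v j z) i -
       k * exp (2 * Re z) * toda_term (\<lambda>x. exp (2 * x)) (\<lambda>j. v j z) (i - 1)))) + m \<le> 0"
    by (rule has_lap_local_max[rotated])
  moreover have "(\<Sum>i\<in>{0..<int r}. c i * (2 * (k * exp (2 * Re z) * toda_term (\<lambda>x. exp (2 * x)) (\<lambda>j. v j z) i -
       k * exp (2 * Re z) * toda_term (\<lambda>x. exp (2 * x)) (\<lambda>j. v j z) (i - 1)))) =
       2 * k * exp (2 * Re z) / expsum r v z * (\<Sum>i\<in>{0..<int r}. P i z * (2 * P i z - P (i - 1) z - P (i + 1) z))"
    unfolding sum_distrib_left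
    by (intro sum.cong) (simp_all add: toda_term_def c_def P_def algebra_simps)
  moreover have "(\<Sum>i\<in>{0..<int r}. P i z * (2 * P i z - P (i - 1) z - P (i + 1) z)) = expvar r v z"
    using sum_log_convexity[OF P assms(1)] by (simp add: expvar_def P_def)
  ultimately have "2 * k * exp (2 * Re z) / expsum r v z * expvar r v z + m \<le> 0" by simp
  then have "(2 * k * exp (2 * Re z) / expsum r v z * expvar r v z + m) * expsum r v z \<le> 0"
    using expsum_pos[OF assms(1), of v z] by (intro mult_nonpos_nonneg) auto
  moreover have "(2 * k * exp (2 * Re z) / expsum r v z * expvar r v z + m) * expsum r v z =
    2 * k * exp (2 * Re z) * expvar r v z + m * expsum r v z"
    using expsum_pos[OF assms(1), of v z] by (simp add: field_simps)
  ultimately show ?thesis by simp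
qed

lemma continuous_on_expsum:
  assumes "\<And>i. continuous_on U (v i)"
  shows "continuous_on U (expsum r v)"
  unfolding expsum_def using assms by (intro continuous_intros) auto

lemma toda_increments:
  assumes "r \<ge> 1" "toda_on k r U v" "z \<in> U"
  shows "iper r (\<lambda>i. v i z - v (i - 1) z)" "(\<Sum>i\<in>{0..<int r}. v i z - v (i - 1) z) = 0"
proof -
  have v: "iper r (\<lambda>i. v i z)" by (rule toda_onD[OF assms(2)])
  then have "iper r (\<lambda>i. v (i - 1) z)" using iper_shift[of r "\<lambda>i. v i z" "- 1"] by simp
  with v show "iper r (\<lambda>i. v i z - v (i - 1) z)" by (simp add: iper_def)
  show "(\<Sum>i\<in>{0..<int r}. v i z - v (i - 1) z) = 0"
    using iper_sum_shift[OF v assms(1), of "- 1"] by (simp add: sum_subtractf)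
qed

text \<open>The product of S and \<open>h^2\<close> is maximized, where h vanishes on the boundary
  of a ball. At the maximum the weight contributes at most a multiple of \<open>S / h^2\<close>,
  while the equation contributes a term quadratic in S; hence \<open>S * h^2\<close> is bounded
  there, whatever the boundary values of S.\<close>

lemma keller_osserman:
  assumes "r \<ge> 1" "k > 0" "toda_on k r (ball z0 1) v"
  shows "expsum r v z0 \<le> 2 * r + 64 * exp 1 * r ^ 3 / k * exp (- 2 * Re z0)"
proof -
  \<comment> \<open>Radius 1/2 keeps the closed ball of the maximization inside the unit ball on
    which the equation holds.\<close>
  define \<rho> :: real where "\<rho> = 1 / 2"
  define h where "h z = \<rho>\<^sup>2 - (cmod (z - z0))\<^sup>2" for z
  have sub: "cball z0 \<rho> \<subseteq> ball z0 1" by (auto simp: \<rho>_def)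
  have "continuous_on (cball z0 \<rho>) (\<lambda>z. expsum r v z * (h z)\<^sup>2)"
    unfolding h_def using continuous_on_expsum toda_onD(3)[OF assms(3)] sub
    by (intro continuous_intros) (meson continuous_on_subset)
  then obtain z where z: "z \<in> cball z0 \<rho>" "\<And>y. y \<in> cball z0 \<rho> \<Longrightarrow> expsum r v y * (h y)\<^sup>2 \<le> expsum r v z * (h z)\<^sup>2"
    using continuous_attains_sup[OF compact_cball, of z0 \<rho>] by (force simp: \<rho>_def)
  have S: "expsum r v z > 0" for z using expsum_pos[OF assms(1)] .
  have "expsum r v z0 * (h z0)\<^sup>2 \<le> expsum r v z * (h z)\<^sup>2" using z(2)[of z0] by (simp add: \<rho>_def)
  moreover have h0: "h z0 = 1 / 4" by (simp add: h_def \<rho>_def power2_eq_square)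
  ultimately have z0: "expsum r v z0 \<le> 16 * (expsum r v z * (h z)\<^sup>2)" by (simp add: power2_eq_square)
  then have "h z \<noteq> 0" using S[of z0] by auto
  then have "cmod (z - z0) < \<rho>" using z(1)
    unfolding h_def mem_cball dist_norm norm_minus_commute[of z0] by (metis diff_self less_eq_real_def)
  have hpos: "h y > 0" if "y \<in> ball z0 \<rho>" for y
    using that by (auto simp: h_def dist_norm norm_minus_commute intro!: power_strict_mono)
  have zb: "z \<in> ball z0 \<rho>" using \<open>cmod (z - z0) < \<rho>\<close> by (simp add: dist_norm norm_minus_commute)
  show ?thesis
  proof (cases "expsum r v z \<ge> 2 * r")
    case False
    have "h z \<le> 1 / 4" by (simp add: h_def \<rho>_def power2_eq_square)
    then have "(h z)\<^sup>2 \<le> (1 / 4)\<^sup>2" using hpos[OF zb] by (intro power_mono) auto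
    then have "expsum r v z * (h z)\<^sup>2 \<le> (2 * r) * (1 / 4)\<^sup>2" using False by (intro mult_mono) auto
    then have "expsum r v z0 \<le> 2 * r" using z0 by (simp add: power2_eq_square)
    moreover have "0 \<le> 64 * exp 1 * r ^ 3 / k * exp (- 2 * Re z0)" using \<open>k > 0\<close> by simp
    ultimately show ?thesis by simp
  next
    case True
    have zU: "z \<in> ball z0 1" using z(1) sub by blast
    have "\<forall>\<^sub>F x in nhds z. ln (expsum r v x) + 2 * ln (h x) \<le> ln (expsum r v z) + 2 * ln (h z)"
    proof -
      have "\<forall>\<^sub>F x in nhds z. x \<in> ball z0 \<rho>" using zb by (intro eventually_nhds_in_open) auto
      then show ?thesis
      proof eventually_elim
        case (elim x)
        have "ln (expsum r v x * (h x)\<^sup>2) \<le> ln (expsum r v z * (h z)\<^sup>2)"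
          using z(2)[of x] elim S[of x] hpos[of x] by (intro ln_mono) auto
        then show ?case using S[of x] S[of z] hpos[OF elim] hpos[OF zb] by (simp add: ln_mult ln_realpow)
      qed
    qed
    moreover have "has_lap (\<lambda>x. 2 * ln (h x)) z (2 * (- 4 * \<rho>\<^sup>2 / (h z)\<^sup>2))"
      unfolding h_def by (intro has_lap_cmult has_lap_ln_ball) fact
    ultimately have "2 * k * exp (2 * Re z) * expvar r v z + 2 * (- 4 * \<rho>\<^sup>2 / (h z)\<^sup>2) * expsum r v z \<le> 0"
      by (intro expsum_at_local_max toda_onD[OF assms(3)] zU assms(1))
    then have "k * exp (2 * Re z) * expvar r v z \<le> expsum r v z / (h z)\<^sup>2"
      by (simp add: \<rho>_def power2_eq_square)
    then have 1: "k * exp (2 * Re z) * expvar r v z * (h z)\<^sup>2 \<le> expsum r v z"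
      using hpos[OF zb] by (simp add: pos_le_divide_eq)
    have "(expsum r v z)\<^sup>2 \<le> 4 * r ^ 3 * expvar r v z"
      using sum_exp_square_le[OF toda_increments(1)[OF assms(1,3) zU] assms(1) toda_increments(2)[OF assms(1,3) zU]] True unfolding expsum_def expvar_def by simp
    then have "k * exp (2 * Re z) * (h z)\<^sup>2 * (expsum r v z)\<^sup>2 \<le> k * exp (2 * Re z) * (h z)\<^sup>2 * (4 * r ^ 3 * expvar r v z)"
      using \<open>k > 0\<close> by (intro mult_left_mono) auto
    also have "\<dots> = 4 * r ^ 3 * (k * exp (2 * Re z) * expvar r v z * (h z)\<^sup>2)" by (simp add: algebra_simps)
    also have "\<dots> \<le> 4 * r ^ 3 * expsum r v z" using 1 by (intro mult_left_mono) auto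
    finally have "(k * exp (2 * Re z) * (expsum r v z * (h z)\<^sup>2)) * expsum r v z \<le> (4 * r ^ 3) * expsum r v z"
      by (simp add: power2_eq_square algebra_simps)
    then have 2: "k * exp (2 * Re z) * (expsum r v z * (h z)\<^sup>2) \<le> 4 * r ^ 3"
      using S[of z] by (simp only: mult_le_cancel_right_pos)
    have "expsum r v z * (h z)\<^sup>2 = exp (- 2 * Re z) / k * (k * exp (2 * Re z) * (expsum r v z * (h z)\<^sup>2))"
      using \<open>k > 0\<close> by (simp add: exp_minus field_simps)
    also have "\<dots> \<le> exp (- 2 * Re z) / k * (4 * r ^ 3)" using 2 \<open>k > 0\<close> by (intro mult_left_mono) auto
    \<comment> \<open>Here Re z > Re z0 - 1/2, which costs the factor \<open>exp 1\<close>.\<close>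
    also have "\<dots> \<le> exp (1 - 2 * Re z0) / k * (4 * r ^ 3)"
    proof -
      have "\<bar>Re (z - z0)\<bar> < \<rho>" using \<open>cmod (z - z0) < \<rho>\<close> abs_Re_le_cmod le_less_trans by blast
      then have "exp (- 2 * Re z) \<le> exp (1 - 2 * Re z0)"
        by (auto simp: \<rho>_def abs_if split: if_splits)
      then show ?thesis using \<open>k > 0\<close> by (intro mult_right_mono divide_right_mono) auto
    qed
    finally have "expsum r v z * (h z)\<^sup>2 \<le> exp (1 - 2 * Re z0) / k * (4 * real r ^ 3)" by simp
    moreover have "16 * (exp (1 - 2 * Re z0) / k * (4 * real r ^ 3)) = 64 * exp 1 * real r ^ 3 / k * exp (- 2 * Re z0)"
      by (simp add: exp_diff exp_minus field_simps)
    ultimately show ?thesis using z0 of_nat_0_le_iff[of r, where 'a=real] by linarith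
  qed
qed

section \<open>Bounds at both ends of the cylinder and radial symmetry\<close>

lemma increment_le_expsum:
  assumes "r \<ge> 1" "iper r (\<lambda>i. v i z)"
  shows "exp (2 * (v i z - v (i - 1) z)) \<le> expsum r v z"
proof -
  have "iper r (\<lambda>i. v (i - 1) z)" using iper_shift[OF assms(2), of "- 1"] by simp
  then have "iper r (\<lambda>i. exp (2 * (v i z - v (i - 1) z)))" using assms(2) by (simp add: iper_def)
  then obtain j where j: "j \<in> {0..<int r}" "exp (2 * (v j z - v (j - 1) z)) = exp (2 * (v i z - v (i - 1) z))"
    using iper_range[of r "\<lambda>i. exp (2 * (v i z - v (i - 1) z))" i] assms(1) by blast
  have "exp (2 * (v j z - v (j - 1) z)) \<le> expsum r v z"
    unfolding expsum_def by (rule member_le_sum[OF j(1)]) auto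
  then show ?thesis using j by simp
qed

text \<open>For Re z at most 0 the factor \<open>exp (2 * Re z)\<close> clears the singular term of
  \<open>keller_osserman\<close>. The constants depend on r and k only; the approximations in
  \<open>toda_exists\<close> rely on this uniformity.\<close>

lemma toda_left_bounds:
  assumes "r \<ge> 1" "k > 0"
  shows "\<exists>C\<ge>0. \<exists>K\<ge>0. \<forall>v z. Re z \<le> 0 \<longrightarrow> toda_on k r (ball z 1) v \<longrightarrow>
     exp (2 * Re z) * expsum r v z \<le> K \<and> (\<forall>i. v i z - v (i - 1) z \<le> C - Re z \<and> \<bar>v i z\<bar> \<le> r * (C - Re z))"
proof -
  define K where "K = 2 * r + 64 * exp 1 * r ^ 3 / k"
  define C where "C = ln K / 2"
  have "K \<ge> 2 * r" using assms by (simp add: K_def)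
  then have K: "K \<ge> 1" using assms by linarith
  then have C: "C \<ge> 0" by (simp add: C_def)
  have "exp (2 * Re z) * expsum r v z \<le> K \<and> (\<forall>i. v i z - v (i - 1) z \<le> C - Re z \<and> \<bar>v i z\<bar> \<le> r * (C - Re z))"
    if z: "Re z \<le> 0" and v: "toda_on k r (ball z 1) v" for v z
  proof -
    have "exp (2 * Re z) * expsum r v z \<le> exp (2 * Re z) * (2 * r + 64 * exp 1 * r ^ 3 / k * exp (- 2 * Re z))"
      using keller_osserman[OF assms v] by (intro mult_left_mono) auto
    also have "\<dots> = exp (2 * Re z) * (2 * r) + 64 * exp 1 * r ^ 3 / k"
      by (simp add: distrib_left exp_minus)
    also have "\<dots> \<le> K" unfolding K_def using z mult_right_mono[of "exp (2 * Re z)" 1 "2 * real r"] by simp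
    finally have S: "exp (2 * Re z) * expsum r v z \<le> K" .
    have p: "v i z - v (i - 1) z \<le> C - Re z" for i
    proof -
      have "exp (2 * Re z + 2 * (v i z - v (i - 1) z)) = exp (2 * Re z) * exp (2 * (v i z - v (i - 1) z))"
        by (simp add: exp_add)
      also have "\<dots> \<le> exp (2 * Re z) * expsum r v z"
        using increment_le_expsum[OF assms(1) toda_onD(1)[OF v]] by (intro mult_left_mono) auto
      also note S
      finally have "2 * Re z + 2 * (v i z - v (i - 1) z) \<le> ln K" using K by (simp add: ln_ge_iff)
      then show ?thesis by (simp add: C_def)
    qed
    moreover have "\<bar>v i z\<bar> \<le> r * (C - Re z)" for i
      using iper_bound_of_increments[OF toda_onD(1)[OF v] assms(1) toda_onD(2)[OF v], of z "C - Re z"] p C z by simp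
    ultimately show ?thesis using S by blast
  qed
  then show ?thesis using K C by (intro exI[of _ C] exI[of _ K] conjI) auto
qed

text \<open>At an interior maximum of log S with a quadratic penalty, the large coefficient
  \<open>exp (2 * Re z)\<close> forces the Dirichlet energy to be small. Hence S is close to its
  minimum r, the positive increments are small, and so are the \<open>v i\<close>.\<close>

lemma toda_decay:
  assumes "r \<ge> 1" "k > 0"
  shows "\<exists>\<epsilon>. (\<epsilon> \<longlongrightarrow> 0) at_top \<and>
     (\<forall>v z i. Re z \<ge> 0 \<longrightarrow> toda_on k r (ball z 2) v \<longrightarrow> \<bar>v i z\<bar> \<le> \<epsilon> (Re z))"
proof -
  \<comment> \<open>A bound for \<open>expsum\<close> on the ball of radius 1/2 about any z0 with
    nonnegative real part; the last factor accounts for real parts down to -1/2.\<close>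
  define C1 where "C1 = 2 * r + 64 * exp 1 * r ^ 3 / k * exp 1"
  \<comment> \<open>On the boundary of that ball the penalty is \<open>A / 4\<close>, more than the
    oscillation \<open>ln C1 - ln r\<close> that log S can have; this makes the maximum
    interior.\<close>
  define A where "A = 4 * (ln C1 - ln r) + 1"
  define C2 where "C2 = 2 * A * C1 * exp 1 / k"
  \<comment> \<open>Three estimates nested: the energy is at most \<open>C2 * exp (- 2 * s)\<close>,
    its root bounds the excess of S over r, and the root of half that excess bounds the
    increments.\<close>
  define \<epsilon> where "\<epsilon> = (\<lambda>s. r * sqrt (r * sqrt (r * (C2 * exp (- 2 * s))) * (1 / 2)))"
  have "C1 \<ge> 2 * r" using assms by (simp add: C1_def)
  then have C1: "C1 \<ge> r" "C1 > 0" using assms by linarith+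
  then have A: "A \<ge> 0" using assms by (simp add: A_def)
  have "((\<lambda>s::real. exp (- 2 * s)) \<longlongrightarrow> 0) at_top"
    by (intro filterlim_compose[OF exp_at_bot] filterlim_tendsto_neg_mult_at_bot[OF tendsto_const] filterlim_ident) simp
  then have "((\<lambda>s. r * sqrt (r * sqrt (r * (C2 * exp (- 2 * s))) * (1 / 2))) \<longlongrightarrow> r * sqrt (r * sqrt (r * (C2 * 0)) * (1 / 2))) at_top"
    by (intro tendsto_mult tendsto_real_sqrt tendsto_const)
  then have lim: "(\<epsilon> \<longlongrightarrow> 0) at_top"
    unfolding \<epsilon>_def mult_zero_right real_sqrt_zero mult_zero_left .
  have "\<bar>v i z0\<bar> \<le> \<epsilon> (Re z0)" if z0: "Re z0 \<ge> 0" and v: "toda_on k r (ball z0 2) v" for v z0 i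
  proof -
    let ?B = "cball z0 (1 / 2)"
    let ?f = "\<lambda>z. ln (expsum r v z) + (- A) * (cmod (z - z0))\<^sup>2"
    have S: "expsum r v z > 0" for z using expsum_pos[OF assms(1)] .
    have Re: "\<bar>Re z - Re z0\<bar> \<le> 1 / 2" if "z \<in> ?B" for z
      using that abs_Re_le_cmod[of "z - z0"] by (simp add: dist_norm norm_minus_commute)
    have sub: "?B \<subseteq> ball z0 2" by auto
    have SC: "expsum r v z \<le> C1" if z: "z \<in> ?B" for z
    proof -
      have "ball z 1 \<subseteq> ball z0 2"
      proof
        fix y assume "y \<in> ball z 1"
        then show "y \<in> ball z0 2" using z dist_triangle[of z0 y z] by simp
      qed
      then have "expsum r v z \<le> 2 * r + 64 * exp 1 * r ^ 3 / k * exp (- 2 * Re z)"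
        using keller_osserman[OF assms toda_on_subset[OF v]] by simp
      also have "\<dots> \<le> C1" unfolding C1_def using Re[OF z] z0 assms
        by (intro add_left_mono mult_left_mono) (auto simp: abs_if split: if_splits)
      finally show ?thesis .
    qed
    have "continuous_on ?B ?f"
      using continuous_on_subset[OF continuous_on_expsum[of "ball z0 2" v r, OF toda_onD(3)[OF v]] sub] S
      by (intro continuous_intros) (auto simp: less_imp_neq[THEN not_sym])
    then obtain z where z: "z \<in> ?B" "\<And>y. y \<in> ?B \<Longrightarrow> ?f y \<le> ?f z"
      using continuous_attains_sup[OF compact_cball, of z0 "1/2"] by force
    have "ln r \<le> ln (expsum r v z0)"
    proof -
      have "r \<le> expsum r v z0"
        unfolding expsum_def by (intro sum_exp_ge toda_increments(2)[OF assms(1) v]) simp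
      then show ?thesis using assms(1) by (intro ln_mono) auto
    qed
    have "dist z0 z \<noteq> 1 / 2"
    proof
      assume "dist z0 z = 1 / 2"
      then have "cmod (z - z0) = 1 / 2" by (simp add: dist_norm norm_minus_commute)
      then have "(cmod (z - z0))\<^sup>2 = 1 / 4" by (simp only: power2_eq_square)
      moreover have "ln (expsum r v z) \<le> ln C1" using SC[OF z(1)] S[of z] C1 by simp
      ultimately have "?f z \<le> ln C1 - A / 4" by (simp only:)
      also have "\<dots> < ln r" unfolding A_def by argo
      also have "\<dots> \<le> ?f z0" using \<open>ln r \<le> _\<close> by simp
      also have "\<dots> \<le> ?f z" by (rule z) simp
      finally show False by simp
    qed
    then have zb: "z \<in> ball z0 (1 / 2)" using z(1) by simp
    have zU: "z \<in> ball z0 2" "z0 \<in> ball z0 2" using z(1) sub by auto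
    have "\<forall>\<^sub>F x in nhds z. x \<in> ball z0 (1 / 2)" using zb by (intro eventually_nhds_in_open) auto
    then have "\<forall>\<^sub>F x in nhds z. ?f x \<le> ?f z" by eventually_elim (use z(2) in auto)
    then have "2 * k * exp (2 * Re z) * expvar r v z + (- A * 4) * expsum r v z \<le> 0"
      by (intro expsum_at_local_max[where b = "\<lambda>z. (- A) * (cmod (z - z0))\<^sup>2"] toda_onD[OF v] assms(1)
          has_lap_cmult has_lap_square_dist zU)
    then have "k * exp (2 * Re z) * expvar r v z \<le> 2 * A * expsum r v z" by (simp add: mult_ac)
    also have "\<dots> \<le> 2 * A * C1" using SC[OF z(1)] A by (intro mult_left_mono) auto
    finally have 1: "k * exp (2 * Re z) * expvar r v z \<le> 2 * A * C1" .
    have "expvar r v z = exp (- 2 * Re z) / k * (k * exp (2 * Re z) * expvar r v z)"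
      using assms by (simp add: exp_minus field_simps)
    also have "\<dots> \<le> exp (- 2 * Re z) / k * (2 * A * C1)" using 1 assms by (intro mult_left_mono) auto
    also have "\<dots> \<le> exp (1 - 2 * Re z0) / k * (2 * A * C1)"
      using Re[OF z(1)] assms A C1 by (intro mult_right_mono divide_right_mono) (auto simp: abs_if split: if_splits)
    also have "\<dots> = C2 * exp (- 2 * Re z0)" by (simp add: C2_def exp_diff exp_minus divide_inverse mult_ac)
    finally have D: "expvar r v z \<le> C2 * exp (- 2 * Re z0)" .
    have "?f z0 \<le> ?f z" by (rule z) simp
    also have "\<dots> \<le> ln (expsum r v z)" using A by simp
    finally have "expsum r v z0 \<le> expsum r v z" using S[of z] S[of z0] by simp
    also have "\<dots> \<le> r * (1 + sqrt (r * expvar r v z))"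
      using sum_exp_le[OF toda_increments(1)[OF assms(1) v zU(1)] assms(1) toda_increments(2)[OF assms(1) v zU(1)]]
      unfolding expsum_def expvar_def by simp
    also have "\<dots> \<le> r * (1 + sqrt (r * (C2 * exp (- 2 * Re z0))))"
      using D by (intro mult_left_mono add_left_mono real_sqrt_le_mono) auto
    finally have 2: "expsum r v z0 - r \<le> r * sqrt (r * (C2 * exp (- 2 * Re z0)))" by (simp add: distrib_left)
    let ?\<eta> = "sqrt (r * sqrt (r * (C2 * exp (- 2 * Re z0))) / 2)"
    have C2: "C2 \<ge> 0" using A C1 assms by (simp add: C2_def)
    have "v i z0 - v (i - 1) z0 \<le> ?\<eta>" for i
    proof (cases "v i z0 - v (i - 1) z0 \<ge> 0")
      case True
      have "2 * (v i z0 - v (i - 1) z0)\<^sup>2 \<le> expsum r v z0 - r"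
        using square_le_sum_exp[OF toda_increments(1)[OF assms(1) v zU(2)] assms(1) toda_increments(2)[OF assms(1) v zU(2)], of i] True
        unfolding expsum_def by simp
      then show ?thesis using 2 by (intro real_le_rsqrt) simp
    next
      case False
      then show ?thesis using C2 by (simp add: order_trans[of _ 0])
    qed
    then have "\<bar>v i z0\<bar> \<le> r * ?\<eta>" using C2
      by (intro iper_bound_of_increments[OF toda_onD(1)[OF v] assms(1) toda_onD(2)[OF v]]) auto
    then show ?thesis by (simp add: \<epsilon>_def)
  qed
  then show ?thesis using lim by blast
qed

section \<open>Comparison of entire solutions\<close>

lemma mono_exp2: "mono (\<lambda>x::real. exp (2 * x))"
  by (auto intro: monoI)

lemma comparison_toda:
  assumes "r \<ge> 1" "k > 0" "toda_on k r {z. a < Re z \<and> Re z < b} x" "toda_on k r {z. a < Re z \<and> Re z < b} y"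
    "\<And>i. vper (x i)" "\<And>i. vper (y i)"
    "\<And>i. continuous_on (strip a b) (x i)" "\<And>i. continuous_on (strip a b) (y i)"
    "\<And>z i. Re z = a \<or> Re z = b \<Longrightarrow> x i z - y i z \<le> \<alpha> + \<beta> * Re z"
    "z \<in> strip a b"
  shows "x i z - y i z \<le> \<alpha> + \<beta> * Re z"
proof (rule comparison[where G = "\<lambda>x. exp (2 * x)" and r = r and k = k and a = a and b = b])
  show "iper r (\<lambda>i. x i z)" "iper r (\<lambda>i. y i z)" for z
    by (rule toda_onD[OF assms(3)] toda_onD[OF assms(4)])+
  show "\<exists>l. has_lap (x i) z l \<and> k * exp (2 * Re z) * toda_term (\<lambda>x. exp (2 * x)) (\<lambda>j. x j z) i \<le> l"
    if "a < Re z" "Re z < b" for z i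
    using toda_onD(4)[OF assms(3), of z i] that by auto
  show "\<exists>l. has_lap (y i) z l \<and> l \<le> k * exp (2 * Re z) * toda_term (\<lambda>x. exp (2 * x)) (\<lambda>j. y j z) i"
    if "a < Re z" "Re z < b" for z i
    using toda_onD(4)[OF assms(4), of z i] that by auto
qed (use assms mono_exp2 in simp_all)

text \<open>The barrier \<open>\<eta> + \<epsilon> * (b - Re z)\<close> dominates the difference at
  a far right edge b by decay, and at a far left edge because the difference is o(Re z). Since b is
  chosen before \<epsilon>, first \<epsilon> and then \<eta> can tend to 0 at a fixed point.\<close>

lemma comparison_entire:
  assumes "r \<ge> 1" "k > 0" "toda_on k r UNIV x" "toda_on k r UNIV y" "\<And>i. vper (x i)" "\<And>i. vper (y i)"
    and left: "\<And>\<epsilon>. \<epsilon> > 0 \<Longrightarrow> \<exists>s. \<forall>z i. Re z \<le> s \<longrightarrow> x i z - y i z \<le> \<epsilon> * \<bar>Re z\<bar>"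
  shows "x i z \<le> y i z"
proof -
  obtain \<delta> where \<delta>: "(\<delta> \<longlongrightarrow> 0) at_top"
    "\<And>v z i. Re z \<ge> 0 \<Longrightarrow> toda_on k r (ball z 2) v \<Longrightarrow> \<bar>v i z\<bar> \<le> \<delta> (Re z)"
    using toda_decay[OF assms(1,2)] by blast
  have "x i z - y i z \<le> \<eta>" if "\<eta> > 0" for \<eta>
  proof -
    have "\<forall>\<^sub>F s in at_top. \<delta> s < \<eta> / 2 \<and> s \<ge> max 0 (Re z)"
      using order_tendstoD(2)[OF \<delta>(1), of "\<eta> / 2"] that by (intro eventually_conj eventually_ge_at_top) auto
    then obtain b where b: "\<delta> b < \<eta> / 2" "b \<ge> 0" "b \<ge> Re z" using eventually_happens'[OF trivial_limit_at_top_linorder] by fastforce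
    have right: "x i z - y i z \<le> \<eta>" if "Re z = b" for z i
    proof -
      have "\<bar>x i z\<bar> \<le> \<delta> b" "\<bar>y i z\<bar> \<le> \<delta> b"
        using \<delta>(2)[of z x i] \<delta>(2)[of z y i] toda_on_subset[OF assms(3)] toda_on_subset[OF assms(4)] b that by auto
      then show ?thesis using b by linarith
    qed
    have main: "x i z - y i z \<le> \<eta> + \<epsilon> * (b - Re z)" if "\<epsilon> > 0" for \<epsilon>
    proof -
      obtain s where s: "\<And>z i. Re z \<le> s \<Longrightarrow> x i z - y i z \<le> \<epsilon> * \<bar>Re z\<bar>" using left[OF \<open>\<epsilon> > 0\<close>] by blast
      \<comment> \<open>Far enough left for the growth hypothesis, to the left of z, and nonpositive
        so that \<open>\<bar>a\<bar> = - a\<close>.\<close>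
      define a where "a = min s (min (Re z) 0)"
      have "x i z - y i z \<le> (\<eta> + \<epsilon> * b) + (- \<epsilon>) * Re z"
      proof (rule comparison_toda[where a = a and b = b, OF assms(1,2) toda_on_subset[OF assms(3)] toda_on_subset[OF assms(4)] assms(5,6)])
        show "continuous_on (strip a b) (x i)" "continuous_on (strip a b) (y i)" for i
          using toda_onD(3)[OF assms(3)] toda_onD(3)[OF assms(4)] continuous_on_subset by blast+
        fix z i assume "Re z = a \<or> Re z = b"
        then show "x i z - y i z \<le> (\<eta> + \<epsilon> * b) + (- \<epsilon>) * Re z"
        proof
          assume "Re z = a"
          moreover have "x i z - y i z \<le> \<epsilon> * \<bar>Re z\<bar>" using s[of z i] \<open>Re z = a\<close> by (simp add: a_def)
          moreover have "\<bar>a\<bar> = - a" by (simp add: a_def)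
          moreover have "\<epsilon> * b \<ge> 0" using b that by simp
          ultimately show ?thesis using \<open>\<eta> > 0\<close> by simp
        qed (use right in simp)
      next
        show "z \<in> strip a b" using b by (auto simp: strip_def a_def)
      qed auto
      then show ?thesis by (simp add: algebra_simps)
    qed
    have "((\<lambda>\<epsilon>. \<eta> + \<epsilon> * (b - Re z)) \<longlongrightarrow> \<eta> + 0 * (b - Re z)) (at_right 0)"
      by (intro tendsto_intros)
    then have "((\<lambda>\<epsilon>. \<eta> + \<epsilon> * (b - Re z)) \<longlongrightarrow> \<eta>) (at_right 0)" by simp
    moreover have "\<forall>\<^sub>F \<epsilon> in at_right 0. x i z - y i z \<le> \<eta> + \<epsilon> * (b - Re z)"
      using main by (simp add: eventually_at_right_field) (metis zero_less_one)
    ultimately show ?thesis by (rule tendsto_lowerbound) simp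
  qed
  then show ?thesis using field_le_epsilon[of "x i z" "y i z"] by force
qed

text \<open>The barrier has two parts. A parabola vanishing on the horizontal edges absorbs the
  Laplacian bound K. The same parabola plus \<open>(Re z - s)^2\<close> is harmonic and, scaled by
  \<open>N / R^2\<close>, reaches N on the vertical edges. On the middle line N thus counts only
  through \<open>N / R^2\<close>.\<close>

lemma odd_barrier:
  assumes "R > 0" "N \<ge> 0"
    and cont: "continuous_on (cbox (Complex (s - R) c) (Complex (s + R) (c + pi))) V"
    and lap: "\<And>z. z \<in> box (Complex (s - R) c) (Complex (s + R) (c + pi)) \<Longrightarrow> \<exists>l\<ge>- K. has_lap V z l"
    and zero: "\<And>z. Im z = c \<or> Im z = c + pi \<Longrightarrow> V z \<le> 0"
    and bnd: "\<And>z. z \<in> cbox (Complex (s - R) c) (Complex (s + R) (c + pi)) \<Longrightarrow> V z \<le> N"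
    and "K \<ge> 0" "Re z = s" "c \<le> Im z" "Im z \<le> c + pi"
  shows "V z \<le> (N / R\<^sup>2 + K / 2) * pi\<^sup>2"
proof -
  \<comment> \<open>This is \<open>(t - c) * (c + pi - t)\<close>, with second derivative
    -2.\<close>
  define h where "h t = pi\<^sup>2 / 4 + (- 1) * (t - (c + pi / 2))\<^sup>2" for t
  define b where "b z = N / R\<^sup>2 * ((Re z - s)\<^sup>2 + h (Im z)) + K / 2 * h (Im z)" for z
  let ?Q = "cbox (Complex (s - R) c) (Complex (s + R) (c + pi))"
  have h: "0 \<le> h t" if "c \<le> t" "t \<le> c + pi" for t
  proof -
    have "h t = (t - c) * (c + pi - t)" by (simp add: h_def power2_eq_square algebra_simps)
    then show ?thesis using that by simp
  qed
  have lapb: "has_lap b z (N / R\<^sup>2 * (2 + (0 + (- 1) * 2)) + K / 2 * (0 + (- 1) * 2))" for z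
    unfolding b_def h_def
    by (intro has_lap_add has_lap_cmult has_lap_Re[OF has_d2_square] has_lap_const has_lap_Im[OF has_d2_square])
  let ?u = "\<lambda>(_ :: unit) z. V z - b z"
  have "?u () z \<le> 0"
  proof (rule max_principle[of "{()}" ?Q ?Q ?u])
    show "continuous_on ?Q (?u i)" for i
      using cont unfolding b_def h_def by (intro continuous_intros)
    show "z \<in> ?Q" using assms by (simp add: in_cbox_complex_iff)
    show "\<exists>z'\<in>?Q. Re z' = Re z \<and> (\<forall>i\<in>{()}. ?u i z' = ?u i z)" if "z \<in> ?Q" for z
      using that by blast
    fix z and i :: unit
    assume z: "z \<in> ?Q" and pos: "?u i z > 0"
    have hz: "h (Im z) \<ge> 0" using z h by (simp add: in_cbox_complex_iff)
    have b0: "b z \<ge> 0" unfolding b_def using assms hz by (intro add_nonneg_nonneg mult_nonneg_nonneg) auto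
    have "Im z \<noteq> c" "Im z \<noteq> c + pi" using zero[of z] pos b0 by auto
    moreover have "(Re z - s)\<^sup>2 \<noteq> R\<^sup>2"
    proof
      assume "(Re z - s)\<^sup>2 = R\<^sup>2"
      then have "b z = N + (N / R\<^sup>2 + K / 2) * h (Im z)" using assms(1) by (simp add: b_def algebra_simps)
      then have "b z \<ge> N" using assms hz by simp
      then show False using bnd[OF z] pos by simp
    qed
    then have "Re z \<noteq> s - R" "Re z \<noteq> s + R" by auto
    ultimately have zb: "z \<in> box (Complex (s - R) c) (Complex (s + R) (c + pi))"
      using z by (auto simp: in_cbox_complex_iff in_box_complex_iff)
    then obtain l where l: "l \<ge> - K" "has_lap V z l" using lap by blast
    have "has_lap (\<lambda>z. V z - b z) z (l - (N / R\<^sup>2 * (2 + (0 + (- 1) * 2)) + K / 2 * (0 + (- 1) * 2)))"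
      by (rule has_lap_diff[OF l(2) lapb])
    moreover have "l - (N / R\<^sup>2 * (2 + (0 + (- 1) * 2)) + K / 2 * (0 + (- 1) * 2)) \<ge> 0" using l(1) by simp
    ultimately show "z \<in> interior ?Q \<and> (\<exists>l\<ge>0. has_lap (?u i) z l)"
      using zb interior_cbox by blast
  qed simp_all
  moreover have "b z \<le> (N / R\<^sup>2 + K / 2) * pi\<^sup>2"
  proof -
    have "h (Im z) \<le> pi\<^sup>2" using zero_le_power2[of pi] zero_le_power2[of "Im z - (c + pi / 2)"] unfolding h_def by linarith
    then have "(N / R\<^sup>2 + K / 2) * h (Im z) \<le> (N / R\<^sup>2 + K / 2) * pi\<^sup>2"
      using assms by (intro mult_left_mono) auto
    then show ?thesis using \<open>Re z = s\<close> by (simp add: b_def algebra_simps)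
  qed
  ultimately show ?thesis by simp
qed

section \<open>Reflections and radial symmetry\<close>

lemma toda_reflect:
  assumes "toda_on k r UNIV v" "c \<in> \<real>"
  shows "toda_on k r UNIV (\<lambda>i z. v i (cnj z + c * \<i>))"
proof -
  have "continuous_on UNIV (\<lambda>z. v i (cnj z + c * \<i>))" for i
    using toda_onD(3)[OF assms(1), of i] by (rule continuous_on_compose2) (auto intro!: continuous_intros)
  moreover have "has_lap (\<lambda>z. v i (cnj z + c * \<i>)) z
      (k * exp (2 * Re z) * toda_term (\<lambda>x. exp (2 * x)) (\<lambda>j. v j (cnj z + c * \<i>)) i)" for i z
    using toda_onD(4)[OF assms(1), of "cnj z + c * \<i>" i] assms(2)
    by (intro has_lap_cnj[of "\<lambda>z. v i (z + c * \<i>)"] has_lap_shift) (auto elim!: Reals_cases)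
  ultimately show ?thesis
    using toda_onD(1,2)[OF assms(1)] unfolding toda_on_def by auto
qed

text \<open>The difference of a solution and its reflection grows at most linearly to the left and
  has a Laplacian bounded by 2 k K. \<open>odd_barrier\<close> on a rectangle of half-width
  proportional to |Re z| turns the linear growth into a bound.\<close>

lemma reflection_bounded_left:
  assumes "r \<ge> 1" "k > 0" "toda_on k r UNIV v" "\<And>i. vper (v i)"
  shows "\<exists>M. \<forall>z i. Re z \<le> - 2 \<longrightarrow> v i z - v i (cnj z + of_real (2 * c) * \<i>) \<le> M"
proof -
  obtain C K where CK: "C \<ge> 0" "K \<ge> 0"
    "\<And>v z. Re z \<le> 0 \<Longrightarrow> toda_on k r (ball z 1) v \<Longrightarrow>
     exp (2 * Re z) * expsum r v z \<le> K \<and> (\<forall>i. v i z - v (i - 1) z \<le> C - Re z \<and> \<bar>v i z\<bar> \<le> r * (C - Re z))"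
    using toda_left_bounds[OF assms(1,2)] by blast
  define v' where "v' i z = v i (cnj z + of_real (2 * c) * \<i>)" for i z
  have v': "toda_on k r UNIV v'" unfolding v'_def using toda_reflect[OF assms(3), of "of_real (2 * c)"] by simp
  have bnd: "\<bar>x i z\<bar> \<le> r * (C - Re z)" "has_lap (x i) z l \<Longrightarrow> \<bar>l\<bar> \<le> k * K"
    if "x = v \<or> x = v'" "Re z \<le> 0" "l = k * exp (2 * Re z) * toda_term (\<lambda>x. exp (2 * x)) (\<lambda>j. x j z) i" for x i z l
  proof -
    have x: "toda_on k r UNIV x" using that assms v' by auto
    have B: "exp (2 * Re z) * expsum r x z \<le> K \<and> (\<forall>i. x i z - x (i - 1) z \<le> C - Re z \<and> \<bar>x i z\<bar> \<le> r * (C - Re z))"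
      using CK(3)[OF that(2) toda_on_subset[OF x]] by simp
    then show "\<bar>x i z\<bar> \<le> r * (C - Re z)" by simp
    have "exp (2 * (x i z - x (i - 1) z)) \<le> expsum r x z" "exp (2 * (x (i + 1) z - x i z)) \<le> expsum r x z"
      using increment_le_expsum[of r x z, OF assms(1) toda_onD(1)[OF x, of z], of i] increment_le_expsum[of r x z, OF assms(1) toda_onD(1)[OF x, of z], of "i + 1"]
      by simp_all
    then have "\<bar>toda_term (\<lambda>x. exp (2 * x)) (\<lambda>j. x j z) i\<bar> \<le> expsum r x z"
      unfolding toda_term_def using exp_ge_zero[of "2 * (x i z - x (i - 1) z)"] exp_ge_zero[of "2 * (x (i + 1) z - x i z)"]
      by linarith
    then have "\<bar>l\<bar> \<le> k * exp (2 * Re z) * expsum r x z"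
      unfolding that(3) using assms(2) by (simp add: abs_mult mult_left_mono)
    also have "\<dots> \<le> k * K" using B assms(2) by (simp add: mult.assoc mult_left_mono)
    finally show "\<bar>l\<bar> \<le> k * K" .
  qed
  define M where "M = (8 * r * (C + 2) + k * K) * pi\<^sup>2"
  have "v i z - v' i z \<le> M" if z: "Re z \<le> - 2" for z i
  proof -
    define m where "m = \<lfloor>(Im z - c) / pi\<rfloor>"
    define c' where "c' = c + pi * of_int m"
    define s where "s = Re z"
    \<comment> \<open>The rectangle then stays between the real parts \<open>3 / 2 * s\<close> and
      \<open>s / 2 \<le> - 1\<close>, where the left bounds apply, and \<open>N / R\<^sup>2\<close>
      is bounded uniformly in s.\<close>
    define R where "R = - s / 2"
    define N where "N = 2 * (r * (C - 3 / 2 * s))"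
    let ?Q = "cbox (Complex (s - R) c') (Complex (s + R) (c' + pi))"
    have sR: "s + R = s / 2" "s - R = 3 / 2 * s" "s \<le> - 2" "R > 0" using z by (auto simp: R_def s_def)
    have ReQ: "Re y \<le> - 1" "3 / 2 * s \<le> Re y" if "y \<in> ?Q" for y
      using that sR by (auto simp: in_cbox_complex_iff)
    have "v i z - v' i z \<le> (N / R\<^sup>2 + (2 * (k * K)) / 2) * pi\<^sup>2"
    proof (rule odd_barrier)
      show "continuous_on ?Q (\<lambda>z. v i z - v' i z)"
        using toda_onD(3)[OF assms(3)] toda_onD(3)[OF v']
        by (intro continuous_intros) (auto intro: continuous_on_subset)
      show "v i y - v' i y \<le> 0" if "Im y = c' \<or> Im y = c' + pi" for y
      proof -
        have "Im y = c + pi * of_int m \<or> Im y = c + pi * of_int (m + 1)"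
          using that by (auto simp: c'_def algebra_simps)
        then obtain n where n: "Im y = c + pi * of_int n" by blast
        \<comment> \<open>On these lines the reflection moves y by n full periods, so the two
          functions agree there.\<close>
        have "y = (cnj y + of_real (2 * c) * \<i>) + of_real (2 * pi * of_int n) * \<i>"
          using n by (simp add: complex_eq_iff)
        then have "v i y = v' i y" unfolding v'_def using vper_int[OF assms(4)] by metis
        then show ?thesis by simp
      qed
      show "v i y - v' i y \<le> N" if "y \<in> ?Q" for y
      proof -
        have "\<bar>v i y\<bar> \<le> r * (C - Re y)" "\<bar>v' i y\<bar> \<le> r * (C - Re y)"
          using bnd(1) ReQ(1)[OF that] by auto
        moreover have "r * (C - Re y) \<le> r * (C - 3 / 2 * s)" using ReQ(2)[OF that] by (intro mult_left_mono) auto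
        ultimately show ?thesis unfolding N_def by linarith
      qed
      show "\<exists>l\<ge>- (2 * (k * K)). has_lap (\<lambda>z. v i z - v' i z) y l"
        if "y \<in> box (Complex (s - R) c') (Complex (s + R) (c' + pi))" for y
      proof -
        have "Re y \<le> 0" using that box_subset_cbox ReQ(1)[of y] by force
        then show ?thesis
          using bnd(2)[OF _ _ refl toda_onD(4)[OF assms(3), of y i]] bnd(2)[OF _ _ refl toda_onD(4)[OF v', of y i]]
            has_lap_diff[OF toda_onD(4)[OF assms(3), of y i] toda_onD(4)[OF v', of y i]]
          by (intro exI conjI) (auto simp: abs_le_iff)
      qed
      show "N \<ge> 0" using CK z by (simp add: N_def s_def)
      have "of_int m * pi \<le> Im z - c" "Im z - c \<le> (of_int m + 1) * pi"
        unfolding m_def using floor_divide_lower[of pi "Im z - c"] less_imp_le[OF floor_divide_upper[of pi "Im z - c"]] by simp_all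
      then show "c' \<le> Im z" "Im z \<le> c' + pi" unfolding c'_def by (simp_all add: algebra_simps)
    qed (use sR CK assms in \<open>auto simp: s_def\<close>)
    also have "\<dots> \<le> M"
    proof -
      have c: "1 \<le> s\<^sup>2" "- s \<le> s\<^sup>2"
        using sR mult_right_mono[of 1 "- s" "- s"] by (auto simp: power2_eq_square)
      then have "C * 1 \<le> C * s\<^sup>2" using CK(1) by (intro mult_left_mono) auto
      then have "C - 3 / 2 * s \<le> (C + 2) * s\<^sup>2" using c sR by (simp add: distrib_right)
      then have "2 * r * (C - 3 / 2 * s) \<le> 2 * r * ((C + 2) * s\<^sup>2)" by (intro mult_left_mono) auto
      moreover have "8 * r * (C + 2) * R\<^sup>2 = 2 * r * ((C + 2) * s\<^sup>2)" by (simp add: R_def power2_eq_square)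
      ultimately have "N \<le> 8 * r * (C + 2) * R\<^sup>2" by (simp only: N_def)
      then have "N / R\<^sup>2 \<le> 8 * r * (C + 2)" using sR by (simp add: pos_divide_le_eq)
      then show ?thesis unfolding M_def by (intro mult_right_mono) auto
    qed
    finally show ?thesis .
  qed
  then show ?thesis unfolding v'_def by blast
qed

text \<open>Two points with equal real part are exchanged by the reflection in the line halfway
  between them. A bounded difference is o(Re z), so \<open>comparison_entire\<close> puts v below
  its reflection; used at both points, this is equality.\<close>

lemma toda_radial:
  assumes "r \<ge> 1" "k > 0" "toda_on k r UNIV v" "\<And>i. vper (v i)" "Re z = Re z'"
  shows "v i z = v i z'"
proof -
  have le: "v i z \<le> v i (cnj z + of_real (2 * c) * \<i>)" for c i z
  proof (rule comparison_entire[OF assms(1-3), where y = "\<lambda>i z. v i (cnj z + of_real (2 * c) * \<i>)"])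
    show "toda_on k r UNIV (\<lambda>i z. v i (cnj z + of_real (2 * c) * \<i>))"
      using toda_reflect[OF assms(3), of "of_real (2 * c)"] by simp
    show "vper (\<lambda>z. v i (cnj z + of_real (2 * c) * \<i>))" for i
      unfolding vper_def
    proof
      fix z
      have "cnj z + of_real (2 * c) * \<i> =
        (cnj (z + of_real (2 * pi) * \<i>) + of_real (2 * c) * \<i>) + of_real (2 * pi) * \<i>"
        by (simp add: complex_eq_iff)
      then show "v i (cnj (z + of_real (2 * pi) * \<i>) + of_real (2 * c) * \<i>) = v i (cnj z + of_real (2 * c) * \<i>)"
        using assms(4) unfolding vper_def by metis
    qed
    obtain M where M: "\<And>z i. Re z \<le> - 2 \<Longrightarrow> v i z - v i (cnj z + of_real (2 * c) * \<i>) \<le> M"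
      using reflection_bounded_left[OF assms(1-4), of c] by blast
    fix \<epsilon> :: real assume "\<epsilon> > 0"
    have "v i z - v i (cnj z + of_real (2 * c) * \<i>) \<le> \<epsilon> * \<bar>Re z\<bar>" if "Re z \<le> min (- 2) (- \<bar>M\<bar> / \<epsilon>)" for z i
    proof -
      have "\<bar>M\<bar> / \<epsilon> \<le> \<bar>Re z\<bar>" using that by linarith
      then have "\<bar>M\<bar> \<le> \<epsilon> * \<bar>Re z\<bar>" using \<open>\<epsilon> > 0\<close> by (simp add: pos_divide_le_eq mult.commute)
      then show ?thesis using M[of z i] that by linarith
    qed
    then show "\<exists>s. \<forall>z i. Re z \<le> s \<longrightarrow> v i z - v i (cnj z + of_real (2 * c) * \<i>) \<le> \<epsilon> * \<bar>Re z\<bar>" by blast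
  qed (use assms in auto)
  have "cnj z + of_real (2 * ((Im z + Im z') / 2)) * \<i> = z'" "cnj z' + of_real (2 * ((Im z + Im z') / 2)) * \<i> = z"
    using assms(5) by (simp_all add: complex_eq_iff field_simps)
  then show ?thesis using le[of i z "(Im z + Im z') / 2"] le[of i z' "(Im z + Im z') / 2"] by simp
qed

section \<open>Asymptotic slopes\<close>

text \<open>The second derivative test, applied to the constant function f - f, compares the two
  values.\<close>

lemma has_d2_unique:
  assumes "has_d2 f x a" "has_d2 f x b"
  shows "a = b"
proof -
  have "c \<le> d" if "has_d2 f x c" "has_d2 f x d" for c d
    using has_d2_local_max[OF has_d2_add[OF that(1) has_d2_cmult[OF that(2), of "- 1"]]] by simp
  then show ?thesis using assms by (intro antisym) auto
qed

lemma has_d2_deriv: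
  assumes "has_d2 f x d"
  shows "\<forall>\<^sub>F t in nhds x. (f has_real_derivative deriv f t) (at t)" "(deriv f has_real_derivative d) (at x)"
proof -
  obtain f' where f': "\<forall>\<^sub>F t in nhds x. (f has_real_derivative f' t) (at t)" "(f' has_real_derivative d) (at x)"
    using assms unfolding has_d2_def by blast
  then have ev: "\<forall>\<^sub>F t in nhds x. deriv f t = f' t" by (auto elim!: eventually_mono intro: DERIV_imp_deriv)
  with f'(1) show "\<forall>\<^sub>F t in nhds x. (f has_real_derivative deriv f t) (at t)" by eventually_elim simp
  show "(deriv f has_real_derivative d) (at x)" using DERIV_cong_ev[OF refl ev refl] f'(2) by simp
qed

lemma has_lap_of_real_part:
  assumes "has_lap f z l" "\<And>z z'. Re z = Re z' \<Longrightarrow> f z = f z'"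
  shows "has_d2 (\<lambda>t. f (of_real t)) (Re z) l"
proof -
  obtain a b where ab: "has_d2 (\<lambda>t. f (z + of_real t)) 0 a" "has_d2 (\<lambda>t. f (z + \<i> * of_real t)) 0 b" "l = a + b"
    using assms(1) unfolding has_lap_def by blast
  have "(\<lambda>t. f (z + \<i> * of_real t)) = (\<lambda>t. f z)" by (intro ext assms(2)) simp
  then have "b = 0" using ab(2) has_d2_const has_d2_unique by metis
  moreover have "(\<lambda>t. f (z + of_real (t + - Re z))) = (\<lambda>t. f (of_real t))"
    by (intro ext assms(2)) simp
  moreover have "has_d2 (\<lambda>t. f (z + of_real (t + - Re z))) (Re z) a"
    by (rule has_d2_shift) (use ab in simp)
  ultimately show ?thesis using ab by simp
qed

section \<open>Limits and growth rates at minus infinity\<close>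

lemma antimono_tendsto_at_bot:
  fixes f :: "real \<Rightarrow> real"
  assumes "\<And>x y. x \<le> y \<Longrightarrow> y \<le> 0 \<Longrightarrow> f y \<le> f x" "\<And>x. x \<le> 0 \<Longrightarrow> f x \<le> B"
  shows "\<exists>L. (f \<longlongrightarrow> L) at_bot"
proof -
  define L where "L = Sup (f ` {..0})"
  have bdd: "bdd_above (f ` {..0})" using assms(2) by (auto intro!: bdd_aboveI[of _ B])
  have "(f \<longlongrightarrow> L) at_bot"
  proof (rule order_tendstoI)
    fix a assume "a < L"
    then obtain y where y: "y \<le> 0" "a < f y" unfolding L_def using less_cSup_iff[OF _ bdd] by auto
    have "\<forall>\<^sub>F x in at_bot. x \<le> y" by (rule eventually_le_at_bot)
    then show "\<forall>\<^sub>F x in at_bot. a < f x"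
      by eventually_elim (use y assms(1) in \<open>force intro: less_le_trans\<close>)
  next
    fix a assume "L < a"
    have "\<forall>\<^sub>F x in at_bot. x \<le> (0 :: real)" by (rule eventually_le_at_bot)
    then show "\<forall>\<^sub>F x in at_bot. f x < a"
    proof eventually_elim
      case (elim x)
      then have "f x \<le> L" unfolding L_def by (intro cSup_upper bdd) auto
      then show ?case using \<open>L < a\<close> by simp
    qed
  qed
  then show ?thesis by blast
qed

lemma tendsto_quotient_at_bot:
  fixes f :: "real \<Rightarrow> real"
  assumes "\<And>s. (f has_real_derivative f' s) (at s)" "(f' \<longlongrightarrow> L) at_bot"
  shows "((\<lambda>s. f s / s) \<longlongrightarrow> L) at_bot"
proof -
  have "((\<lambda>s. f (- s) / s) \<longlongrightarrow> - L) at_top"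
  proof (rule lhospital_at_top_at_top)
    show "LIM x at_top. x :> at_top" by (rule filterlim_ident)
    show "\<forall>\<^sub>F x in at_top. ((\<lambda>s. f (- s)) has_real_derivative - f' (- x)) (at x)"
      using assms(1) DERIV_mirror by (intro always_eventually) blast
    show "\<forall>\<^sub>F x in at_top. ((\<lambda>x. x) has_real_derivative 1) (at x)" by simp
    have "((\<lambda>x. f' (- x)) \<longlongrightarrow> L) at_top" using assms(2) by (simp add: filterlim_at_bot_mirror)
    then show "((\<lambda>x. - f' (- x) / 1) \<longlongrightarrow> - L) at_top" by (auto intro: tendsto_minus)
  qed simp
  then have "((\<lambda>s. - (f (- s) / s)) \<longlongrightarrow> - (- L)) at_top" by (rule tendsto_minus)
  then show ?thesis by (simp add: filterlim_at_bot_mirror)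
qed

text \<open>To the left of c, the difference of A and the quadratic is convex, and its slope at c is
  zero.\<close>

lemma quadratic_lower_bound_left:
  fixes A :: "real \<Rightarrow> real"
  assumes "\<And>s. (A has_real_derivative A' s) (at s)" "\<And>s. (A' has_real_derivative A'' s) (at s)"
    "\<And>s. s \<le> c \<Longrightarrow> 2 * N \<le> A'' s" "s \<le> c"
  shows "A c + A' c * (s - c) + N * (s - c)\<^sup>2 \<le> A s"
proof -
  define B where "B s = A s - (A' c * (s - c) + N * (s - c)\<^sup>2)" for s
  define B' where "B' s = A' s - (A' c + 2 * N * (s - c))" for s
  have B: "(B has_real_derivative B' s) (at s)" "(B' has_real_derivative A'' s - 2 * N) (at s)" for s
    unfolding B_def B'_def using assms(1,2) by (auto intro!: derivative_eq_intros)
  have "B' s \<le> 0" if "s \<le> c" for s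
  proof -
    have "B' s \<le> B' c" by (rule DERIV_nonneg_imp_nondecreasing[OF that]) (use B assms(3) in force)
    then show ?thesis by (simp add: B'_def)
  qed
  then have "B c \<le> B s" by (intro DERIV_nonpos_imp_nonincreasing[OF \<open>s \<le> c\<close>]) (use B in force)
  then show ?thesis by (simp add: B_def)
qed

text \<open>Division by t^2 and passage to infinity leave only the leading coefficients.\<close>

lemma quadratic_coefficient_le:
  fixes a b c M N :: real
  assumes "\<And>t. t \<ge> 0 \<Longrightarrow> b + N * t\<^sup>2 + a * t \<le> M * (c + t)\<^sup>2"
  shows "N \<le> M"
proof -
  have z: "((\<lambda>t::real. inverse t) \<longlongrightarrow> 0) at_top" by (rule tendsto_inverse_0_at_top) (rule filterlim_ident)
  have "((\<lambda>t. M * (c * inverse t + 1)\<^sup>2 - a * inverse t - b * (inverse t)\<^sup>2) \<longlongrightarrow> M * (c * 0 + 1)\<^sup>2 - a * 0 - b * 0\<^sup>2) at_top"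
    by (intro tendsto_intros z)
  then have lim: "((\<lambda>t. M * (c * inverse t + 1)\<^sup>2 - a * inverse t - b * (inverse t)\<^sup>2) \<longlongrightarrow> M) at_top" by simp
  have "\<forall>\<^sub>F t in at_top. t > (0 :: real)" by (rule eventually_gt_at_top)
  then have "\<forall>\<^sub>F t in at_top. N \<le> M * (c * inverse t + 1)\<^sup>2 - a * inverse t - b * (inverse t)\<^sup>2"
  proof eventually_elim
    case (elim t)
    have "(b + N * t\<^sup>2 + a * t) * (inverse t)\<^sup>2 \<le> M * (c + t)\<^sup>2 * (inverse t)\<^sup>2"
      using assms[of t] elim by (intro mult_right_mono) auto
    moreover have "(b + N * t\<^sup>2 + a * t) * (inverse t)\<^sup>2 = b * (inverse t)\<^sup>2 + N + a * inverse t"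
      using elim by (simp add: field_simps power2_eq_square)
    moreover have "M * (c + t)\<^sup>2 * (inverse t)\<^sup>2 = M * (c * inverse t + 1)\<^sup>2"
      using elim by (simp add: field_simps power2_eq_square)
    ultimately show ?case by linarith
  qed
  then show ?thesis by (rule tendsto_lowerbound[OF lim]) simp
qed

text \<open>The kinetic part D is bounded indirectly: convexity of half the sum of the
  \<open>(V i)^2\<close> would make a large D force growth faster than the known linear bound on the
  \<open>V i\<close> permits. Once D is bounded, H and all \<open>V' i + H\<close> are antitone and
  bounded above on the left half-line.\<close>

lemma toda_ode_slopes:
  fixes V V' :: "int \<Rightarrow> real \<Rightarrow> real"
  defines "P \<equiv> \<lambda>i s. exp (2 * (V i s - V (i - 1) s))"
  assumes "r \<ge> 1" "k > 0" and per: "\<And>s. iper r (\<lambda>i. V i s)" "\<And>s. iper r (\<lambda>i. V' i s)"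
    and d: "\<And>i s. (V i has_real_derivative V' i s) (at s)"
      "\<And>i s. (V' i has_real_derivative k * exp (2 * s) * (P i s - P (i + 1) s)) (at s)"
    and Kb: "\<And>s. s \<le> 0 \<Longrightarrow> exp (2 * s) * (\<Sum>i\<in>{0..<int r}. P i s) \<le> K"
    and Vb: "\<And>i s. s \<le> 0 \<Longrightarrow> \<bar>V i s\<bar> \<le> r * (C - s)"
  shows "\<exists>L. \<forall>i. ((\<lambda>s. V i s / s) \<longlongrightarrow> L i) at_bot"
proof -
  let ?S = "\<lambda>f :: int \<Rightarrow> real. \<Sum>i\<in>{0..<int r}. f i"
  define E where "E s = exp (2 * s) * ?S (\<lambda>i. P i s)" for s
  define D where "D s = ?S (\<lambda>i. (V' i s)\<^sup>2) / 2" for s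
  define H where "H s = D s - k / 2 * E s" for s
  have Pper: "iper r (\<lambda>i. P i s)" for s
  proof -
    have "iper r (\<lambda>i. V (i - 1) s)" using iper_shift[OF per(1)[of s], of "- 1"] by simp
    with per(1)[of s] show ?thesis by (simp add: iper_def P_def)
  qed
  have abel: "?S (\<lambda>i. x i * (P i s - P (i + 1) s)) = ?S (\<lambda>i. P i s * (x i - x (i - 1)))" if "iper r x" for x s
  proof -
    have "iper r (\<lambda>i. x (i - 1))" using iper_shift[OF that, of "- 1"] by simp
    then have "iper r (\<lambda>i. x (i - 1) * P i s)" using Pper[of s] by (simp add: iper_def)
    from iper_sum_shift[OF this assms(2), of 1]
    show ?thesis by (simp add: right_diff_distrib sum_subtractf mult.commute)
  qed
  have dP: "(P i has_real_derivative P i s * (2 * (V' i s - V' (i - 1) s))) (at s)" for i s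
    unfolding P_def by (auto intro!: derivative_eq_intros d(1))
  have Ppos: "P i s > 0" for i s by (simp add: P_def)
  have E0: "E s \<ge> 0" for s unfolding E_def using Ppos by (intro mult_nonneg_nonneg sum_nonneg) (auto simp: less_imp_le)
  have dE: "(E has_real_derivative 2 * E s + 2 * exp (2 * s) * ?S (\<lambda>i. V' i s * (P i s - P (i + 1) s))) (at s)" for s
  proof -
    have "(E has_real_derivative (exp (2 * s) * 2) * ?S (\<lambda>i. P i s) + ?S (\<lambda>i. P i s * (2 * (V' i s - V' (i - 1) s))) * exp (2 * s)) (at s)"
      unfolding E_def by (intro DERIV_mult DERIV_sum dP) (auto intro!: derivative_eq_intros)
    moreover have "?S (\<lambda>i. P i s * (2 * (V' i s - V' (i - 1) s))) = 2 * ?S (\<lambda>i. V' i s * (P i s - P (i + 1) s))"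
      unfolding abel[OF per(2)] sum_distrib_left by (intro sum.cong) (auto simp: algebra_simps)
    ultimately show ?thesis by (simp add: E_def mult_ac)
  qed
  have dD: "(D has_real_derivative k * exp (2 * s) * ?S (\<lambda>i. V' i s * (P i s - P (i + 1) s))) (at s)" for s
  proof -
    have "((\<lambda>s. ?S (\<lambda>i. (V' i s)\<^sup>2)) has_real_derivative ?S (\<lambda>i. 2 * V' i s * (k * exp (2 * s) * (P i s - P (i + 1) s)))) (at s)"
      by (intro DERIV_sum) (auto intro!: derivative_eq_intros d(2))
    from DERIV_cdivide[OF this, of 2] show ?thesis
      unfolding D_def by (simp add: sum_distrib_left sum_divide_distrib mult_ac)
  qed
  \<comment> \<open>The mixed terms of D and \<open>k / 2 * E\<close> cancel; only the explicit
    factor \<open>exp (2 * s)\<close> in E leaves a contribution, of one sign.\<close>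
  have dH: "(H has_real_derivative - k * E s) (at s)" for s
    unfolding H_def by (rule DERIV_cong[OF DERIV_diff[OF dD DERIV_cmult[OF dE]]]) (simp add: algebra_simps)
  have H_anti: "H y \<le> H x" if "x \<le> y" for x y
    by (rule DERIV_nonpos_imp_nonincreasing[OF that]) (use dH E0 assms(3) in \<open>force simp: mult_nonneg_nonneg\<close>)
  define A where "A s = ?S (\<lambda>i. (V i s)\<^sup>2) / 2" for s
  define A' where "A' s = ?S (\<lambda>i. V i s * V' i s)" for s
  define A'' where "A'' s = ?S (\<lambda>i. (V' i s)\<^sup>2 + V i s * (k * exp (2 * s) * (P i s - P (i + 1) s)))" for s
  have dA: "(A has_real_derivative A' s) (at s)" for s
  proof -
    have "((\<lambda>s. ?S (\<lambda>i. (V i s)\<^sup>2)) has_real_derivative ?S (\<lambda>i. 2 * V i s * V' i s)) (at s)"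
      by (intro DERIV_sum) (auto intro!: derivative_eq_intros d(1))
    from DERIV_cdivide[OF this, of 2] show ?thesis
      unfolding A_def A'_def by (simp add: sum_divide_distrib mult_ac)
  qed
  have dA': "(A' has_real_derivative A'' s) (at s)" for s
    unfolding A'_def A''_def
    by (intro DERIV_sum) (auto intro!: derivative_eq_intros d simp: power2_eq_square)
  \<comment> \<open>With p an increment and P = exp (2 p), each \<open>(P - 1) * p\<close> is
    nonnegative; as the increments sum to zero, the coupling term of A'' is nonnegative.\<close>
  have A'': "2 * D s \<le> A'' s" for s
  proof -
    have "0 = ?S (\<lambda>i. V i s - V (i - 1) s)"
      using iper_sum_shift[OF per(1)[of s] assms(2), of "- 1"] by (simp add: sum_subtractf)
    also have "\<dots> \<le> ?S (\<lambda>i. P i s * (V i s - V (i - 1) s))"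
    proof (rule sum_mono)
      fix i
      show "V i s - V (i - 1) s \<le> P i s * (V i s - V (i - 1) s)"
      proof (cases "V i s - V (i - 1) s \<ge> 0")
        case True
        then have "1 \<le> P i s" by (simp add: P_def)
        from mult_right_mono[OF this True] show ?thesis by simp
      next
        case False
        then have "P i s \<le> 1" by (simp add: P_def)
        from mult_right_mono_neg[OF this, of "V i s - V (i - 1) s"] False show ?thesis by simp
      qed
    qed
    also have "\<dots> = ?S (\<lambda>i. V i s * (P i s - P (i + 1) s))" using abel[OF per(1)] by simp
    finally have "0 \<le> k * exp (2 * s) * ?S (\<lambda>i. V i s * (P i s - P (i + 1) s))" using assms(3) by simp
    moreover have "A'' s = 2 * D s + k * exp (2 * s) * ?S (\<lambda>i. V i s * (P i s - P (i + 1) s))"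
      unfolding A''_def D_def by (simp add: sum.distrib sum_distrib_left mult_ac)
    ultimately show ?thesis by simp
  qed
  have E_le: "E s \<le> K" if "s \<le> 0" for s using Kb[OF that] by (simp add: E_def)
  define N0 where "N0 = r ^ 3 / 2 + k / 2 * K"
  have D_le: "D s \<le> N0" if "s \<le> 0" for s
  proof -
    \<comment> \<open>To the left of s, D stays above H and H above its value N at s, so A grows at
      least like N t^2, while the linear bounds on the \<open>V i\<close> allow no more than
      \<open>r^3 / 2 * t^2\<close> to leading order.\<close>
    define N where "N = D s - k / 2 * E s"
    have N: "2 * N \<le> A'' x" if "x \<le> s" for x
    proof -
      have "0 \<le> k / 2 * E x" using E0 assms(3) by simp
      then have "N \<le> D x" using H_anti[OF that] unfolding H_def N_def by linarith
      then show ?thesis using A''[of x] by linarith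
    qed
    have "A s + N * t\<^sup>2 + (- A' s) * t \<le> (r ^ 3 / 2) * ((C - s) + t)\<^sup>2" if "t \<ge> 0" for t
    proof -
      have "A s + A' s * ((s - t) - s) + N * ((s - t) - s)\<^sup>2 \<le> A (s - t)"
        by (rule quadratic_lower_bound_left[OF dA dA' N]) (use that in auto)
      also have "\<dots> \<le> ?S (\<lambda>i. (r * (C - (s - t)))\<^sup>2) / 2"
        unfolding A_def using Vb[of "s - t"] \<open>s \<le> 0\<close> that
        by (intro divide_right_mono sum_mono) (auto simp: abs_le_square_iff[symmetric] intro: order_trans[OF _ abs_ge_self])
      also have "C - (s - t) = (C - s) + t" by simp
      also have "?S (\<lambda>i. (r * ((C - s) + t))\<^sup>2) / 2 = (r ^ 3 / 2) * ((C - s) + t)\<^sup>2"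
        by (simp add: power2_eq_square power3_eq_cube mult_ac)
      finally show ?thesis by (simp add: mult.commute)
    qed
    then have "N \<le> r ^ 3 / 2" by (rule quadratic_coefficient_le)
    moreover have "k / 2 * E s \<le> k / 2 * K" using E_le[OF that] assms(3) by (intro mult_left_mono) auto
    ultimately show ?thesis by (simp add: N_def N0_def)
  qed
  have H_le: "H s \<le> N0" if "s \<le> 0" for s
  proof -
    have "0 \<le> k / 2 * E s" using E0 assms(3) by simp
    then show ?thesis using D_le[OF that] unfolding H_def by linarith
  qed
  have V'_le: "V' i s \<le> N0 + 1" if "s \<le> 0" for i s
  proof -
    obtain j where j: "j \<in> {0..<int r}" "V' j s = V' i s" using iper_range[OF per(2) assms(2)] by blast
    have "(V' j s)\<^sup>2 \<le> ?S (\<lambda>i. (V' i s)\<^sup>2)" using j(1) by (intro member_le_sum) auto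
    then have "(V' i s)\<^sup>2 \<le> 2 * N0" using D_le[OF that] j by (simp add: D_def)
    moreover have "2 * V' i s \<le> (V' i s)\<^sup>2 + 1"
      using zero_le_power2[of "V' i s - 1"] by (simp add: power2_diff)
    moreover have "0 \<le> (V' i s)\<^sup>2" by simp
    ultimately show ?thesis by linarith
  qed
  obtain LH where LH: "(H \<longlongrightarrow> LH) at_bot" using antimono_tendsto_at_bot[of H] H_anti H_le by blast
  have "\<exists>L. ((\<lambda>s. V i s / s) \<longlongrightarrow> L) at_bot" for i
  proof -
    let ?Z = "\<lambda>s. V' i s + H s"
    have dZ: "(?Z has_real_derivative k * exp (2 * s) * (P i s - P (i + 1) s) + - k * E s) (at s)" for s
      by (intro DERIV_add d dH)
    \<comment> \<open>\<open>V' i\<close> increases at most at the rate at which H decreases; this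
      replaces integrability of its derivative.\<close>
    have "k * exp (2 * s) * (P i s - P (i + 1) s) + - k * E s \<le> 0" for s
    proof -
      obtain j where j: "j \<in> {0..<int r}" "P j s = P i s" using iper_range[OF Pper assms(2)] by blast
      have "P j s \<le> ?S (\<lambda>i. P i s)" using j(1) Ppos less_imp_le by (intro member_le_sum) auto
      then have "k * exp (2 * s) * (P i s - P (i + 1) s) \<le> k * exp (2 * s) * ?S (\<lambda>i. P i s)"
        using j Ppos[of "i + 1" s] assms(3) by (intro mult_left_mono) auto
      then show ?thesis by (simp add: E_def mult.assoc)
    qed
    then have "?Z y \<le> ?Z x" if "x \<le> y" for x y
      by (intro DERIV_nonpos_imp_nonincreasing[OF that]) (use dZ in blast)
    moreover have "?Z s \<le> (N0 + 1) + N0" if "s \<le> 0" for s using V'_le[OF that, of i] H_le[OF that] by simp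
    ultimately obtain L where "(?Z \<longlongrightarrow> L) at_bot" using antimono_tendsto_at_bot[of ?Z] by blast
    from tendsto_diff[OF this LH] have "(V' i \<longlongrightarrow> L - LH) at_bot" by simp
    then show ?thesis using tendsto_quotient_at_bot d(1) by blast
  qed
  then show ?thesis by metis
qed

lemma toda_on_radial_ode:
  assumes "toda_on k r UNIV v" "\<And>i z z'. Re z = Re z' \<Longrightarrow> v i z = v i z'"
  defines "V \<equiv> \<lambda>i s. v i (of_real s)"
  shows "(V i has_real_derivative deriv (V i) s) (at s)"
    "(deriv (V i) has_real_derivative k * exp (2 * s) *
      (exp (2 * (V i s - V (i - 1) s)) - exp (2 * (V (i + 1) s - V i s)))) (at s)"
proof -
  have "has_d2 (V i) s (k * exp (2 * s) * (exp (2 * (V i s - V (i - 1) s)) - exp (2 * (V (i + 1) s - V i s))))"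
    using has_lap_of_real_part[OF toda_onD(4)[OF assms(1), of "of_real s" i] assms(2)] by (simp add: V_def toda_term_def)
  then show "(V i has_real_derivative deriv (V i) s) (at s)"
    "(deriv (V i) has_real_derivative k * exp (2 * s) *
      (exp (2 * (V i s - V (i - 1) s)) - exp (2 * (V (i + 1) s - V i s)))) (at s)"
    using has_d2_deriv eventually_nhds_x_imp_x by blast+
qed

lemma toda_slopes:
  assumes "r \<ge> 1" "k > 0" "toda_on k r UNIV v" "\<And>i. vper (v i)"
  shows "\<exists>\<nu>. iper r \<nu> \<and> (\<Sum>i\<in>{0..<int r}. \<nu> i) = 0 \<and> (\<forall>i. \<nu> i - \<nu> (i - 1) \<le> 1) \<and>
    (\<forall>i. ((\<lambda>s. v i (of_real s) / s) \<longlongrightarrow> - \<nu> i) at_bot)"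
proof -
  obtain C K where CK: "C \<ge> 0" "K \<ge> 0"
    "\<And>v z. Re z \<le> 0 \<Longrightarrow> toda_on k r (ball z 1) v \<Longrightarrow>
     exp (2 * Re z) * expsum r v z \<le> K \<and> (\<forall>i. v i z - v (i - 1) z \<le> C - Re z \<and> \<bar>v i z\<bar> \<le> r * (C - Re z))"
    using toda_left_bounds[OF assms(1,2)] by blast
  define V where "V i s = v i (of_real s)" for i s
  define P where "P i s = exp (2 * (V i s - V (i - 1) s))" for i s
  have per: "iper r (\<lambda>i. V i s)" for s unfolding V_def by (rule toda_onD[OF assms(3)])
  have bnd: "exp (2 * s) * (\<Sum>i\<in>{0..<int r}. P i s) \<le> K" "V i s - V (i - 1) s \<le> C - s" "\<bar>V i s\<bar> \<le> r * (C - s)"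
    if "s \<le> 0" for i s
    using CK(3)[of "of_real s" v] toda_on_subset[OF assms(3)] that by (auto simp: expsum_def V_def P_def)
  define V' where "V' i = deriv (V i)" for i
  have d: "(V i has_real_derivative V' i s) (at s)" "(V' i has_real_derivative k * exp (2 * s) * (P i s - P (i + 1) s)) (at s)" for i s
    using toda_on_radial_ode[OF assms(3) toda_radial[OF assms], of i s] unfolding V'_def P_def V_def by simp_all
  have "V (i + int r) = V i" for i using per by (auto simp: iper_def)
  then have per': "iper r (\<lambda>i. V' i s)" for s by (simp add: iper_def V'_def)
  obtain L where L: "\<And>i. ((\<lambda>s. V i s / s) \<longlongrightarrow> L i) at_bot"
    using toda_ode_slopes[OF assms(1,2) per per' d(1) d(2)[unfolded P_def] bnd(1)[unfolded P_def] bnd(3)] by blast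
  have ne: "at_bot \<noteq> (bot :: real filter)" by simp
  have "iper r L"
  proof -
    have "L (i + int r) = L i" for i
      using L[of "i + int r"] L[of i] \<open>\<And>i. V (i + int r) = V i\<close> tendsto_unique[OF ne] by simp
    then show ?thesis by (simp add: iper_def)
  qed
  moreover have "(\<Sum>i\<in>{0..<int r}. L i) = 0"
  proof -
    have "((\<lambda>s. \<Sum>i\<in>{0..<int r}. V i s / s) \<longlongrightarrow> (\<Sum>i\<in>{0..<int r}. L i)) at_bot"
      by (intro tendsto_sum L)
    moreover have "(\<lambda>s. \<Sum>i\<in>{0..<int r}. V i s / s) = (\<lambda>s. 0)"
      using toda_onD(2)[OF assms(3)] by (intro ext) (simp add: V_def sum_divide_distrib[symmetric])
    ultimately show ?thesis using tendsto_unique[OF ne] tendsto_const by metis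
  qed
  \<comment> \<open>Dividing \<open>V i s - V (i - 1) s \<le> C - s\<close> by the negative s
    reverses it.\<close>
  moreover have "- 1 \<le> L i - L (i - 1)" for i
  proof -
    have "((\<lambda>s. C / s - 1) \<longlongrightarrow> 0 - 1) at_bot"
      by (intro tendsto_diff tendsto_const tendsto_divide_0[OF tendsto_const] filterlim_at_bot_imp_at_infinity filterlim_ident)
    moreover have "((\<lambda>s. V i s / s - V (i - 1) s / s) \<longlongrightarrow> L i - L (i - 1)) at_bot"
      by (intro tendsto_diff L)
    moreover have "\<forall>\<^sub>F s in at_bot. C / s - 1 \<le> V i s / s - V (i - 1) s / s"
    proof -
      have "\<forall>\<^sub>F s in at_bot. s < (0 :: real)" by (rule eventually_gt_at_bot)
      then show ?thesis
      proof eventually_elim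
        case (elim s)
        then have "(C - s) / s \<le> (V i s - V (i - 1) s) / s"
          using bnd(2)[of s i] by (intro divide_right_mono_neg) auto
        then show ?case using elim by (simp add: diff_divide_distrib)
      qed
    qed
    ultimately show ?thesis using tendsto_le[OF ne] by fastforce
  qed
  moreover have "\<nu> i - \<nu> (i - 1) \<le> 1" if "\<And>i. - 1 \<le> L i - L (i - 1)" "\<nu> = (\<lambda>i. - L i)" for \<nu> i
    using that(1)[of i] that(2) by simp
  ultimately show ?thesis using L unfolding V_def
    by (intro exI[of _ "\<lambda>i. - L i"]) (auto simp: iper_def sum_negf)
qed

section \<open>The Dirichlet problem\<close>

lemma linear_system_2:
  fixes a b c d e f :: real
  assumes "a * d - b * c \<noteq> 0"
  shows "\<exists>p q. a * p + b * q = e \<and> c * p + d * q = f"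
proof (intro exI conjI)
  let ?D = "a * d - b * c"
  show "a * ((e * d - b * f) / ?D) + b * ((a * f - c * e) / ?D) = e"
  proof -
    have "a * (e * d - b * f) + b * (a * f - c * e) = e * ?D" by (simp add: algebra_simps)
    then show ?thesis using assms by (simp add: add_divide_distrib[symmetric])
  qed
  show "c * ((e * d - b * f) / ?D) + d * ((a * f - c * e) / ?D) = f"
  proof -
    have "c * (e * d - b * f) + d * (a * f - c * e) = f * ?D" by (simp add: algebra_simps)
    then show ?thesis using assms by (simp add: add_divide_distrib[symmetric])
  qed
qed

text \<open>Variation of parameters: the integrals \<open>I\<close> multiply the two homogeneous
  exponentials, and the boundary values fix p and q.\<close>

lemma linear_bvp_exists:
  fixes h :: "real \<Rightarrow> real"
  assumes "\<kappa> > 0" "a < b" "continuous_on {a..b} h"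
  shows "\<exists>y. continuous_on {a..b} y \<and> y a = A \<and> y b = B \<and>
    (\<forall>s\<in>{a<..<b}. has_d2 y s (\<kappa>\<^sup>2 * y s - h s))"
proof -
  define I where "I \<sigma> s = integral {a..s} (\<lambda>t. exp (\<sigma> * t) * h t)" for \<sigma> s
  have dI: "(I \<sigma> has_real_derivative exp (\<sigma> * s) * h s) (at s within {a..b})" if "s \<in> {a..b}" for \<sigma> s
    unfolding I_def using that assms(3) by (intro integral_has_real_derivative continuous_intros)
  have cI: "continuous_on {a..b} (I \<sigma>)" for \<sigma> by (rule DERIV_continuous_on[OF dI])
  have dI': "(I \<sigma> has_real_derivative exp (\<sigma> * s) * h s) (at s)" if "s \<in> {a<..<b}" for \<sigma> s
    using dI[of s \<sigma>] that by (simp add: at_within_Icc_at)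
  \<comment> \<open>The boundary determinant, nonzero because a and b differ.\<close>
  have "exp (\<kappa> * a) * exp (- \<kappa> * b) - exp (- \<kappa> * a) * exp (\<kappa> * b) \<noteq> 0"
    using assms by (simp add: exp_add[symmetric])
  then obtain p q where pq: "exp (\<kappa> * a) * p + exp (- \<kappa> * a) * q = A"
    "exp (\<kappa> * b) * p + exp (- \<kappa> * b) * q =
      B + exp (\<kappa> * b) * (I (- \<kappa>) b / (2 * \<kappa>)) - exp (- \<kappa> * b) * (I \<kappa> b / (2 * \<kappa>))"
    using linear_system_2 by blast
  define y where "y s = exp (\<kappa> * s) * (p - I (- \<kappa>) s / (2 * \<kappa>)) + exp (- \<kappa> * s) * (q + I \<kappa> s / (2 * \<kappa>))" for s
  define y' where "y' s = \<kappa> * (exp (\<kappa> * s) * (p - I (- \<kappa>) s / (2 * \<kappa>))) - \<kappa> * (exp (- \<kappa> * s) * (q + I \<kappa> s / (2 * \<kappa>)))" for s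
  have "continuous_on {a..b} y" unfolding y_def using cI assms(1) by (intro continuous_intros) auto
  moreover have "y a = A" using pq(1) by (simp add: y_def I_def)
  moreover have "y b = B" using pq(2) by (simp add: y_def algebra_simps)
  moreover have "has_d2 y s (\<kappa>\<^sup>2 * y s - h s)" if s: "s \<in> {a<..<b}" for s
  proof (rule has_d2I[of "{a<..<b}"])
    have e: "exp (\<kappa> * t) * exp (- \<kappa> * t) = 1" for t by (simp add: exp_add[symmetric])
    show "(y has_real_derivative y' t) (at t)" if "t \<in> {a<..<b}" for t
    proof -
      have "(y has_real_derivative
        (exp (\<kappa> * t) * \<kappa>) * (p - I (- \<kappa>) t / (2 * \<kappa>)) + (0 - exp (- \<kappa> * t) * h t / (2 * \<kappa>)) * exp (\<kappa> * t) +
        ((exp (- \<kappa> * t) * (- \<kappa>)) * (q + I \<kappa> t / (2 * \<kappa>)) + (0 + exp (\<kappa> * t) * h t / (2 * \<kappa>)) * exp (- \<kappa> * t))) (at t)"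
        unfolding y_def
        by (intro DERIV_add DERIV_mult DERIV_diff DERIV_const DERIV_cdivide dI' that)
          (auto intro!: derivative_eq_intros)
      then show ?thesis by (rule DERIV_cong) (simp add: y'_def algebra_simps)
    qed
    have "(y' has_real_derivative
        \<kappa> * ((exp (\<kappa> * s) * \<kappa>) * (p - I (- \<kappa>) s / (2 * \<kappa>)) + (0 - exp (- \<kappa> * s) * h s / (2 * \<kappa>)) * exp (\<kappa> * s)) -
        \<kappa> * ((exp (- \<kappa> * s) * (- \<kappa>)) * (q + I \<kappa> s / (2 * \<kappa>)) + (0 + exp (\<kappa> * s) * h s / (2 * \<kappa>)) * exp (- \<kappa> * s))) (at s)"
      unfolding y'_def
      by (intro DERIV_add DERIV_mult DERIV_diff DERIV_const DERIV_cdivide DERIV_cmult dI' s)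
        (auto intro!: derivative_eq_intros)
    then show "(y' has_real_derivative \<kappa>\<^sup>2 * y s - h s) (at s)"
    proof (rule DERIV_cong)
      have "\<kappa> * ((exp (\<kappa> * s) * \<kappa>) * (p - I (- \<kappa>) s / (2 * \<kappa>)) + (0 - exp (- \<kappa> * s) * h s / (2 * \<kappa>)) * exp (\<kappa> * s)) -
        \<kappa> * ((exp (- \<kappa> * s) * (- \<kappa>)) * (q + I \<kappa> s / (2 * \<kappa>)) + (0 + exp (\<kappa> * s) * h s / (2 * \<kappa>)) * exp (- \<kappa> * s))
        = \<kappa>\<^sup>2 * y s - (exp (\<kappa> * s) * exp (- \<kappa> * s)) * h s"
        using assms(1) by (simp add: y_def power2_eq_square field_simps)
      then show "\<kappa> * ((exp (\<kappa> * s) * \<kappa>) * (p - I (- \<kappa>) s / (2 * \<kappa>)) + (0 - exp (- \<kappa> * s) * h s / (2 * \<kappa>)) * exp (\<kappa> * s)) -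
        \<kappa> * ((exp (- \<kappa> * s) * (- \<kappa>)) * (q + I \<kappa> s / (2 * \<kappa>)) + (0 + exp (\<kappa> * s) * h s / (2 * \<kappa>)) * exp (- \<kappa> * s))
        = \<kappa>\<^sup>2 * y s - h s" unfolding e by simp
    qed
  qed (use s in auto)
  ultimately show ?thesis by blast
qed

text \<open>The constant barrier would give only \<open>H / \<kappa>\<^sup>2\<close>. The extra
  factor, strictly below 1, is what makes the map in \<open>truncated_bvp\<close> a
  contraction.\<close>

lemma linear_bvp_bound:
  fixes y :: "real \<Rightarrow> real"
  assumes "\<kappa> > 0" "a < b" "continuous_on {a..b} y" "y a \<le> 0" "y b \<le> 0" "H \<ge> 0"
    and d: "\<And>s. s \<in> {a<..<b} \<Longrightarrow> has_d2 y s (\<kappa>\<^sup>2 * y s - h s)"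
    and h: "\<And>s. s \<in> {a<..<b} \<Longrightarrow> h s \<le> H" and "s \<in> {a..b}"
  shows "y s \<le> H / \<kappa>\<^sup>2 * (1 - exp (- \<kappa> * (b - a)))"
proof -
  \<comment> \<open>The barrier subtracted from y is
    \<open>H / \<kappa>\<^sup>2 * (1 - exp (\<kappa> * (s - b)))\<close>: it solves the equation
    with source H, vanishes at b and is nonnegative at a.\<close>
  define u where "u s = y s + (H / \<kappa>\<^sup>2 * exp (\<kappa> * (s - b)) + (- H / \<kappa>\<^sup>2))" for s
  have "continuous_on {a..b} u" unfolding u_def using assms(3) by (intro continuous_intros)
  then obtain m where m: "m \<in> {a..b}" "\<And>x. x \<in> {a..b} \<Longrightarrow> u x \<le> u m"
    using continuous_attains_sup[of "{a..b}" u] assms(2) by auto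
  have "u m \<le> 0"
  proof (rule ccontr)
    assume "\<not> u m \<le> 0"
    have "H / \<kappa>\<^sup>2 * exp (\<kappa> * (a - b)) \<le> H / \<kappa>\<^sup>2 * 1"
      using assms by (intro mult_left_mono) (auto simp: mult_nonneg_nonpos)
    then have "u a \<le> 0" "u b \<le> 0" using assms(4,5) by (auto simp: u_def)
    then have mi: "m \<in> {a<..<b}" using m(1) \<open>\<not> u m \<le> 0\<close> by (auto simp: less_le)
    have "has_d2 (\<lambda>s. exp (\<kappa> * (s - b))) m (\<kappa> * (\<kappa> * exp (\<kappa> * (m - b))))"
      by (rule has_d2I[of UNIV m _ "\<lambda>s. \<kappa> * exp (\<kappa> * (s - b))"]) (auto intro!: derivative_eq_intros)
    then have "has_d2 u m (\<kappa>\<^sup>2 * y m - h m + (H / \<kappa>\<^sup>2 * (\<kappa> * (\<kappa> * exp (\<kappa> * (m - b)))) + 0))"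
      unfolding u_def by (intro has_d2_add has_d2_cmult has_d2_const d mi)
    moreover have "\<forall>\<^sub>F x in nhds m. u x \<le> u m"
    proof -
      have "\<forall>\<^sub>F x in nhds m. x \<in> {a<..<b}" using mi by (intro eventually_nhds_in_open) auto
      then show ?thesis by eventually_elim (use m(2) in auto)
    qed
    ultimately have "\<kappa>\<^sup>2 * y m - h m + (H / \<kappa>\<^sup>2 * (\<kappa> * (\<kappa> * exp (\<kappa> * (m - b)))) + 0) \<le> 0"
      by (rule has_d2_local_max)
    moreover have "\<kappa>\<^sup>2 * y m - h m + (H / \<kappa>\<^sup>2 * (\<kappa> * (\<kappa> * exp (\<kappa> * (m - b)))) + 0) = \<kappa>\<^sup>2 * u m + (H - h m)"
      using assms(1) by (simp add: u_def power2_eq_square field_simps)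
    moreover have "\<kappa>\<^sup>2 * u m > 0" using assms(1) \<open>\<not> u m \<le> 0\<close> by simp
    ultimately show False using h[OF mi] by linarith
  qed
  then have "u s \<le> 0" using m(2)[OF \<open>s \<in> {a..b}\<close>] by simp
  moreover have "H / \<kappa>\<^sup>2 * exp (- \<kappa> * (b - a)) \<le> H / \<kappa>\<^sup>2 * exp (\<kappa> * (s - b))"
  proof -
    have "\<kappa> * (a - b) \<le> \<kappa> * (s - b)" using assms by (intro mult_left_mono) auto
    then have "- \<kappa> * (b - a) \<le> \<kappa> * (s - b)" by (simp add: algebra_simps)
    then show ?thesis using assms by (intro mult_left_mono) auto
  qed
  ultimately show ?thesis by (simp add: u_def algebra_simps)
qed

text \<open>With a discrete index as second coordinate, a whole family becomes one element of a
  Banach space of bounded continuous functions.\<close>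

lemma continuous_on_Times_discrete:
  fixes f :: "'a::topological_space \<times> 'b discrete \<Rightarrow> 'c::topological_space"
  assumes "\<And>i. continuous_on UNIV (\<lambda>s. f (s, i))"
  shows "continuous_on UNIV f"
proof -
  have "continuous_on (UNIV \<times> {i}) f" for i
  proof -
    have "continuous_on (UNIV \<times> {i}) (\<lambda>x. f (fst x, i))"
      by (rule continuous_on_compose2[OF assms]) (auto intro!: continuous_intros)
    then show ?thesis by (rule continuous_on_eq) auto
  qed
  then have "continuous_on (\<Union>i\<in>UNIV. UNIV \<times> {i :: 'b discrete}) f"
    by (intro continuous_on_open_UN open_Times open_discrete) auto
  moreover have "(\<Union>i\<in>UNIV. UNIV \<times> {i}) = (UNIV :: ('a \<times> 'b discrete) set)" by auto
  ultimately show ?thesis by simp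
qed

text \<open>\<open>K x - c T(x)\<close> is a combination of neighbouring differences with nonnegative weights of sum \<open>K\<close>.\<close>

lemma toda_term_contraction:
  assumes "mono G" "\<And>x y. \<bar>G x - G y\<bar> \<le> L * \<bar>x - y\<bar>" "L \<ge> 0" "c \<ge> 0" "2 * c * L \<le> K"
    and "\<And>j. \<bar>x j - y j\<bar> \<le> \<delta>"
  shows "\<bar>(K * x i - c * toda_term G x i) - (K * y i - c * toda_term G y i)\<bar> \<le> K * \<delta>"
proof -
  have slope: "\<exists>\<theta>. 0 \<le> \<theta> \<and> \<theta> \<le> L \<and> G x - G y = \<theta> * (x - y)" for x y
  proof (cases "x = y")
    case False
    then have "0 \<le> (G x - G y) / (x - y)"
      using monoD[OF assms(1)] by (cases "x < y") (auto simp: divide_nonpos_neg divide_nonneg_pos)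
    moreover have "\<bar>(G x - G y) / (x - y)\<bar> \<le> L" using assms(2)[of x y] False by (simp add: pos_divide_le_eq)
    then have "(G x - G y) / (x - y) \<le> L" by (rule abs_le_D1)
    ultimately show ?thesis using False by (intro exI[of _ "(G x - G y) / (x - y)"]) auto
  qed (use assms(3) in auto)
  obtain t u where t: "0 \<le> t" "t \<le> L" "G (x i - x (i - 1)) - G (y i - y (i - 1)) = t * ((x i - x (i - 1)) - (y i - y (i - 1)))"
    and u: "0 \<le> u" "u \<le> L" "G (x (i + 1) - x i) - G (y (i + 1) - y i) = u * ((x (i + 1) - x i) - (y (i + 1) - y i))"
    using slope by blast
  define d where "d j = x j - y j" for j
  have d: "\<bar>d j\<bar> \<le> \<delta>" for j using assms(6) by (simp add: d_def)
  have "(K * x i - c * toda_term G x i) - (K * y i - c * toda_term G y i) =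
    K * d i - c * ((G (x i - x (i - 1)) - G (y i - y (i - 1))) - (G (x (i + 1) - x i) - G (y (i + 1) - y i)))"
    unfolding toda_term_def d_def by (simp add: algebra_simps)
  also have "\<dots> = (K - c * t - c * u) * d i + c * t * d (i - 1) + c * u * d (i + 1)"
    unfolding t(3) u(3) d_def by (simp add: algebra_simps)
  finally have e: "(K * x i - c * toda_term G x i) - (K * y i - c * toda_term G y i) =
    (K - c * t - c * u) * d i + c * t * d (i - 1) + c * u * d (i + 1)" .
  have "c * t \<le> c * L" "c * u \<le> c * L" using t u assms(4) by (auto intro: mult_left_mono)
  then have p: "0 \<le> K - c * t - c * u" "0 \<le> c * t" "0 \<le> c * u" using assms t u by auto
  have "\<bar>(K - c * t - c * u) * d i\<bar> \<le> (K - c * t - c * u) * \<delta>" "\<bar>c * t * d (i - 1)\<bar> \<le> c * t * \<delta>"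
    "\<bar>c * u * d (i + 1)\<bar> \<le> c * u * \<delta>"
  proof -
    have "\<bar>w * d j\<bar> \<le> w * \<delta>" if "0 \<le> w" for w j
      using mult_left_mono[OF d that] that by (simp add: abs_mult)
    then show "\<bar>(K - c * t - c * u) * d i\<bar> \<le> (K - c * t - c * u) * \<delta>" "\<bar>c * t * d (i - 1)\<bar> \<le> c * t * \<delta>"
      "\<bar>c * u * d (i + 1)\<bar> \<le> c * u * \<delta>" using p by blast+
  qed
  then have "\<bar>(K - c * t - c * u) * d i + c * t * d (i - 1) + c * u * d (i + 1)\<bar> \<le>
    (K - c * t - c * u) * \<delta> + c * t * \<delta> + c * u * \<delta>" by linarith
  also have "\<dots> = K * \<delta>" by (simp add: algebra_simps)
  finally show ?thesis unfolding e .
qed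

text \<open>The term \<open>\<kappa>\<^sup>2 * y\<close> is moved to the left-hand side. For
  \<kappa> large the source \<open>h\<close> has Lipschitz constant \<open>\<kappa>\<^sup>2\<close>,
  by \<open>toda_term_contraction\<close>, and the linear solver has norm below
  \<open>1 / \<kappa>\<^sup>2\<close>; Banach's theorem gives the fixed point.\<close>

lemma truncated_bvp:
  fixes A B :: "int \<Rightarrow> real"
  assumes "r \<ge> 1" "k > 0" "a < b" "iper r A" "iper r B" "mono G" "continuous_on UNIV G"
    and bound: "\<And>x. \<bar>G x\<bar> \<le> \<Gamma>" and lip: "\<And>x y. \<bar>G x - G y\<bar> \<le> L * \<bar>x - y\<bar>" and "L \<ge> 0"
  shows "\<exists>v. (\<forall>s. iper r (\<lambda>i. v i s)) \<and> (\<forall>i. continuous_on {a..b} (v i)) \<and> (\<forall>i. v i a = A i \<and> v i b = B i) \<and>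
    (\<forall>i. \<forall>s\<in>{a<..<b}. has_d2 (v i) s (k * exp (2 * s) * toda_term G (\<lambda>j. v j s) i))"
proof -
  \<comment> \<open>\<open>exp (2 * b)\<close> bounds the coefficient on the whole interval, and the
    summand 1 keeps \<kappa> positive when L = 0.\<close>
  define \<kappa> where "\<kappa> = sqrt (2 * (k * exp (2 * b)) * L + 1)"
  have \<kappa>2: "\<kappa>\<^sup>2 = 2 * (k * exp (2 * b)) * L + 1" unfolding \<kappa>_def using assms by simp
  have \<kappa>: "\<kappa> > 0" unfolding \<kappa>_def using assms by (simp add: add_nonneg_pos)
  define h where "h V i s = \<kappa>\<^sup>2 * apply_bcontfun V (s, discrete (i mod int r)) -
    k * exp (2 * s) * toda_term G (\<lambda>j. apply_bcontfun V (s, discrete (j mod int r))) i"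
    for V :: "(real \<times> int discrete) \<Rightarrow>\<^sub>C real" and i s
  have Vcont: "continuous_on X (\<lambda>s. apply_bcontfun V (s, i))" for V :: "(real \<times> int discrete) \<Rightarrow>\<^sub>C real" and X i
    by (rule continuous_on_compose2[OF continuous_on_apply_bcontfun[of UNIV V]]) (auto intro!: continuous_intros)
  have hcont: "continuous_on {a..b} (h V i)" for V i
    unfolding h_def toda_term_def
    by (intro continuous_intros Vcont continuous_on_compose2[OF assms(7)]) auto
  have "\<exists>Y. \<forall>i. continuous_on {a..b} (Y i) \<and> Y i a = A i \<and> Y i b = B i \<and>
    (\<forall>s\<in>{a<..<b}. has_d2 (Y i) s (\<kappa>\<^sup>2 * Y i s - h V i s))" for V
    by (intro choice allI linear_bvp_exists \<kappa> assms(3) hcont)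
  then obtain Y where Y: "\<And>V i. continuous_on {a..b} (Y V i)" "\<And>V i. Y V i a = A i" "\<And>V i. Y V i b = B i"
    "\<And>V i s. s \<in> {a<..<b} \<Longrightarrow> has_d2 (Y V i) s (\<kappa>\<^sup>2 * Y V i s - h V i s)"
    by metis
  \<comment> \<open>Clamping to the interval extends the solutions to the whole line, the domain of
    the function space.\<close>
  define c where "c s = max a (min b s)" for s
  have c: "c s \<in> {a..b}" "continuous_on UNIV c" for s
    unfolding c_def using assms(3) by (auto intro!: continuous_intros)
  have c_id: "c s = s" if "s \<in> {a..b}" for s using that by (auto simp: c_def)
  define F where "F V x = Y V (of_discrete (snd x)) (c (fst x))" for V x
  have Fb: "F V \<in> bcontfun" for V
  proof -
    \<comment> \<open>One bound for all integer indices, available because the boundary data are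
      periodic.\<close>
    obtain M where M: "M \<ge> 0" "\<And>i. \<bar>A i\<bar> \<le> M" "\<And>i. \<bar>B i\<bar> \<le> M"
    proof -
      have "\<bar>A i\<bar> \<le> (\<Sum>j\<in>{0..<int r}. \<bar>A j\<bar> + \<bar>B j\<bar>)" "\<bar>B i\<bar> \<le> (\<Sum>j\<in>{0..<int r}. \<bar>A j\<bar> + \<bar>B j\<bar>)" for i
      proof -
        have "iper r (\<lambda>j. (A j, B j))" using assms(4,5) by (simp add: iper_def)
        from iper_range[OF this assms(1), of i] obtain j where j: "j \<in> {0..<int r}" "A j = A i" "B j = B i" by auto
        have "\<bar>A j\<bar> + \<bar>B j\<bar> \<le> (\<Sum>j\<in>{0..<int r}. \<bar>A j\<bar> + \<bar>B j\<bar>)" using j(1) by (intro member_le_sum) auto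
        then show "\<bar>A i\<bar> \<le> (\<Sum>j\<in>{0..<int r}. \<bar>A j\<bar> + \<bar>B j\<bar>)" "\<bar>B i\<bar> \<le> (\<Sum>j\<in>{0..<int r}. \<bar>A j\<bar> + \<bar>B j\<bar>)"
          using j by auto
      qed
      then show ?thesis using that[of "\<Sum>j\<in>{0..<int r}. \<bar>A j\<bar> + \<bar>B j\<bar>"] by (simp add: sum_nonneg)
    qed
    define H where "H = \<kappa>\<^sup>2 * norm V + k * exp (2 * b) * (2 * \<Gamma>)"
    have \<Gamma>: "\<Gamma> \<ge> 0" using bound[of 0] by linarith
    have H: "H \<ge> 0" unfolding H_def using \<Gamma> assms by simp
    have hH: "\<bar>h V i s\<bar> \<le> H" if "s \<in> {a<..<b}" for i s
    proof -
      have "\<bar>\<kappa>\<^sup>2 * apply_bcontfun V (s, discrete (i mod int r))\<bar> \<le> \<kappa>\<^sup>2 * norm V"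
        using norm_bounded[of V "(s, discrete (i mod int r))"] by (simp add: abs_mult mult_left_mono)
      moreover have "\<bar>toda_term G (\<lambda>j. apply_bcontfun V (s, discrete (j mod int r))) i\<bar> \<le> 2 * \<Gamma>"
        unfolding toda_term_def
        using bound[of "apply_bcontfun V (s, discrete (i mod int r)) - apply_bcontfun V (s, discrete ((i - 1) mod int r))"]
          bound[of "apply_bcontfun V (s, discrete ((i + 1) mod int r)) - apply_bcontfun V (s, discrete (i mod int r))"]
        by linarith
      then have "\<bar>k * exp (2 * s) * toda_term G (\<lambda>j. apply_bcontfun V (s, discrete (j mod int r))) i\<bar> \<le> k * exp (2 * b) * (2 * \<Gamma>)"
        unfolding abs_mult using that assms(2) by (intro mult_mono) auto
      ultimately show ?thesis unfolding h_def H_def by linarith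
    qed
    have YH: "\<sigma> * Y V i s \<le> M + H / \<kappa>\<^sup>2" if "s \<in> {a..b}" "\<sigma> = 1 \<or> \<sigma> = - 1" for i s \<sigma>
    proof -
      have "\<sigma> * Y V i s + (- M) \<le> H / \<kappa>\<^sup>2 * (1 - exp (- \<kappa> * (b - a)))"
      proof (rule linear_bvp_bound[OF \<kappa> assms(3) _ _ _ H _ _ that(1), where h = "\<lambda>s. \<sigma> * h V i s - \<kappa>\<^sup>2 * M"])
        show "continuous_on {a..b} (\<lambda>s. \<sigma> * Y V i s + (- M))" by (intro continuous_intros Y)
        show "\<sigma> * Y V i a + (- M) \<le> 0" "\<sigma> * Y V i b + (- M) \<le> 0" using that(2) Y(2,3)[of V i] M(2,3)[of i] by auto
        fix s assume s: "s \<in> {a<..<b}"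
        show "has_d2 (\<lambda>s. \<sigma> * Y V i s + (- M)) s (\<kappa>\<^sup>2 * (\<sigma> * Y V i s + (- M)) - (\<sigma> * h V i s - \<kappa>\<^sup>2 * M))"
          using has_d2_add[OF has_d2_cmult[OF Y(4)[OF s, of V i], of \<sigma>] has_d2_const[of "- M"]] by (simp add: algebra_simps)
        have "0 \<le> \<kappa>\<^sup>2 * M" using M(1) by simp
        then show "\<sigma> * h V i s - \<kappa>\<^sup>2 * M \<le> H" using hH[OF s, of i] that(2) by auto
      qed
      also have "\<dots> \<le> H / \<kappa>\<^sup>2 * 1" using H by (intro mult_left_mono) auto
      finally show ?thesis by simp
    qed
    have "Y V i s \<le> M + H / \<kappa>\<^sup>2" "- Y V i s \<le> M + H / \<kappa>\<^sup>2" if "s \<in> {a..b}" for i s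
      using YH[OF that, of 1 i] YH[OF that, of "- 1" i] by simp_all
    then have "norm (F V x) \<le> M + H / \<kappa>\<^sup>2" for x
      using c(1) unfolding F_def real_norm_def abs_le_iff by blast
    moreover have "continuous_on UNIV (F V)"
      by (rule continuous_on_Times_discrete) (auto simp: F_def intro!: continuous_on_compose2[OF Y(1) c(2)] c(1))
    ultimately show ?thesis by (rule bcontfun_normI[rotated])
  qed
  define \<Phi> where "\<Phi> V = Bcontfun (F V)" for V
  have \<Phi>: "apply_bcontfun (\<Phi> V) x = F V x" for V x
    unfolding \<Phi>_def using Fb by (simp add: Bcontfun_inverse)
  define \<theta> where "\<theta> = 1 - exp (- \<kappa> * (b - a))"
  have \<theta>: "0 \<le> \<theta>" "\<theta> < 1" unfolding \<theta>_def using \<kappa> assms(3) by (auto simp: mult_nonneg_nonneg)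
  have "\<exists>!V. \<Phi> V = V"
  proof (rule banach_fix_type[where f = \<Phi> and c = \<theta>])
    show "0 \<le> \<theta>" "\<theta> < 1" by (fact \<theta>)+
    show "\<forall>V W. dist (\<Phi> V) (\<Phi> W) \<le> \<theta> * dist V W"
    proof (intro allI)
      fix V W :: "(real \<times> int discrete) \<Rightarrow>\<^sub>C real"
      define \<delta> where "\<delta> = dist V W"
      have h\<delta>: "\<bar>h V i s - h W i s\<bar> \<le> \<kappa>\<^sup>2 * \<delta>" if "s \<in> {a<..<b}" for i s
        unfolding h_def
      proof (rule toda_term_contraction[OF assms(6) lip assms(10)])
        show "0 \<le> k * exp (2 * s)" using assms(2) by simp
        have "k * exp (2 * s) * L \<le> k * exp (2 * b) * L" using that assms(2,10) by (intro mult_right_mono) auto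
        then show "2 * (k * exp (2 * s)) * L \<le> \<kappa>\<^sup>2" unfolding \<kappa>2 by simp
        show "\<bar>apply_bcontfun V (s, discrete (j mod int r)) - apply_bcontfun W (s, discrete (j mod int r))\<bar> \<le> \<delta>" for j
          using dist_bounded[of V "(s, discrete (j mod int r))" W] by (simp add: \<delta>_def dist_real_def)
      qed
      have *: "Y V i s - Y W i s \<le> \<theta> * \<delta>" if "s \<in> {a..b}" "\<And>i s. s \<in> {a<..<b} \<Longrightarrow> \<bar>h V i s - h W i s\<bar> \<le> \<kappa>\<^sup>2 * \<delta>" for V W i s
      proof -
        have "Y V i s + (- 1) * Y W i s \<le> (\<kappa>\<^sup>2 * \<delta>) / \<kappa>\<^sup>2 * (1 - exp (- \<kappa> * (b - a)))"
        proof (rule linear_bvp_bound[OF \<kappa> assms(3) _ _ _ _ _ _ that(1), where h = "\<lambda>s. h V i s - h W i s"])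
          show "continuous_on {a..b} (\<lambda>s. Y V i s + (- 1) * Y W i s)" by (intro continuous_intros Y)
          show "0 \<le> \<kappa>\<^sup>2 * \<delta>" by (simp add: \<delta>_def)
          fix s assume s: "s \<in> {a<..<b}"
          show "has_d2 (\<lambda>s. Y V i s + (- 1) * Y W i s) s (\<kappa>\<^sup>2 * (Y V i s + (- 1) * Y W i s) - (h V i s - h W i s))"
            using has_d2_add[OF Y(4)[OF s, of V i] has_d2_cmult[OF Y(4)[OF s, of W i], of "- 1"]] by (simp add: algebra_simps)
          show "h V i s - h W i s \<le> \<kappa>\<^sup>2 * \<delta>" using that(2)[OF s, of i] by simp
        qed (auto simp: Y(2,3))
        then show ?thesis using \<kappa> by (simp add: \<theta>_def mult.commute)
      qed
      show "dist (\<Phi> V) (\<Phi> W) \<le> \<theta> * dist V W"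
      proof (rule dist_bound)
        fix x
        have "Y V (of_discrete (snd x)) (c (fst x)) - Y W (of_discrete (snd x)) (c (fst x)) \<le> \<theta> * \<delta>"
          by (rule *[OF c(1)]) (use h\<delta> in auto)
        moreover have "Y W (of_discrete (snd x)) (c (fst x)) - Y V (of_discrete (snd x)) (c (fst x)) \<le> \<theta> * \<delta>"
          by (rule *[OF c(1)]) (use h\<delta> in \<open>auto simp: abs_minus_commute\<close>)
        ultimately show "dist (apply_bcontfun (\<Phi> V) x) (apply_bcontfun (\<Phi> W) x) \<le> \<theta> * dist V W"
          unfolding \<Phi> F_def dist_real_def \<delta>_def[symmetric] by (simp add: abs_le_iff)
      qed
    qed
  qed
  then obtain V where V: "\<Phi> V = V" by blast
  have VY: "apply_bcontfun V (s, discrete i) = Y V i s" if "s \<in> {a..b}" for s i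
    using \<Phi>[of V "(s, discrete i)"] V c_id[OF that] by (simp add: F_def discrete_inverse)
  \<comment> \<open>Periodicity is imposed by reading the fixed point only at the representatives of
    the index modulo r; \<open>h\<close> was set up in the same way.\<close>
  define v where "v i s = apply_bcontfun V (s, discrete (i mod int r))" for i s
  have v: "v i s = Y V (i mod int r) s" if "s \<in> {a..b}" for s i unfolding v_def by (rule VY[OF that])
  show ?thesis
  proof (intro exI[of _ v] conjI allI ballI)
    show "iper r (\<lambda>i. v i s)" for s by (simp add: iper_def v_def)
    show "continuous_on {a..b} (v i)" for i using Vcont by (simp add: v_def[abs_def])
    show "v i a = A i" "v i b = B i" for i
      using v[of a i] v[of b i] assms(3) Y(2,3) iper_mod[OF assms(4)] iper_mod[OF assms(5)] by auto
    fix i s assume s: "s \<in> {a<..<b}"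
    have "has_d2 (Y V (i mod int r)) s (\<kappa>\<^sup>2 * Y V (i mod int r) s - h V (i mod int r) s)" by (rule Y(4)[OF s])
    moreover have "\<kappa>\<^sup>2 * Y V (i mod int r) s - h V (i mod int r) s = k * exp (2 * s) * toda_term G (\<lambda>j. v j s) i"
    proof -
      have "toda_term G (\<lambda>j. apply_bcontfun V (s, discrete (j mod int r))) (i mod int r) = toda_term G (\<lambda>j. v j s) i"
        unfolding toda_term_def v_def by (simp add: mod_simps)
      then show ?thesis using s VY[of s "i mod int r"] by (simp add: h_def)
    qed
    moreover have "\<forall>\<^sub>F t in nhds s. Y V (i mod int r) t = v i t"
    proof -
      have "\<forall>\<^sub>F t in nhds s. t \<in> {a<..<b}" using s by (intro eventually_nhds_in_open) auto
      then show ?thesis by eventually_elim (simp add: v)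
    qed
    ultimately show "has_d2 (v i) s (k * exp (2 * s) * toda_term G (\<lambda>j. v j s) i)"
      using has_d2_cong by metis
  qed
qed

section \<open>Clipping the exponential and removing the clip\<close>

lemma vper_Re: "vper (\<lambda>z. f (Re z))"
  by (simp add: vper_def)

lemma continuous_on_strip_Re: "continuous_on {a..b} f \<Longrightarrow> continuous_on (strip a b) (\<lambda>z. f (Re z))"
  by (rule continuous_on_compose2[of "{a..b}" f]) (auto intro!: continuous_intros simp: strip_def)

text \<open>Freezing the argument at \<open>X\<close> gives the bounded, globally Lipschitz and
  still monotone nonlinearity that \<open>truncated_bvp\<close> needs.\<close>

definition clip_exp :: "real \<Rightarrow> real \<Rightarrow> real" where
  "clip_exp X x = exp (2 * min x X)"

lemma clip_exp: "mono (clip_exp X)" "continuous_on UNIV (clip_exp X)" "\<bar>clip_exp X x\<bar> \<le> exp (2 * X)"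
  "\<bar>clip_exp X x - clip_exp X y\<bar> \<le> 2 * exp (2 * X) * \<bar>x - y\<bar>"
proof -
  show "mono (clip_exp X)" by (auto simp: clip_exp_def min_def intro!: monoI)
  show "continuous_on UNIV (clip_exp X)" unfolding clip_exp_def by (intro continuous_intros)
  show "\<bar>clip_exp X x\<bar> \<le> exp (2 * X)" by (simp add: clip_exp_def)
  have "clip_exp X x - clip_exp X y \<le> 2 * exp (2 * X) * \<bar>x - y\<bar>" for x y
  proof -
    define d where "d = min x X - min y X"
    have "1 - exp (- (2 * d)) \<le> 2 * d" using exp_ge_add_one_self[of "- (2 * d)"] by simp
    also have "\<dots> \<le> 2 * \<bar>x - y\<bar>" by (auto simp: d_def min_def abs_if)
    finally have "exp (2 * min x X) * (1 - exp (- (2 * d))) \<le> exp (2 * min x X) * (2 * \<bar>x - y\<bar>)"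
      by (intro mult_left_mono) auto
    also have "\<dots> \<le> exp (2 * X) * (2 * \<bar>x - y\<bar>)" by (intro mult_right_mono) auto
    finally show ?thesis by (simp add: clip_exp_def d_def right_diff_distrib exp_add[symmetric])
  qed
  from this[of x y] this[of y x] show "\<bar>clip_exp X x - clip_exp X y\<bar> \<le> 2 * exp (2 * X) * \<bar>x - y\<bar>"
    by (simp add: abs_le_iff abs_minus_commute)
qed

lemma iper_bounded:
  fixes A :: "int \<Rightarrow> real"
  assumes "iper r A" "r \<ge> 1"
  shows "\<bar>A i\<bar> \<le> (\<Sum>j\<in>{0..<int r}. \<bar>A j\<bar>)"
proof -
  obtain j where "j \<in> {0..<int r}" "A j = A i" using iper_range[OF assms] by blast
  then show ?thesis using member_le_sum[of j "{0..<int r}" "\<lambda>j. \<bar>A j\<bar>"] by simp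
qed

text \<open>Comparison with the zero solution, valid for the clipped system too, bounds the solution
  by its boundary data, so the clip at \<open>2 * M\<close> never acts.\<close>

lemma toda_bvp:
  fixes A B :: "int \<Rightarrow> real"
  assumes "r \<ge> 1" "k > 0" "a < b" "iper r A" "iper r B"
    "(\<Sum>i\<in>{0..<int r}. A i) = 0" "(\<Sum>i\<in>{0..<int r}. B i) = 0"
  shows "\<exists>V. toda_on k r {z. a < Re z \<and> Re z < b} (\<lambda>i z. V i (Re z)) \<and>
    (\<forall>i. continuous_on {a..b} (V i)) \<and> (\<forall>i. V i a = A i \<and> V i b = B i)"
proof -
  define M where "M = (\<Sum>j\<in>{0..<int r}. \<bar>A j\<bar>) + (\<Sum>j\<in>{0..<int r}. \<bar>B j\<bar>)"
  have M: "\<bar>A i\<bar> \<le> M" "\<bar>B i\<bar> \<le> M" for i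
    using iper_bounded[OF assms(4,1), of i] iper_bounded[OF assms(5,1), of i]
      sum_nonneg[of "{0..<int r}" "\<lambda>j. \<bar>A j\<bar>"] sum_nonneg[of "{0..<int r}" "\<lambda>j. \<bar>B j\<bar>"]
    unfolding M_def by auto
  define G where "G = clip_exp (2 * M)"
  obtain V where V: "\<And>s. iper r (\<lambda>i. V i s)" "\<And>i. continuous_on {a..b} (V i)" "\<And>i. V i a = A i" "\<And>i. V i b = B i"
    "\<And>i s. s \<in> {a<..<b} \<Longrightarrow> has_d2 (V i) s (k * exp (2 * s) * toda_term G (\<lambda>j. V j s) i)"
    using truncated_bvp[OF assms(1-5) clip_exp(1)[of "2 * M"] clip_exp(2) clip_exp(3) clip_exp(4)]
    unfolding G_def by (metis exp_ge_zero mult_nonneg_nonneg zero_le_numeral)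
  have lapV: "has_lap (\<lambda>z. V i (Re z)) z (k * exp (2 * Re z) * toda_term G (\<lambda>j. V j (Re z)) i)"
    if "a < Re z" "Re z < b" for z i
    using V(5)[of "Re z" i] that by (intro has_lap_Re) auto
  have lap0: "has_lap (\<lambda>_. 0) z (k * exp (2 * Re z) * toda_term G (\<lambda>_. 0) i)" for z i
    using has_lap_const[of 0 z] by (simp add: toda_term_def)
  have "\<bar>V i s\<bar> \<le> M" if s: "s \<in> {a..b}" for i s
  proof -
    have z: "of_real s \<in> strip a b" using s by (simp add: strip_def)
    have "V i (Re (of_real s)) - 0 \<le> M + 0 * Re (of_real s)"
    proof (rule comparison[where G = G and x = "\<lambda>i z. V i (Re z)" and y = "\<lambda>_ _. 0" and a = a and b = b and k = k and r = r])
      show "\<exists>l. has_lap (\<lambda>z. V i (Re z)) z l \<and> k * exp (2 * Re z) * toda_term G (\<lambda>j. V j (Re z)) i \<le> l"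
        if "a < Re z" "Re z < b" for z i using lapV[OF that] by blast
      show "\<exists>l. has_lap (\<lambda>_. 0) z l \<and> l \<le> k * exp (2 * Re z) * toda_term G (\<lambda>_. 0) i" for z i using lap0 by blast
      show "V i (Re z) - 0 \<le> M + 0 * Re z" if "Re z = a \<or> Re z = b" for z i
        using that V(3,4) M[of i] by (auto simp: abs_le_iff)
    qed (use assms V z clip_exp in \<open>auto simp: G_def vper_Re vper_def iper_def intro: continuous_on_strip_Re\<close>)
    moreover have "0 - V i (Re (of_real s)) \<le> M + 0 * Re (of_real s)"
    proof (rule comparison[where G = G and y = "\<lambda>i z. V i (Re z)" and x = "\<lambda>_ _. 0" and a = a and b = b and k = k and r = r])
      show "\<exists>l. has_lap (\<lambda>z. V i (Re z)) z l \<and> l \<le> k * exp (2 * Re z) * toda_term G (\<lambda>j. V j (Re z)) i"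
        if "a < Re z" "Re z < b" for z i using lapV[OF that] by blast
      show "\<exists>l. has_lap (\<lambda>_. 0) z l \<and> k * exp (2 * Re z) * toda_term G (\<lambda>_. 0) i \<le> l" for z i using lap0 by blast
      show "0 - V i (Re z) \<le> M + 0 * Re z" if "Re z = a \<or> Re z = b" for z i
        using that V(3,4) M[of i] by (auto simp: abs_le_iff)
    qed (use assms V z clip_exp in \<open>auto simp: G_def vper_Re vper_def iper_def intro: continuous_on_strip_Re\<close>)
    ultimately show ?thesis by simp
  qed
  then have "V i s - V j s \<le> 2 * M" if "s \<in> {a..b}" for i j s
    using that abs_le_D1[of "V i s" M] abs_le_D2[of "V j s" M] by fastforce
  then have GV: "toda_term G (\<lambda>j. V j s) i = toda_term (\<lambda>x. exp (2 * x)) (\<lambda>j. V j s) i" if "s \<in> {a..b}" for s i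
    using that by (simp add: toda_term_def G_def clip_exp_def min_absorb1)
  \<comment> \<open>The sum is harmonic with zero boundary values. As a constant family with
    \<open>G\<close> the identity it has zero \<open>toda_term\<close>, so \<open>comparison\<close>
    becomes the scalar maximum principle.\<close>
  have sum0: "(\<Sum>i\<in>{0..<int r}. V i s) = 0" if s: "s \<in> {a<..<b}" for s
  proof -
    have *: "c * (\<Sum>i\<in>{0..<int r}. V i s) \<le> 0" if c: "c = 1 \<or> c = - 1" for c
    proof -
      define y where "y z = c * (\<Sum>i\<in>{0..<int r}. V i (Re z))" for z
      have lapy: "has_lap y z 0" if "a < Re z" "Re z < b" for z
      proof -
        have "has_lap y z (c * (\<Sum>i\<in>{0..<int r}. k * exp (2 * Re z) * toda_term G (\<lambda>j. V j (Re z)) i))"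
          unfolding y_def by (intro has_lap_cmult has_lap_sum lapV that)
        moreover have "(\<Sum>i\<in>{0..<int r}. toda_term G (\<lambda>j. V j (Re z)) i) = 0"
        proof -
          have "iper r (\<lambda>i. V (i - 1) (Re z))" using iper_shift[OF V(1), of "- 1"] by simp
          then have "iper r (\<lambda>i. G (V i (Re z) - V (i - 1) (Re z)))" using V(1)[of "Re z"] by (simp add: iper_def)
          from iper_sum_shift[OF this assms(1), of 1] show ?thesis by (simp add: toda_term_def sum_subtractf)
        qed
        ultimately show ?thesis by (simp add: sum_distrib_left[symmetric])
      qed
      have "y (of_real s) - 0 \<le> 0 + 0 * Re (of_real s)"
      proof (rule comparison[where G = "\<lambda>x. x" and x = "\<lambda>_. y" and y = "\<lambda>_ _. 0" and a = a and b = b and k = k and r = r])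
        show "\<exists>l. has_lap y z l \<and> k * exp (2 * Re z) * toda_term (\<lambda>x. x) (\<lambda>j. y z) i \<le> l"
          if "a < Re z" "Re z < b" for z i using lapy[OF that] by (auto simp: toda_term_def)
        show "\<exists>l. has_lap (\<lambda>_. 0) z l \<and> l \<le> k * exp (2 * Re z) * toda_term (\<lambda>x. x) (\<lambda>_. 0) i" for z i
          using has_lap_const[of 0 z] by (auto simp: toda_term_def)
        show "continuous_on (strip a b) y"
          unfolding y_def using V(2) by (intro continuous_intros continuous_on_strip_Re)
        show "y z - 0 \<le> 0 + 0 * Re z" if "Re z = a \<or> Re z = b" for z
          using that V(3,4) assms(6,7) by (auto simp: y_def)
      qed (use assms s in \<open>auto simp: y_def vper_def iper_def strip_def intro: monoI\<close>)
      then show ?thesis by (simp add: y_def)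
    qed
    show ?thesis using *[of 1] *[of "- 1"] by simp
  qed
  have "toda_on k r {z. a < Re z \<and> Re z < b} (\<lambda>i z. V i (Re z))"
    unfolding toda_on_def
  proof (intro conjI allI ballI)
    show "continuous_on {z. a < Re z \<and> Re z < b} (\<lambda>z. V i (Re z))" for i
      by (rule continuous_on_subset[OF continuous_on_strip_Re[OF V(2)]]) (auto simp: strip_def)
    fix z i assume "z \<in> {z. a < Re z \<and> Re z < b}"
    then show "has_lap (\<lambda>z. V i (Re z)) z (k * exp (2 * Re z) * toda_term (\<lambda>x. exp (2 * x)) (\<lambda>j. V j (Re z)) i)"
      using lapV[of z i] GV[of "Re z" i] by simp
  qed (use V(1) sum0 in auto)
  then show ?thesis using V(2-4) by blast
qed

section \<open>Existence for prescribed slopes\<close>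

text \<open>The coefficients grow by \<open>2\<close> along the cycle, except at one index \<open>m\<close> with
  \<open>\<nu>\<^sub>m - \<nu>\<^sub>m\<^sub>-\<^sub>1 < 1\<close>, where the exponential decay absorbs any power of \<open>s\<close>. Such an \<open>m\<close> exists because
  the increments of \<open>\<nu>\<close> over one period add up to \<open>0 < r\<close>.\<close>

lemma log_subsolution:
  fixes \<nu> :: "int \<Rightarrow> real"
  assumes "r \<ge> 1" "k > 0" "iper r \<nu>" and \<nu>: "\<And>i. \<nu> i - \<nu> (i - 1) \<le> 1"
  shows "\<exists>c B. iper r c \<and> (\<forall>i. 0 \<le> c i \<and> c i \<le> 2 * real r) \<and> B \<ge> 1 \<and> (\<forall>s i. s \<le> - B \<longrightarrow>
    k * exp (2 * s) * toda_term (\<lambda>x. exp (2 * x)) (\<lambda>j. - c j * ln (- s) - \<nu> j * s) i \<le> c i / s\<^sup>2)"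
proof -
  define \<kappa> where "\<kappa> i = 1 - (\<nu> i - \<nu> (i - 1))" for i
  have "(\<Sum>i\<in>{0..<int r}. \<kappa> i) = r"
    using iper_sum_shift[OF assms(3,1), of "- 1"] by (simp add: \<kappa>_def sum_subtractf)
  have "\<exists>m. \<kappa> m > 0"
  proof (rule ccontr)
    assume "\<not> (\<exists>m. \<kappa> m > 0)"
    then have "(\<Sum>i\<in>{0..<int r}. \<kappa> i) \<le> 0" by (intro sum_nonpos) (auto simp: not_less)
    then show False using \<open>_ = real r\<close> assms(1) by simp
  qed
  then obtain m where m: "\<kappa> m > 0" by blast
  \<comment> \<open>The values 2, 4, ..., 2 r along the cycle, starting at m.\<close>
  define c where "c i = real_of_int (2 * ((i - m) mod int r) + 2)" for i
  have c: "iper r c" "2 \<le> c i" "c i \<le> 2 * real r" for i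
  proof -
    show "iper r c" unfolding iper_def c_def by (simp add: diff_add_eq[symmetric])
    have "0 \<le> (i - m) mod int r" "(i - m) mod int r \<le> int r - 1" using assms(1) by auto
    then have "2 * ((i - m) mod int r) + 2 \<ge> 2" "2 * ((i - m) mod int r) + 2 \<le> 2 * int r" by linarith+
    then show "2 \<le> c i" "c i \<le> 2 * real r" unfolding c_def by linarith+
  qed
  \<comment> \<open>The drop of \<open>c\<close> at m costs less than the power
    \<open>t^(4 * r)\<close> of t = - s, which is beaten by exponential decay because
    \<open>\<kappa> m > 0\<close>.\<close>
  have "((\<lambda>t. k * exp (4 * r * ln t - 2 * \<kappa> m * t)) \<longlongrightarrow> 0) at_top" using m by real_asymp
  then have "\<forall>\<^sub>F t in at_top. k * exp (4 * r * ln t - 2 * \<kappa> m * t) < 2" by (rule order_tendstoD) simp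
  then obtain B0 where B0: "\<And>t. t \<ge> B0 \<Longrightarrow> k * exp (4 * r * ln t - 2 * \<kappa> m * t) < 2"
    unfolding eventually_at_top_linorder by blast
  define B where "B = max 1 (max k B0)"
  have main: "k * exp (2 * s) * toda_term (\<lambda>x. exp (2 * x)) (\<lambda>j. - c j * ln (- s) - \<nu> j * s) i \<le> c i / s\<^sup>2"
    if s: "s \<le> - B" for s i
  proof -
    define l where "l = ln (- s)"
    have s1: "- s \<ge> 1" "- s \<ge> k" "- s \<ge> B0" using s by (auto simp: B_def)
    then have l: "l \<ge> 0" by (simp add: l_def)
    have "- s = exp l" using s1 by (simp add: l_def)
    then have "(- s)\<^sup>2 = exp (2 * l)" by (simp only: exp_double)
    then have s2: "s\<^sup>2 = exp (2 * l)" by simp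
    \<comment> \<open>The second exponential of \<open>toda_term\<close> enters with a minus sign
      and is dropped.\<close>
    have "k * exp (2 * s) * toda_term (\<lambda>x. exp (2 * x)) (\<lambda>j. - c j * ln (- s) - \<nu> j * s) i
      \<le> k * exp (2 * s) * exp (2 * ((- c i * l - \<nu> i * s) - (- c (i - 1) * l - \<nu> (i - 1) * s)))"
      unfolding toda_term_def l_def[symmetric] using assms(2) by (intro mult_left_mono) auto
    also have "\<dots> = k * exp (2 * \<kappa> i * s - 2 * (c i - c (i - 1)) * l)"
      by (simp add: \<kappa>_def exp_add[symmetric] algebra_simps)
    also have "\<dots> \<le> 2 * exp (- 2 * l)"
    proof (cases "(i - m) mod int r = 0")
      case False
      then have "(i - 1 - m) mod int r = (i - m) mod int r - 1"
      proof -
        have "0 \<le> (i - m) mod int r" "(i - m) mod int r < int r" using assms(1) by auto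
        then have "((i - m) mod int r - 1) mod int r = (i - m) mod int r - 1"
          using False by (intro mod_pos_pos_trivial) linarith+
        then show ?thesis unfolding mod_diff_left_eq by (simp add: algebra_simps)
      qed
      then have "c i - c (i - 1) = 2" by (simp add: c_def)
      moreover have "2 * \<kappa> i * s \<le> 0" using \<nu>[of i] s1 by (simp add: \<kappa>_def mult_nonneg_nonpos)
      ultimately have "k * exp (2 * \<kappa> i * s - 2 * (c i - c (i - 1)) * l) \<le> k * exp (- 4 * l)"
        using assms(2) by (intro mult_left_mono) auto
      \<comment> \<open>One power of - s absorbs the constant k.\<close>
      also have "\<dots> \<le> exp l * exp (- 4 * l)" using s1 by (intro mult_right_mono) (auto simp: l_def)
      also have "\<dots> = exp (- 3 * l)" by (simp add: exp_add[symmetric])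
      also have "\<dots> \<le> exp (- 2 * l)" using l by simp
      also have "\<dots> \<le> 2 * exp (- 2 * l)" by simp
      finally show ?thesis .
    next
      case True
      have "\<kappa> i = \<kappa> m"
      proof -
        have "iper r (\<lambda>i. \<nu> (i - 1))" using iper_shift[OF assms(3), of "- 1"] by simp
        then have "iper r \<kappa>" using assms(3) by (simp add: iper_def \<kappa>_def)
        moreover have "i mod int r = m mod int r" using True by (simp add: mod_eq_dvd_iff dvd_eq_mod_eq_0)
        ultimately show ?thesis using iper_mod by metis
      qed
      have "2 * \<kappa> i * s - 2 * (c i - c (i - 1)) * l \<le> (4 * r * l - 2 * \<kappa> m * (- s)) - 2 * l"
      proof -
        have "2 * (c (i - 1) - c i) * l \<le> 2 * (2 * real r - 2) * l"
          using c(2)[of i] c(3)[of "i - 1"] l by (intro mult_right_mono) auto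
        then show ?thesis using \<open>\<kappa> i = \<kappa> m\<close> l by (simp add: algebra_simps)
      qed
      then have "k * exp (2 * \<kappa> i * s - 2 * (c i - c (i - 1)) * l) \<le> k * exp ((4 * r * l - 2 * \<kappa> m * (- s)) - 2 * l)"
        using assms(2) by (intro mult_left_mono) auto
      also have "\<dots> = (k * exp (4 * r * l - 2 * \<kappa> m * (- s))) * exp (- 2 * l)"
        by (simp add: exp_diff exp_minus divide_inverse)
      also have "\<dots> \<le> 2 * exp (- 2 * l)" using B0[OF s1(3)] by (intro mult_right_mono) (auto simp: l_def)
      finally show ?thesis .
    qed
    also have "\<dots> = 2 / s\<^sup>2" by (simp add: s2 exp_minus divide_inverse)
    also have "\<dots> \<le> c i / s\<^sup>2" using c(2) by (intro divide_right_mono) auto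
    finally show ?thesis .
  qed
  show ?thesis
  proof (intro exI conjI allI impI)
    show "iper r c" "B \<ge> 1" using c(1) by (auto simp: B_def)
    show "0 \<le> c i" "c i \<le> 2 * real r" for i using c(2)[of i] c(3)[of i] by auto
  qed (rule main)
qed

section \<open>Comparison with the logarithmic profiles\<close>

lemma has_d2_log_profile:
  assumes "s < 0"
  shows "has_d2 (\<lambda>s. - c * ln (- s) - \<nu> * s + d) s (c / s\<^sup>2)"
proof (rule has_d2I[of "{..<0}"])
  show "((\<lambda>s. - c * ln (- s) - \<nu> * s + d) has_real_derivative - c / t - \<nu>) (at t)" if "t \<in> {..<0}" for t
    using that by (auto intro!: derivative_eq_intros)
  have "((\<lambda>s. inverse s) has_real_derivative - (inverse s * inverse s)) (at s)"
    using DERIV_inverse[of s] assms by (simp add: power2_eq_square)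
  then have "((\<lambda>s. - c * inverse s - \<nu>) has_real_derivative - c * (- (inverse s * inverse s)) - 0) (at s)"
    by (intro DERIV_diff DERIV_cmult DERIV_const)
  then show "((\<lambda>s. - c / s - \<nu>) has_real_derivative c / s\<^sup>2) (at s)"
    by (simp add: power2_eq_square divide_inverse)
qed (use assms in auto)

text \<open>\<open>toda_term\<close> does not see the additive constant d, which is therefore free
  to fit the profile under the solution at the two edges.\<close>

lemma toda_lower_bound:
  assumes "r \<ge> 1" "k > 0" "iper r c" "iper r \<nu>" "B > 0"
    and sub: "\<And>s i. s \<le> - B \<Longrightarrow>
      k * exp (2 * s) * toda_term (\<lambda>x. exp (2 * x)) (\<lambda>j. - c j * ln (- s) - \<nu> j * s) i \<le> c i / s\<^sup>2"
    and v: "toda_on k r {z. a < Re z \<and> Re z < - B} v" "\<And>i. vper (v i)" "\<And>i. continuous_on (strip a (- B)) (v i)"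
    and bdry: "\<And>z i. Re z = a \<or> Re z = - B \<Longrightarrow> - c i * ln (- Re z) - \<nu> i * Re z + d \<le> v i z"
    and z: "z \<in> strip a (- B)"
  shows "- c i * ln (- Re z) - \<nu> i * Re z + d \<le> v i z"
proof -
  have "(- c i * ln (- Re z) - \<nu> i * Re z + d) - v i z \<le> 0 + 0 * Re z"
  proof (rule comparison[where G = "\<lambda>x. exp (2 * x)" and x = "\<lambda>i z. - c i * ln (- Re z) - \<nu> i * Re z + d"
        and y = v and k = k and r = r and a = a and b = "- B"])
    show "continuous_on (strip a (- B)) (\<lambda>z. - c i * ln (- Re z) - \<nu> i * Re z + d)" for i
      using assms(5) by (intro continuous_intros) (auto simp: strip_def)
    show "\<exists>l. has_lap (\<lambda>z. - c i * ln (- Re z) - \<nu> i * Re z + d) z l \<and>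
       k * exp (2 * Re z) * toda_term (\<lambda>x. exp (2 * x)) (\<lambda>j. - c j * ln (- Re z) - \<nu> j * Re z + d) i \<le> l"
      if "a < Re z" "Re z < - B" for z i
    proof -
      have "has_lap (\<lambda>z. - c i * ln (- Re z) - \<nu> i * Re z + d) z (c i / (Re z)\<^sup>2)"
        by (rule has_lap_Re[of "\<lambda>s. - c i * ln (- s) - \<nu> i * s + d"]) (use has_d2_log_profile that assms(5) in simp)
      moreover have "toda_term (\<lambda>x. exp (2 * x)) (\<lambda>j. - c j * ln (- Re z) - \<nu> j * Re z + d) i =
        toda_term (\<lambda>x. exp (2 * x)) (\<lambda>j. - c j * ln (- Re z) - \<nu> j * Re z) i"
        by (simp add: toda_term_def)
      ultimately show ?thesis using sub[of "Re z" i] that by auto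
    qed
    show "\<exists>l. has_lap (v i) z l \<and> l \<le> k * exp (2 * Re z) * toda_term (\<lambda>x. exp (2 * x)) (\<lambda>j. v j z) i"
      if "a < Re z" "Re z < - B" for z i using toda_onD(4)[OF v(1), of z i] that by auto
    show "iper r (\<lambda>i. - c i * ln (- Re z) - \<nu> i * Re z + d)" for z using assms(3,4) by (simp add: iper_def)
    show "(- c i * ln (- Re z) - \<nu> i * Re z + d) - v i z \<le> 0 + 0 * Re z" if "Re z = a \<or> Re z = - B" for z i
      using bdry[OF that, of i] by simp
    show "vper (\<lambda>z. - c i * ln (- Re z) - \<nu> i * Re z + d)" for i by (simp add: vper_def)
  qed (use assms(1,2) v z toda_onD(1)[OF v(1)] mono_exp2 in auto)
  then show ?thesis by simp
qed

text \<open>This symmetry exchanges subsolutions and supersolutions, so every lower bound for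
  solutions also yields an upper bound.\<close>

lemma toda_reverse:
  assumes "r \<ge> 1" "toda_on k r U v"
  shows "toda_on k r U (\<lambda>i z. - v (- i) z)"
  unfolding toda_on_def
proof (intro conjI allI ballI)
  show per: "iper r (\<lambda>i. - v (- i) z)" for z
  proof -
    have "v (- (i + int r)) z = v (- i) z" for i
      using toda_onD(1)[OF assms(2), of z] unfolding iper_def
      by (metis add.commute add_minus_cancel minus_add_distrib diff_add_cancel uminus_add_conv_diff)
    then show ?thesis by (simp add: iper_def)
  qed
  show "(\<Sum>i\<in>{0..<int r}. - v (- i) z) = 0" if "z \<in> U" for z
  proof -
    have "(\<Sum>i\<in>{0..<int r}. v (- i) z) = (\<Sum>i\<in>{1 - int r..<1 - int r + int r}. v i z)"
      by (rule sum.reindex_bij_witness[of _ uminus uminus]) auto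
    also have "\<dots> = (\<Sum>i\<in>{0..<int r}. v i z)" by (rule iper_sum_window[OF toda_onD(1)[OF assms(2)] assms(1)])
    finally show ?thesis using toda_onD(2)[OF assms(2) that] by (simp add: sum_negf)
  qed
  show "continuous_on U (\<lambda>z. - v (- i) z)" for i by (intro continuous_intros toda_onD(3)[OF assms(2)])
  fix z and i :: int assume "z \<in> U"
  have e: "- (i + 1) = - i - 1" "- (i - 1) = - i + 1" by simp_all
  from \<open>z \<in> U\<close> show "has_lap (\<lambda>z. - v (- i) z) z (k * exp (2 * Re z) * toda_term (\<lambda>x. exp (2 * x)) (\<lambda>j. - v (- j) z) i)"
    using has_lap_cmult[OF toda_onD(4)[OF assms(2), of z "- i"], of "- 1"]
    unfolding toda_term_def e by (simp add: right_diff_distrib)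
qed

lemma has_lap_cong:
  assumes "has_lap f z l" "\<forall>\<^sub>F x in nhds z. f x = g x"
  shows "has_lap g z l"
proof -
  obtain a b where ab: "has_d2 (\<lambda>t. f (z + of_real t)) 0 a" "has_d2 (\<lambda>t. f (z + \<i> * of_real t)) 0 b" "l = a + b"
    using assms(1) unfolding has_lap_def by blast
  have "filterlim (\<lambda>t. z + of_real t) (nhds z) (nhds (0::real))"
    "filterlim (\<lambda>t. z + \<i> * of_real t) (nhds z) (nhds (0::real))"
    by (auto intro!: tendsto_eq_intros filterlim_ident)
  then have "\<forall>\<^sub>F t in nhds (0::real). f (z + of_real t) = g (z + of_real t)"
    "\<forall>\<^sub>F t in nhds (0::real). f (z + \<i> * of_real t) = g (z + \<i> * of_real t)"
    using assms(2) unfolding filterlim_iff by auto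
  then show ?thesis
    unfolding has_lap_def using has_d2_cong[OF ab(1)] has_d2_cong[OF ab(2)] ab(3) by (intro exI conjI)
qed

lemma toda_on_cong:
  assumes "toda_on k r U v" "open U" "\<And>z i. z \<in> U \<Longrightarrow> v i z = w i z" "\<And>z. iper r (\<lambda>i. w i z)"
  shows "toda_on k r U w"
  unfolding toda_on_def
proof (intro conjI allI ballI)
  show "continuous_on U (w i)" for i
    using continuous_on_eq[OF toda_onD(3)[OF assms(1)]] assms(3) by blast
  show "(\<Sum>i\<in>{0..<int r}. w i z) = 0" if "z \<in> U" for z
    using toda_onD(2)[OF assms(1) that] assms(3)[OF that] by simp
  fix z i assume z: "z \<in> U"
  have "\<forall>\<^sub>F x in nhds z. x \<in> U" using assms(2) z by (rule eventually_nhds_in_open)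
  then have "\<forall>\<^sub>F x in nhds z. v i x = w i x" by eventually_elim (rule assms(3))
  from has_lap_cong[OF toda_onD(4)[OF assms(1) z] this]
  show "has_lap (w i) z (k * exp (2 * Re z) * toda_term (\<lambda>x. exp (2 * x)) (\<lambda>j. w j z) i)"
    using assms(3)[OF z] by (simp add: toda_term_def)
qed (use assms(4) in auto)

text \<open>The left end point \<open>- n\<^sup>2\<close> is much farther out than the right end point \<open>n\<close>: two approximations
  differ by \<open>O(log n)\<close> on the left and by \<open>o(1)\<close> near \<open>n\<close>, and linear interpolation between these
  bounds tends to \<open>0\<close> at every fixed point.\<close>

lemma toda_exists:
  fixes \<nu> :: "int \<Rightarrow> real"
  assumes "r \<ge> 1" "k > 0" "iper r \<nu>" "(\<Sum>i\<in>{0..<int r}. \<nu> i) = 0" "\<And>i. \<nu> i - \<nu> (i - 1) \<le> 1"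
  shows "\<exists>V. toda_on k r UNIV (\<lambda>i z. V i (Re z)) \<and> (\<forall>i. ((\<lambda>s. V i s / s) \<longlongrightarrow> - \<nu> i) at_bot)"
proof -
  have \<nu>': "iper r (\<lambda>i. - \<nu> (- i))"
  proof -
    have "\<nu> (- (i + int r)) = \<nu> (- i)" for i
      using assms(3)[unfolded iper_def, rule_format, of "- (i + int r)"] by simp
    then show ?thesis by (simp add: iper_def)
  qed
  have \<nu>'1: "- \<nu> (- i) - - \<nu> (- (i - 1)) \<le> 1" for i
    using assms(5)[of "- i + 1"] by (simp add: algebra_simps)
  obtain c B1 where c: "iper r c" "\<And>i. 0 \<le> c i" "\<And>i. c i \<le> 2 * real r" "B1 \<ge> 1" "\<And>s i. s \<le> - B1 \<Longrightarrow>
    k * exp (2 * s) * toda_term (\<lambda>x. exp (2 * x)) (\<lambda>j. - c j * ln (- s) - \<nu> j * s) i \<le> c i / s\<^sup>2"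
    using log_subsolution[OF assms(1,2,3,5)] by blast
  obtain c' B2 where c': "iper r c'" "\<And>i. 0 \<le> c' i" "\<And>i. c' i \<le> 2 * real r" "B2 \<ge> 1" "\<And>s i. s \<le> - B2 \<Longrightarrow>
    k * exp (2 * s) * toda_term (\<lambda>x. exp (2 * x)) (\<lambda>j. - c' j * ln (- s) - (- \<nu> (- j)) * s) i \<le> c' i / s\<^sup>2"
    using log_subsolution[OF assms(1,2) \<nu>' \<nu>'1] by blast
  define B where "B = max B1 B2"
  have B: "B \<ge> 1" "B \<ge> B1" "B \<ge> B2" using c(4) by (auto simp: B_def)
  obtain C1 K where CK: "C1 \<ge> 0"
    "\<And>v z. Re z \<le> 0 \<Longrightarrow> toda_on k r (ball z 1) v \<Longrightarrow>
     exp (2 * Re z) * expsum r v z \<le> K \<and> (\<forall>i. v i z - v (i - 1) z \<le> C1 - Re z \<and> \<bar>v i z\<bar> \<le> r * (C1 - Re z))"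
    using toda_left_bounds[OF assms(1,2)] by blast
  obtain \<delta> where \<delta>: "(\<delta> \<longlongrightarrow> 0) at_top"
    "\<And>v z i. Re z \<ge> 0 \<Longrightarrow> toda_on k r (ball z 2) v \<Longrightarrow> \<bar>v i z\<bar> \<le> \<delta> (Re z)"
    using toda_decay[OF assms(1,2)] by blast
  define M where "M = (\<Sum>j\<in>{0..<int r}. \<bar>\<nu> j\<bar>)"
  have M: "\<bar>\<nu> i\<bar> \<le> M" for i unfolding M_def by (rule iper_bounded[OF assms(3,1)])
  have M0: "M \<ge> 0" by (simp add: M_def sum_nonneg)
  \<comment> \<open>Settles the edge Re z = - B, where the solution is at least
    \<open>- r * (C1 + B)\<close> and the linear profile at most \<open>M * B\<close>.\<close>
  define C where "C = r * (C1 + B) + M * B"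
  have C0: "C \<ge> 0" unfolding C_def using CK(1) B M0 by simp
  \<comment> \<open>The margin 3 leaves room for unit balls about points with real part - B and
    makes n - 2 positive.\<close>
  define n0 where "n0 = nat \<lceil>B\<rceil> + 3"
  have n0: "real n \<ge> B + 3" if "n \<ge> n0" for n
  proof -
    have "real n \<ge> real n0" using that by simp
    also have "real n0 \<ge> B + 3" unfolding n0_def using B by linarith
    finally show ?thesis .
  qed
  have nsq: "real n \<le> (real n)\<^sup>2" for n by (simp add: power2_eq_square) (metis le_square of_nat_le_iff of_nat_mult)
  define Q where "Q n V \<longleftrightarrow> toda_on k r {z. - (real n)\<^sup>2 < Re z \<and> Re z < real n} (\<lambda>i z. V i (Re z)) \<and>
    (\<forall>i. continuous_on {- (real n)\<^sup>2..real n} (V i)) \<and> (\<forall>i. V i (- (real n)\<^sup>2) = \<nu> i * (real n)\<^sup>2 \<and> V i (real n) = 0)"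
    for n V
  have "\<exists>V. Q n V" if "n \<ge> n0" for n
    unfolding Q_def using toda_bvp[OF assms(1,2), of "- (real n)\<^sup>2" "real n" "\<lambda>i. \<nu> i * (real n)\<^sup>2" "\<lambda>_. 0"] n0[OF that] B nsq[of n] assms(3,4)
    by (simp add: iper_def sum_distrib_right[symmetric])
  then have "\<forall>n. \<exists>V. n0 \<le> n \<longrightarrow> Q n V" by blast
  from choice[OF this] obtain V where "\<forall>n. n0 \<le> n \<longrightarrow> Q n (V n)" ..
  then have V_Q: "n \<ge> n0 \<Longrightarrow> Q n (V n)" for n by blast
  have V: "\<And>n. n \<ge> n0 \<Longrightarrow> toda_on k r {z. - (real n)\<^sup>2 < Re z \<and> Re z < real n} (\<lambda>i z. V n i (Re z))"
    "\<And>n i. n \<ge> n0 \<Longrightarrow> continuous_on {- (real n)\<^sup>2..real n} (V n i)"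
    "\<And>n i. n \<ge> n0 \<Longrightarrow> V n i (- (real n)\<^sup>2) = \<nu> i * (real n)\<^sup>2"
    "\<And>n i. n \<ge> n0 \<Longrightarrow> V n i (real n) = 0"
    using V_Q unfolding Q_def by blast+
  \<comment> \<open>General in c, \<nu> and v because it serves twice: for \<open>V n\<close>, and
    for its reversal, which gives the upper bound.\<close>
  have low: "- c i * ln (- s) - \<nu> i * s + (- C) \<le> v i (of_real s)"
    if n: "n \<ge> n0" and s: "- (real n)\<^sup>2 \<le> s" "s \<le> - B" and c: "iper r c" "\<And>i. 0 \<le> c i"
      "\<And>s i. s \<le> - B \<Longrightarrow> k * exp (2 * s) * toda_term (\<lambda>x. exp (2 * x)) (\<lambda>j. - c j * ln (- s) - \<nu> j * s) i \<le> c i / s\<^sup>2"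
      and \<nu>: "iper r \<nu>" "\<And>i. \<bar>\<nu> i\<bar> \<le> M"
      and v: "toda_on k r {z. - (real n)\<^sup>2 < Re z \<and> Re z < real n} v" "\<And>i. vper (v i)"
        "\<And>i. continuous_on (strip (- (real n)\<^sup>2) (real n)) (v i)" "\<And>i z. Re z = - (real n)\<^sup>2 \<Longrightarrow> v i z = \<nu> i * (real n)\<^sup>2"
    for n s i c \<nu> v
  proof -
    have nn: "- (real n)\<^sup>2 + 1 \<le> - B" using n0[OF n] nsq[of n] by linarith
    have n1: "(real n)\<^sup>2 \<ge> 1" using nn B by linarith
    have "- c i * ln (- Re (of_real s)) - \<nu> i * Re (of_real s) + (- C) \<le> v i (of_real s)"
    proof (rule toda_lower_bound[where B = B and a = "- (real n)\<^sup>2" and k = k and r = r])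
      show "toda_on k r {z. - (real n)\<^sup>2 < Re z \<and> Re z < - B} v"
        by (rule toda_on_subset[OF v(1)]) (use B in auto)
      show "continuous_on (strip (- (real n)\<^sup>2) (- B)) (v i)" for i
        by (rule continuous_on_subset[OF v(3)]) (use B in \<open>auto simp: strip_def\<close>)
      show "of_real s \<in> strip (- (real n)\<^sup>2) (- B)" using s by (simp add: strip_def)
      fix z i assume "Re z = - (real n)\<^sup>2 \<or> Re z = - B"
      then show "- c i * ln (- Re z) - \<nu> i * Re z + (- C) \<le> v i z"
      proof
        assume z: "Re z = - (real n)\<^sup>2"
        have "0 \<le> c i * ln ((real n)\<^sup>2)" using c(2) n1 by simp
        then show ?thesis using v(4)[OF z, of i] C0 unfolding z by simp
      next
        assume z: "Re z = - B"
        have "ball z 1 \<subseteq> {z. - (real n)\<^sup>2 < Re z \<and> Re z < real n}"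
        proof
          fix y assume "y \<in> ball z 1"
          then have "\<bar>Re (z - y)\<bar> < 1" using abs_Re_le_cmod[of "z - y"] by (simp add: dist_norm)
          then show "y \<in> {z. - (real n)\<^sup>2 < Re z \<and> Re z < real n}" using z nn B n0[OF n] by (auto simp: abs_less_iff)
        qed
        moreover have "Re z \<le> 0" using z B by simp
        ultimately have "\<bar>v i z\<bar> \<le> r * (C1 - Re z)" using CK(2)[OF _ toda_on_subset[OF v(1)]] by blast
        moreover have "0 \<le> c i * ln B" using c(2) B by simp
        moreover have "\<nu> i * B \<le> M * B" using \<nu>(2)[of i] B by (intro mult_right_mono) (auto simp: abs_le_iff)
        ultimately show ?thesis unfolding z C_def by simp
      qed
    qed (use assms(1,2) B c \<nu> v in auto)
    then show ?thesis by simp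
  qed
  have bnd: "\<bar>V n i s + \<nu> i * s\<bar> \<le> 2 * r * ln (- s) + C" if n: "n \<ge> n0" and s: "- (real n)\<^sup>2 \<le> s" "s \<le> - B" for n i s
  proof -
    have cont: "continuous_on (strip (- (real n)\<^sup>2) (real n)) (\<lambda>z. V n i (Re z))" for i
      by (rule continuous_on_strip_Re[OF V(2)[OF n]])
    have ln: "ln (- s) \<ge> 0" using s B by simp
    have "- c i * ln (- s) - \<nu> i * s + (- C) \<le> V n i (Re (of_real s))"
      by (rule low[OF n s c(1,2) _ assms(3) M V(1)[OF n]]) (use c(5) B cont V(3)[OF n] in \<open>auto simp: vper_Re\<close>)
    moreover have "- c' (- i) * ln (- s) - - \<nu> (- (- i)) * s + (- C) \<le> - V n (- (- i)) (Re (of_real s))"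
    proof (rule low[OF n s c'(1,2) _ \<nu>' _ toda_reverse[OF assms(1) V(1)[OF n]]])
      show "vper (\<lambda>z. - V n (- i) (Re z))" for i by (simp add: vper_def)
      show "continuous_on (strip (- (real n)\<^sup>2) (real n)) (\<lambda>z. - V n (- i) (Re z))" for i
        by (intro continuous_intros cont)
    qed (use c'(5) B M V(3)[OF n] in auto)
    moreover have "c i * ln (- s) \<le> 2 * r * ln (- s)" "c' (- i) * ln (- s) \<le> 2 * r * ln (- s)"
      using c(3) c'(3) ln by (auto intro: mult_right_mono)
    ultimately show ?thesis by (simp add: abs_le_iff)
  qed
  \<comment> \<open>\<open>toda_decay\<close> needs a ball of radius 2 in the domain, so
    approximations are compared at m - 2 instead of m.\<close>
  have dec: "\<bar>V n i (real m - 2)\<bar> \<le> \<delta> (real m - 2)" if n: "n \<ge> n0" "n0 \<le> m" "m \<le> n" for n m i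
  proof -
    have "ball (of_real (real m - 2)) 2 \<subseteq> {z. - (real n)\<^sup>2 < Re z \<and> Re z < real n}"
    proof
      fix y :: complex assume "y \<in> ball (of_real (real m - 2)) 2"
      then have "\<bar>Re (of_real (real m - 2) - y)\<bar> < 2"
        using abs_Re_le_cmod[of "of_real (real m - 2) - y"] by (simp add: dist_norm)
      then show "y \<in> {z. - (real n)\<^sup>2 < Re z \<and> Re z < real n}"
        using that n0[OF that(2)] B by (auto simp: abs_less_iff intro: le_less_trans[of _ 0])
    qed
    then show ?thesis
      using \<delta>(2)[OF _ toda_on_subset[OF V(1)[OF n(1)]], of "of_real (real m - 2)" i] n0[OF that(2)] B by simp
  qed
  \<comment> \<open>Twice the bound of \<open>bnd\<close> at the left end, hence a bound for the gap
    of two approximations there.\<close>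
  define \<Lambda> where "\<Lambda> n = 2 * (2 * r * ln ((real n)\<^sup>2) + C)" for n
  \<comment> \<open>The affine interpolation from \<open>\<Lambda> n\<close> plus the right-hand
    error, at - n^2, to that error at n - 2. At fixed s the interpolated term is of order log n /
    n.\<close>
  define e where "e n s = 2 * \<delta> (real n - 2) + \<Lambda> n * (real n - 2 - s) / (real n - 2 + (real n)\<^sup>2)" for n s
  have cmp: "\<bar>V n i s - V m i s\<bar> \<le> e n s"
    if nm: "n0 \<le> n" "n \<le> m" and s: "- (real n)\<^sup>2 \<le> s" "s \<le> real n - 2" for n m i s
  proof -
    have m: "n0 \<le> m" using nm by simp
    have nmsq: "(real n)\<^sup>2 \<le> (real m)\<^sup>2" using nm by (intro power_mono) auto
    have nB: "- (real n)\<^sup>2 \<le> - B" using n0[OF nm(1)] nsq[of n] by linarith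
    define \<beta> where "\<beta> = - \<Lambda> n / (real n - 2 + (real n)\<^sup>2)"
    have den: "real n - 2 + (real n)\<^sup>2 > 0" using n0[OF nm(1)] B by (simp add: add_pos_nonneg)
    have esplit: "e n t = (2 * \<delta> (real n - 2) - \<beta> * (real n - 2)) + \<beta> * t" for t
    proof -
      define x where "x = \<Lambda> n / (real n - 2 + (real n)\<^sup>2)"
      have "e n t = 2 * \<delta> (real n - 2) + x * (real n - 2 - t)" "\<beta> = - x"
        unfolding e_def \<beta>_def x_def by simp_all
      then show ?thesis by (simp add: algebra_simps)
    qed
    have \<delta>0: "0 \<le> \<delta> (real n - 2)" using dec[OF nm(1) nm(1) order_refl, of 0] by linarith
    have main: "V p i (Re (of_real s)) - V q i (Re (of_real s)) \<le> (2 * \<delta> (real n - 2) - \<beta> * (real n - 2)) + \<beta> * Re (of_real s)"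
      if pq: "n0 \<le> p" "n0 \<le> q" "n \<le> p" "n \<le> q" for p q
    proof (rule comparison_toda[OF assms(1,2), where a = "- (real n)\<^sup>2" and b = "real n - 2"])
      have sq: "(real n)\<^sup>2 \<le> (real p)\<^sup>2" "(real n)\<^sup>2 \<le> (real q)\<^sup>2" using pq by (auto intro: power_mono)
      have sq': "- (real p)\<^sup>2 < x" "- (real q)\<^sup>2 < x" if "- (real n)\<^sup>2 < x" for x
        using sq that by linarith+
      have sq'': "- (real p)\<^sup>2 \<le> x" "- (real q)\<^sup>2 \<le> x" if "- (real n)\<^sup>2 \<le> x" for x
        using sq that by linarith+
      show "toda_on k r {z. - (real n)\<^sup>2 < Re z \<and> Re z < real n - 2} (\<lambda>i z. V p i (Re z))"
        by (rule toda_on_subset[OF V(1)[OF pq(1)]]) (use pq in \<open>auto intro: sq' sq''\<close>)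
      show "toda_on k r {z. - (real n)\<^sup>2 < Re z \<and> Re z < real n - 2} (\<lambda>i z. V q i (Re z))"
        by (rule toda_on_subset[OF V(1)[OF pq(2)]]) (use pq in \<open>auto intro: sq' sq''\<close>)
      show "continuous_on (strip (- (real n)\<^sup>2) (real n - 2)) (\<lambda>z. V p i (Re z))" for i
        by (rule continuous_on_strip_Re[OF continuous_on_subset[OF V(2)[OF pq(1)]]]) (use pq in \<open>auto intro: sq' sq''\<close>)
      show "continuous_on (strip (- (real n)\<^sup>2) (real n - 2)) (\<lambda>z. V q i (Re z))" for i
        by (rule continuous_on_strip_Re[OF continuous_on_subset[OF V(2)[OF pq(2)]]]) (use pq in \<open>auto intro: sq' sq''\<close>)
      show "of_real s \<in> strip (- (real n)\<^sup>2) (real n - 2)" using s by (simp add: strip_def)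
      fix z i assume "Re z = - (real n)\<^sup>2 \<or> Re z = real n - 2"
      then show "V p i (Re z) - V q i (Re z) \<le> (2 * \<delta> (real n - 2) - \<beta> * (real n - 2)) + \<beta> * Re z"
      proof
        assume z: "Re z = - (real n)\<^sup>2"
        have "e n (- (real n)\<^sup>2) = 2 * \<delta> (real n - 2) + \<Lambda> n" unfolding e_def using den by simp
        moreover have "\<bar>V p i (Re z) + \<nu> i * Re z\<bar> \<le> 2 * r * ln (- Re z) + C" "\<bar>V q i (Re z) + \<nu> i * Re z\<bar> \<le> 2 * r * ln (- Re z) + C"
          using bnd[OF pq(1), of "Re z" i] bnd[OF pq(2), of "Re z" i] sq nB unfolding z by auto
        then have "V p i (Re z) - V q i (Re z) \<le> \<Lambda> n" unfolding \<Lambda>_def z by (simp add: abs_le_iff)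
        ultimately show ?thesis using esplit[of "- (real n)\<^sup>2"] \<delta>0 z by simp
      next
        assume z: "Re z = real n - 2"
        show ?thesis using dec[OF pq(1) nm(1) pq(3), of i] dec[OF pq(2) nm(1) pq(4), of i] unfolding z by (simp add: abs_le_iff)
      qed
    qed (auto simp: vper_Re)
    show ?thesis using main[of n m] main[of m n] nm m esplit[of s] by (simp add: abs_le_iff)
  qed
  have e0: "(\<lambda>n. e n s) \<longlonglongrightarrow> 0" for s
  proof -
    have "filterlim (\<lambda>n. real n - 2) at_top sequentially" by real_asymp
    then have "(\<lambda>n. \<delta> (real n - 2)) \<longlonglongrightarrow> 0" by (rule filterlim_compose[OF \<delta>(1)])
    moreover have "(\<lambda>n. \<Lambda> n * (real n - 2 - s) / (real n - 2 + (real n)\<^sup>2)) \<longlonglongrightarrow> 0"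
      unfolding \<Lambda>_def using assms(1) by real_asymp
    ultimately have "(\<lambda>n. e n s) \<longlonglongrightarrow> 2 * 0 + 0" unfolding e_def by (intro tendsto_intros)
    then show ?thesis by simp
  qed
  have evn: "\<forall>\<^sub>F n in sequentially. n0 \<le> n \<and> - (real n)\<^sup>2 \<le> s \<and> s \<le> real n - 2" for s
  proof -
    have "\<forall>\<^sub>F n in sequentially. - (real n)\<^sup>2 \<le> s" "\<forall>\<^sub>F n in sequentially. s \<le> real n - 2" by real_asymp+
    then show ?thesis by (intro eventually_conj eventually_ge_at_top)
  qed
  have "convergent (\<lambda>n. V n i s)" for i s
  proof -
    have "Cauchy (\<lambda>n. V n i s)"
    proof (rule CauchyI')
      fix \<epsilon> :: real assume "\<epsilon> > 0"
      have "\<forall>\<^sub>F n in sequentially. e n s < \<epsilon>" using order_tendstoD(2)[OF e0] \<open>\<epsilon> > 0\<close> .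
      with evn[of s] have "\<forall>\<^sub>F n in sequentially. (n0 \<le> n \<and> - (real n)\<^sup>2 \<le> s \<and> s \<le> real n - 2) \<and> e n s < \<epsilon>"
        by (rule eventually_conj)
      then obtain N where N: "\<And>n. n \<ge> N \<Longrightarrow> (n0 \<le> n \<and> - (real n)\<^sup>2 \<le> s \<and> s \<le> real n - 2) \<and> e n s < \<epsilon>"
        unfolding eventually_sequentially by blast
      show "\<exists>N. \<forall>m\<ge>N. \<forall>n>m. dist (V m i s) (V n i s) < \<epsilon>"
        unfolding dist_real_def using N cmp by (meson le_less_trans less_imp_le order_trans)
    qed
    then show ?thesis by (rule Cauchy_convergent)
  qed
  then obtain W where W: "\<And>i s. (\<lambda>n. V n i s) \<longlonglongrightarrow> W i s" unfolding convergent_def by metis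
  have Wper: "iper r (\<lambda>i. W i s)" for s
    unfolding iper_def
  proof
    fix i
    have "\<forall>\<^sub>F n in sequentially. V n (i + int r) s = V n i s"
      using eventually_ge_at_top[of n0]
    proof eventually_elim
      case (elim n)
      then show ?case using toda_onD(1)[OF V(1)[OF elim], of "of_real s"] by (simp add: iper_def)
    qed
    then have "(\<lambda>n. V n (i + int r) s) \<longlonglongrightarrow> W i s" using W by (simp cong: tendsto_cong)
    then show "W (i + int r) s = W i s" using W LIMSEQ_unique by blast
  qed
  have Wsum: "(\<Sum>i\<in>{0..<int r}. W i s) = 0" for s
  proof -
    have "(\<lambda>n. \<Sum>i\<in>{0..<int r}. V n i s) \<longlonglongrightarrow> (\<Sum>i\<in>{0..<int r}. W i s)" by (intro tendsto_sum W)
    moreover have "\<forall>\<^sub>F n in sequentially. (\<Sum>i\<in>{0..<int r}. V n i s) = 0"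
      using evn[of "s + 1"] evn[of "s - 1"]
    proof eventually_elim
      case (elim n)
      then show ?case using toda_onD(2)[OF V(1), of n "of_real s"] by auto
    qed
    then have "(\<lambda>n. \<Sum>i\<in>{0..<int r}. V n i s) \<longlonglongrightarrow> 0" by (rule tendsto_eventually)
    ultimately show ?thesis using LIMSEQ_unique by blast
  qed
  \<comment> \<open>W is so far only a pointwise limit. On each interval comparison identifies it
    with the Dirichlet solution U having the same end values, and so it inherits the
    equation.\<close>
  have WR: "toda_on k r {z. - R < Re z \<and> Re z < R} (\<lambda>i z. W i (Re z))" if R: "R > 0" for R
  proof -
    have "- R < R" using R by simp
    from toda_bvp[OF assms(1,2) this Wper[of "- R"] Wper[of R] Wsum Wsum]
    obtain U where U: "toda_on k r {z. - R < Re z \<and> Re z < R} (\<lambda>i z. U i (Re z))"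
      "\<And>i. continuous_on {- R..R} (U i)" "\<And>i. U i (- R) = W i (- R)" "\<And>i. U i R = W i R"
      by blast
    have UW: "U i s = W i s" if s: "- R < s" "s < R" for i s
    proof -
      have dist: "\<bar>V n i s - U i s\<bar> \<le> (\<Sum>j\<in>{0..<int r}. \<bar>V n j (- R) - W j (- R)\<bar>) + (\<Sum>j\<in>{0..<int r}. \<bar>V n j R - W j R\<bar>)" (is "_ \<le> ?d")
        if n: "n0 \<le> n" "- (real n)\<^sup>2 \<le> - R" "R \<le> real n - 2" for n
      proof -
        have nper: "iper r (\<lambda>i. V n i s)" for s using toda_onD(1)[OF V(1)[OF n(1)], of "of_real s"] by simp
        have b: "\<bar>V n j t - W j t\<bar> \<le> ?d" if "t = - R \<or> t = R" for j t
        proof -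
          have "iper r (\<lambda>j. V n j t - W j t)" using nper[of t] Wper[of t] by (simp add: iper_def)
          from iper_bounded[OF this assms(1), of j] that show ?thesis
            by (auto intro: add_increasing add_increasing2 sum_nonneg)
        qed
        have t: "toda_on k r {z. - R < Re z \<and> Re z < R} (\<lambda>i z. V n i (Re z))"
          by (rule toda_on_subset[OF V(1)[OF n(1)]]) (use n in auto)
        have co: "continuous_on (strip (- R) R) (\<lambda>z. V n i (Re z))" for i
          by (rule continuous_on_strip_Re[OF continuous_on_subset[OF V(2)[OF n(1)]]]) (use n in auto)
        have "V n i (Re (of_real s)) - U i (Re (of_real s)) \<le> ?d + 0 * Re (of_real s)"
        proof (rule comparison_toda[OF assms(1,2) t U(1)])
          show "V n i (Re z) - U i (Re z) \<le> ?d + 0 * Re z" if "Re z = - R \<or> Re z = R" for z i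
            using b[OF that, of i] that U(3,4) by (auto simp: abs_le_iff)
        qed (use co continuous_on_strip_Re[OF U(2)] s in \<open>auto simp: vper_Re strip_def\<close>)
        moreover have "U i (Re (of_real s)) - V n i (Re (of_real s)) \<le> ?d + 0 * Re (of_real s)"
        proof (rule comparison_toda[OF assms(1,2) U(1) t])
          show "U i (Re z) - V n i (Re z) \<le> ?d + 0 * Re z" if "Re z = - R \<or> Re z = R" for z i
            using b[OF that, of i] that U(3,4) by (auto simp: abs_le_iff)
        qed (use co continuous_on_strip_Re[OF U(2)] s in \<open>auto simp: vper_Re strip_def\<close>)
        ultimately show ?thesis by (simp add: abs_le_iff)
      qed
      have "(\<lambda>n. (\<Sum>j\<in>{0..<int r}. \<bar>V n j (- R) - W j (- R)\<bar>) + (\<Sum>j\<in>{0..<int r}. \<bar>V n j R - W j R\<bar>)) \<longlonglongrightarrow>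
        (\<Sum>j\<in>{0..<int r}. \<bar>W j (- R) - W j (- R)\<bar>) + (\<Sum>j\<in>{0..<int r}. \<bar>W j R - W j R\<bar>)"
        by (intro tendsto_intros W)
      then have "(\<lambda>n. (\<Sum>j\<in>{0..<int r}. \<bar>V n j (- R) - W j (- R)\<bar>) + (\<Sum>j\<in>{0..<int r}. \<bar>V n j R - W j R\<bar>)) \<longlonglongrightarrow> 0" by simp
      moreover have "\<forall>\<^sub>F n in sequentially. norm (V n i s - U i s) \<le> (\<Sum>j\<in>{0..<int r}. \<bar>V n j (- R) - W j (- R)\<bar>) + (\<Sum>j\<in>{0..<int r}. \<bar>V n j R - W j R\<bar>)"
        using evn[of R] evn[of "- R"] by eventually_elim (use dist in auto)
      ultimately have "(\<lambda>n. V n i s - U i s) \<longlonglongrightarrow> 0" by (rule Lim_null_comparison[rotated])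
      then have "(\<lambda>n. V n i s) \<longlonglongrightarrow> U i s" by (simp add: LIM_zero_iff)
      then show ?thesis using W LIMSEQ_unique by blast
    qed
    show ?thesis
      by (rule toda_on_cong[OF U(1)])
        (auto simp: UW Wper intro!: open_Collect_conj open_Collect_less continuous_intros)
  qed
  have "toda_on k r UNIV (\<lambda>i z. W i (Re z))"
    unfolding toda_on_def
  proof (intro conjI allI ballI)
    show "continuous_on UNIV (\<lambda>z. W i (Re z))" for i
    proof (rule continuous_at_imp_continuous_on, rule ballI)
      fix z :: complex
      have o: "open {y. - (\<bar>Re z\<bar> + 1) < Re y \<and> Re y < \<bar>Re z\<bar> + 1}"
        by (intro open_Collect_conj open_Collect_less continuous_intros)
      show "isCont (\<lambda>z. W i (Re z)) z"
        using toda_onD(3)[OF WR[of "\<bar>Re z\<bar> + 1"], of i] unfolding continuous_on_eq_continuous_at[OF o] by force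
    qed
    show "has_lap (\<lambda>z. W i (Re z)) z (k * exp (2 * Re z) * toda_term (\<lambda>x. exp (2 * x)) (\<lambda>j. W j (Re z)) i)" for z i
      by (rule toda_onD(4)[OF WR[of "\<bar>Re z\<bar> + 1"]]) auto
  qed (use Wper Wsum in auto)
  moreover have "((\<lambda>s. W i s / s) \<longlongrightarrow> - \<nu> i) at_bot" for i
  proof -
    have Wb: "\<bar>W i s + \<nu> i * s\<bar> \<le> 2 * r * ln (- s) + C" if "s \<le> - B" for s
    proof -
      have "(\<lambda>n. \<bar>V n i s + \<nu> i * s\<bar>) \<longlonglongrightarrow> \<bar>W i s + \<nu> i * s\<bar>" by (intro tendsto_intros W)
      moreover have "\<forall>\<^sub>F n in sequentially. \<bar>V n i s + \<nu> i * s\<bar> \<le> 2 * r * ln (- s) + C"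
        using evn[of s] by eventually_elim (use bnd that in auto)
      ultimately show ?thesis by (rule tendsto_upperbound) simp
    qed
    have "((\<lambda>s. (2 * r * ln (- s) + C) / (- s)) \<longlongrightarrow> 0) at_bot" by real_asymp
    moreover have "\<forall>\<^sub>F s in at_bot. norm (W i s / s + \<nu> i) \<le> (2 * r * ln (- s) + C) / (- s)"
      using eventually_le_at_bot[of "- B"]
    proof eventually_elim
      case (elim s)
      then have "s < 0" using B by simp
      then have "W i s / s + \<nu> i = (W i s + \<nu> i * s) / s" by (simp add: add_divide_distrib)
      then have "norm (W i s / s + \<nu> i) = \<bar>W i s + \<nu> i * s\<bar> / (- s)" using \<open>s < 0\<close> by (simp add: abs_divide)
      also have "\<dots> \<le> (2 * r * ln (- s) + C) / (- s)"
        using Wb[OF elim] \<open>s < 0\<close> by (intro divide_right_mono) auto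
      finally show ?case .
    qed
    ultimately have "((\<lambda>s. W i s / s + \<nu> i) \<longlongrightarrow> 0) at_bot" by (rule Lim_null_comparison[rotated])
    then show ?thesis using LIM_zero_iff[of "\<lambda>s. W i s / s" "- \<nu> i" at_bot] by simp
  qed
  ultimately show ?thesis by blast
qed

section \<open>Transfer to the punctured plane\<close>

text \<open>Equal slopes make the difference o(Re z) on the real axis. Finiteness of the index set
  modulo r makes this uniform in i, and radial symmetry carries it to all z, as
  \<open>comparison_entire\<close> requires.\<close>

lemma toda_unique:
  assumes "r \<ge> 1" "k > 0" "toda_on k r UNIV v" "\<And>i. vper (v i)" "toda_on k r UNIV w" "\<And>i. vper (w i)"
    and v: "\<And>i. ((\<lambda>s. v i (of_real s) / s) \<longlongrightarrow> - \<nu> i) at_bot"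
    and w: "\<And>i. ((\<lambda>s. w i (of_real s) / s) \<longlongrightarrow> - \<nu> i) at_bot"
  shows "v i z = w i z"
proof -
  have left: "\<exists>s. \<forall>z i. Re z \<le> s \<longrightarrow> \<bar>v i z - w i z\<bar> \<le> \<epsilon> * \<bar>Re z\<bar>" if "\<epsilon> > 0" for \<epsilon>
  proof -
    have "\<forall>\<^sub>F s in at_bot. \<bar>v i (of_real s) - w i (of_real s)\<bar> \<le> \<epsilon> * \<bar>s\<bar>" for i
    proof -
      have "((\<lambda>s. v i (of_real s) / s - w i (of_real s) / s) \<longlongrightarrow> - \<nu> i - - \<nu> i) at_bot"
        by (intro tendsto_diff v w)
      then have "\<forall>\<^sub>F s in at_bot. dist (v i (of_real s) / s - w i (of_real s) / s) 0 < \<epsilon>"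
        using that by (intro tendstoD) simp_all
      with eventually_gt_at_bot[of "0::real"] show ?thesis
      proof eventually_elim
        case (elim s)
        then have "\<bar>v i (of_real s) - w i (of_real s)\<bar> / \<bar>s\<bar> < \<epsilon>"
          by (simp only: diff_divide_distrib[symmetric] abs_divide dist_real_def diff_0_right)
        then have "\<bar>v i (of_real s) - w i (of_real s)\<bar> / \<bar>s\<bar> * \<bar>s\<bar> \<le> \<epsilon> * \<bar>s\<bar>"
          by (intro mult_right_mono) auto
        then show ?case using elim by simp
      qed
    qed
    then have "\<forall>\<^sub>F s in at_bot. \<forall>i\<in>{0..<int r}. \<bar>v i (of_real s) - w i (of_real s)\<bar> \<le> \<epsilon> * \<bar>s\<bar>"
      by (intro eventually_ball_finite) auto
    then obtain S where S: "\<And>s i. s \<le> S \<Longrightarrow> i \<in> {0..<int r} \<Longrightarrow> \<bar>v i (of_real s) - w i (of_real s)\<bar> \<le> \<epsilon> * \<bar>s\<bar>"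
      unfolding eventually_at_bot_linorder by blast
    have "\<bar>v i z - w i z\<bar> \<le> \<epsilon> * \<bar>Re z\<bar>" if "Re z \<le> S" for z i
    proof -
      have "iper r (\<lambda>i. v i z - w i z)"
        using toda_onD(1)[OF assms(3), of z] toda_onD(1)[OF assms(5), of z] by (simp add: iper_def)
      from iper_range[OF this assms(1), of i] obtain j where j: "j \<in> {0..<int r}" "v j z - w j z = v i z - w i z" by auto
      have "v j z = v j (of_real (Re z))" "w j z = w j (of_real (Re z))"
        by (rule toda_radial[OF assms(1,2,3,4)], simp) (rule toda_radial[OF assms(1,2,5,6)], simp)
      then show ?thesis using S[OF that j(1)] j(2) by simp
    qed
    then show ?thesis by blast
  qed
  have "v i z \<le> w i z"
    by (rule comparison_entire[OF assms(1,2,3,5,4,6)]) (use left in \<open>meson abs_le_D1\<close>)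
  moreover have "w i z \<le> v i z"
    by (rule comparison_entire[OF assms(1,2,5,3,6,4)]) (use left in \<open>metis abs_le_D1 abs_minus_commute\<close>)
  ultimately show ?thesis by simp
qed

section \<open>The Laplacian under the exponential map and the Wirtinger operators\<close>

lemma curve_derivative:
  assumes "(f has_derivative f') (at (\<gamma> t))" "(\<gamma> has_vector_derivative e) (at t)"
  shows "((\<lambda>t. f (\<gamma> t) :: real) has_real_derivative f' e) (at t)"
proof -
  have "((\<lambda>t. f (\<gamma> t)) has_derivative (\<lambda>h. f' (h *\<^sub>R e))) (at t)"
    using has_derivative_compose[OF assms(2)[unfolded has_vector_derivative_def] assms(1)] .
  moreover have "(\<lambda>h. f' (h *\<^sub>R e)) = (*) (f' e)"
    using linear_scale[OF has_derivative_linear[OF assms(1)]] by (auto simp: mult.commute)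
  ultimately show ?thesis unfolding has_field_derivative_def by simp
qed

lemma linear_complex_expand:
  fixes f :: "complex \<Rightarrow> real"
  assumes "linear f"
  shows "f w = Re w * f 1 + Im w * f \<i>"
proof -
  have "w = Re w *\<^sub>R 1 + Im w *\<^sub>R \<i>" by (simp add: complex_eq_iff)
  then have "f w = f (Re w *\<^sub>R 1 + Im w *\<^sub>R \<i>)" by simp
  also have "\<dots> = Re w * f 1 + Im w * f \<i>" by (simp only: linear_add[OF assms] linear_scale[OF assms] real_scaleR_def)
  finally show ?thesis .
qed

text \<open>Conformal invariance: the Laplacian acquires the factor \<open>|exp z|^2\<close>. The
  first-order terms for the directions 1 and \<open>\<i>\<close> cancel because the squares of these
  directions add up to 0, and each mixed second derivative cancels against itself.\<close>

lemma has_lap_comp_exp: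
  fixes f :: "complex \<Rightarrow> real"
  defines "F \<equiv> \<lambda>v x. frechet_derivative f (at x) v"
  assumes "\<And>x. x \<noteq> 0 \<Longrightarrow> f differentiable (at x)" "\<And>v x. x \<noteq> 0 \<Longrightarrow> F v differentiable (at x)"
  shows "has_lap (\<lambda>z. f (exp z)) z (exp (2 * Re z) *
    (frechet_derivative (F 1) (at (exp z)) 1 + frechet_derivative (F \<i>) (at (exp z)) \<i>))"
proof -
  define D where "D v w = frechet_derivative (F v) (at (exp z)) w" for v w
  have df: "(f has_derivative (\<lambda>v. F v x)) (at x)" if "x \<noteq> 0" for x
    using assms(2)[OF that] unfolding F_def frechet_derivative_works by simp
  have dF: "(F v has_derivative D v) (at (exp z))" for v
    unfolding D_def using assms(3)[of "exp z" v] by (simp add: frechet_derivative_works)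
  have Fl: "F w x = Re w * F 1 x + Im w * F \<i> x" if "x \<noteq> 0" for w x
    using linear_complex_expand[OF has_derivative_linear[OF df[OF that]]] .
  have Dl: "D v w = Re w * D v 1 + Im w * D v \<i>" for v w
    using linear_complex_expand[OF has_derivative_linear[OF dF]] .
  have d2: "has_d2 (\<lambda>t. f (exp (z + c * of_real t))) 0
      (Re (c * (c * exp z)) * F 1 (exp z) + Re (c * exp z) * D 1 (c * exp z) +
       (Im (c * (c * exp z)) * F \<i> (exp z) + Im (c * exp z) * D \<i> (c * exp z)))" for c
  proof -
    define \<gamma> where "\<gamma> t = exp (z + c * of_real t)" for t :: real
    have \<gamma>: "(\<gamma> has_vector_derivative c * \<gamma> t) (at t)" for t
    proof -
      have "((\<lambda>t. z + c * of_real t) has_vector_derivative c) (at t)"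
        by (auto intro!: derivative_eq_intros)
      from field_vector_diff_chain_at[OF this DERIV_exp] show ?thesis by (simp add: \<gamma>_def[abs_def] o_def)
    qed
    have \<gamma>0: "\<gamma> 0 = exp z" by (simp add: \<gamma>_def)
    have c\<gamma>: "((\<lambda>t. Re (c * \<gamma> t)) has_real_derivative Re (c * (c * \<gamma> t))) (at t)"
      "((\<lambda>t. Im (c * \<gamma> t)) has_real_derivative Im (c * (c * \<gamma> t))) (at t)" for t
      by (intro curve_derivative[OF _ \<gamma>] bounded_linear_imp_has_derivative
          bounded_linear_compose[OF bounded_linear_Re] bounded_linear_compose[OF bounded_linear_Im] bounded_linear_mult_right)+
    define g' where "g' t = Re (c * \<gamma> t) * F 1 (\<gamma> t) + Im (c * \<gamma> t) * F \<i> (\<gamma> t)" for t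
    have 1: "((\<lambda>t. f (\<gamma> t)) has_real_derivative g' t) (at t)" for t
      using curve_derivative[OF df \<gamma>, of t] Fl[of "\<gamma> t" "c * \<gamma> t"] by (simp add: \<gamma>_def g'_def)
    have dF\<gamma>: "((\<lambda>t. F v (\<gamma> t)) has_real_derivative D v (c * \<gamma> 0)) (at 0)" for v
      by (rule curve_derivative[OF _ \<gamma>]) (use dF in \<open>simp add: \<gamma>0\<close>)
    have "(g' has_real_derivative
       (Re (c * (c * \<gamma> 0)) * F 1 (\<gamma> 0) + D 1 (c * \<gamma> 0) * Re (c * \<gamma> 0) +
       (Im (c * (c * \<gamma> 0)) * F \<i> (\<gamma> 0) + D \<i> (c * \<gamma> 0) * Im (c * \<gamma> 0)))) (at 0)"
      unfolding g'_def by (intro DERIV_add DERIV_mult c\<gamma> dF\<gamma>)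
    then have "(g' has_real_derivative
       (Re (c * (c * exp z)) * F 1 (exp z) + Re (c * exp z) * D 1 (c * exp z) +
       (Im (c * (c * exp z)) * F \<i> (exp z) + Im (c * exp z) * D \<i> (c * exp z)))) (at 0)"
      unfolding \<gamma>0 by (simp only: mult.commute[of "Re (c * exp z)"] mult.commute[of "Im (c * exp z)"])
    then show ?thesis using 1 unfolding \<gamma>_def by (intro has_d2I[of UNIV]) auto
  qed
  define p q where "p = Re (exp z)" and "q = Im (exp z)"
  have pq: "p\<^sup>2 + q\<^sup>2 = exp (2 * Re z)"
    using cmod_power2[of "exp z"] by (simp add: p_def q_def exp_double)
  define A where "A = p * F 1 (exp z) + p * D 1 (exp z) + (q * F \<i> (exp z) + q * D \<i> (exp z))"
  define B where "B = - p * F 1 (exp z) + - q * D 1 (\<i> * exp z) + (- q * F \<i> (exp z) + p * D \<i> (\<i> * exp z))"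
  have "has_d2 (\<lambda>t. f (exp (z + of_real t))) 0 A" "has_d2 (\<lambda>t. f (exp (z + \<i> * of_real t))) 0 B"
    using d2[of 1] d2[of \<i>] by (simp_all add: A_def B_def p_def q_def)
  then have "has_lap (\<lambda>z. f (exp z)) z (A + B)" unfolding has_lap_def by blast
  moreover have "A + B = (p\<^sup>2 + q\<^sup>2) * (D 1 1 + D \<i> \<i>)"
  proof -
    have e: "D v (exp z) = p * D v 1 + q * D v \<i>" "D v (\<i> * exp z) = - q * D v 1 + p * D v \<i>" for v
      using Dl[of v "exp z"] Dl[of v "\<i> * exp z"] by (simp_all add: p_def q_def)
    show ?thesis unfolding A_def B_def e by (simp add: power2_eq_square algebra_simps)
  qed
  ultimately show ?thesis unfolding pq D_def by simp
qed

lemma frechet_derivative_eqI: "(f has_derivative D) (at x) \<Longrightarrow> frechet_derivative f (at x) = D"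
  using frechet_derivative_at by metis

lemma has_derivative_cong_open:
  assumes "open S" "x \<in> S" "\<And>y. y \<in> S \<Longrightarrow> f y = g y"
  shows "(f has_derivative D) (at x) \<longleftrightarrow> (g has_derivative D) (at x)"
  using has_derivative_transform_within_open[of f D x UNIV S g] has_derivative_transform_within_open[of g D x UNIV S f] assms
  by auto

lemma frechet_derivative_cong_open:
  assumes "open S" "x \<in> S" "\<And>y. y \<in> S \<Longrightarrow> f y = g y"
  shows "frechet_derivative f (at x) = frechet_derivative g (at x)"
  unfolding frechet_derivative_def using has_derivative_cong_open[OF assms] by simp

text \<open>The imaginary part, the antisymmetric part of the second differential, is carried along:
  \<open>toda_on_log_lift\<close> reads only the real part, and \<open>d_qbar_d_q_radial\<close>
  sees it vanish by an explicit formula.\<close>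

lemma d_qbar_d_q_of_real:
  fixes f :: "complex \<Rightarrow> real"
  defines "F \<equiv> \<lambda>v x. frechet_derivative f (at x) v"
  assumes "\<And>x. x \<noteq> 0 \<Longrightarrow> f differentiable (at x)" "\<And>v x. x \<noteq> 0 \<Longrightarrow> F v differentiable (at x)" "q \<noteq> 0"
  shows "d_qbar (d_q (\<lambda>z. complex_of_real (f z))) q =
    Complex ((frechet_derivative (F 1) (at q) 1 + frechet_derivative (F \<i>) (at q) \<i>) / 4)
      ((frechet_derivative (F 1) (at q) \<i> - frechet_derivative (F \<i>) (at q) 1) / 4)"
proof -
  define D where "D v w = frechet_derivative (F v) (at q) w" for v w
  have df: "(f has_derivative (\<lambda>v. F v x)) (at x)" if "x \<noteq> 0" for x
    using assms(2)[OF that] unfolding F_def frechet_derivative_works by simp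
  have dF: "(F v has_derivative D v) (at q)" for v
    unfolding D_def using assms(3)[of q v] assms(4) by (simp add: frechet_derivative_works)
  have "((\<lambda>z. complex_of_real (f z)) has_derivative (\<lambda>v. complex_of_real (F v x))) (at x)" if "x \<noteq> 0" for x
    by (intro derivative_intros df that)
  then have dq: "d_q (\<lambda>z. complex_of_real (f z)) x = (complex_of_real (F 1 x) - \<i> * complex_of_real (F \<i> x)) / 2" if "x \<noteq> 0" for x
    using that unfolding d_q_def by (subst (1 2) frechet_derivative_eqI) auto
  have "((\<lambda>x. (complex_of_real (F 1 x) - \<i> * complex_of_real (F \<i> x)) / 2) has_derivative
    (\<lambda>w. (complex_of_real (D 1 w) - \<i> * complex_of_real (D \<i> w)) / 2)) (at q)"
    unfolding divide_inverse by (intro has_derivative_mult_left has_derivative_mult_right derivative_intros dF)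
  then have "(d_q (\<lambda>z. complex_of_real (f z)) has_derivative
    (\<lambda>w. (complex_of_real (D 1 w) - \<i> * complex_of_real (D \<i> w)) / 2)) (at q)"
    by (subst has_derivative_cong_open[of "- {0}"]) (use dq assms(4) in auto)
  then have "d_qbar (d_q (\<lambda>z. complex_of_real (f z))) q =
    ((complex_of_real (D 1 1) - \<i> * complex_of_real (D \<i> 1)) / 2 +
      \<i> * ((complex_of_real (D 1 \<i>) - \<i> * complex_of_real (D \<i> \<i>)) / 2)) / 2"
    unfolding d_qbar_def by (subst (1 2) frechet_derivative_eqI) auto
  then show ?thesis by (simp add: complex_eq_iff D_def)
qed

section \<open>Smoothness and derivatives of radial functions\<close>

lemma Ck_on_cong:
  assumes "open S" "\<And>x. x \<in> S \<Longrightarrow> f x = g x"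
  shows "Ck_on k S f \<longleftrightarrow> Ck_on k S g"
  using assms(2)
proof (induction k arbitrary: f g)
  case 0
  then show ?case by (auto intro: continuous_on_cong[THEN iffD1])
next
  case (Suc k)
  have "f differentiable (at x) \<longleftrightarrow> g differentiable (at x)" if "x \<in> S" for x
    using has_derivative_cong_open[OF assms(1) that Suc.prems] unfolding differentiable_def by simp
  moreover have "Ck_on k S (\<lambda>x. frechet_derivative f (at x) v) \<longleftrightarrow> Ck_on k S (\<lambda>x. frechet_derivative g (at x) v)" for v
    using frechet_derivative_cong_open[OF assms(1) _ Suc.prems] by (intro Suc.IH) simp
  ultimately show ?case by simp
qed

text \<open>A class closed under directional derivatives consists of smooth functions; no iterated
  derivative has to be computed.\<close>

lemma Ck_on_of_derivative_closed:
  assumes "open S" "f \<in> \<A>"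
    and cl: "\<And>f. f \<in> \<A> \<Longrightarrow> \<exists>G. (\<forall>v. G v \<in> \<A>) \<and> (\<forall>x\<in>S. (f has_derivative (\<lambda>v. G v x)) (at x))"
  shows "Ck_on k S f"
  using assms(2)
proof (induction k arbitrary: f)
  case 0
  then obtain G where "\<forall>x\<in>S. (f has_derivative (\<lambda>v. G v x)) (at x)" using cl by blast
  then show ?case by (auto intro!: continuous_at_imp_continuous_on has_derivative_continuous)
next
  case (Suc k)
  then obtain G where G: "\<And>v. G v \<in> \<A>" "\<And>x. x \<in> S \<Longrightarrow> (f has_derivative (\<lambda>v. G v x)) (at x)" using cl by blast
  have "Ck_on k S (\<lambda>x. frechet_derivative f (at x) v)" for v
    by (subst Ck_on_cong[OF assms(1), of _ "G v"]) (simp_all add: G(1) Suc.IH frechet_derivative_eqI[OF G(2)])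
  then show ?case using G(2) by (auto simp: differentiable_def)
qed

text \<open>Written as half the logarithm of \<open>q \<bullet> q\<close>, so that only the inner
  product is differentiated.\<close>

lemma has_derivative_ln_cmod:
  assumes "q \<noteq> 0"
  shows "((\<lambda>q. ln (cmod q)) has_derivative (\<lambda>v. (v \<bullet> q) * inverse (q \<bullet> q))) (at q)"
proof -
  have "q \<bullet> q > 0" using assms by simp
  then have "((\<lambda>q. ln (q \<bullet> q) * (1 / 2)) has_derivative (\<lambda>v. (inverse (q \<bullet> q) * (q \<bullet> v + v \<bullet> q)) * (1 / 2))) (at q)"
    by (intro has_derivative_mult_left)
      (auto intro!: derivative_eq_intros simp: divide_inverse mult_ac)
  moreover have "(\<lambda>v. (inverse (q \<bullet> q) * (q \<bullet> v + v \<bullet> q)) * (1 / 2)) = (\<lambda>v. (v \<bullet> q) * inverse (q \<bullet> q))"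
    by (auto simp: inner_commute)
  moreover have "(\<lambda>q. ln (q \<bullet> q) * (1 / 2)) = (\<lambda>q. ln (cmod q))"
  proof
    fix q :: complex
    show "ln (q \<bullet> q) * (1 / 2) = ln (cmod q)"
      by (cases "q = 0") (auto simp: dot_square_norm ln_realpow)
  qed
  ultimately show ?thesis by simp
qed

lemma has_derivative_inverse_inner:
  fixes q :: complex
  assumes "q \<noteq> 0"
  shows "((\<lambda>q. inverse (q \<bullet> q)) has_derivative (\<lambda>v. - 2 * ((v \<bullet> q) * (inverse (q \<bullet> q) * inverse (q \<bullet> q))))) (at q)"
proof -
  have "((\<lambda>q. inverse (q \<bullet> q)) has_derivative (\<lambda>v. - (inverse (q \<bullet> q) * (q \<bullet> v + v \<bullet> q) * inverse (q \<bullet> q)))) (at q)"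
    using assms by (intro Deriv.has_derivative_inverse has_derivative_inner has_derivative_ident) simp
  moreover have "(\<lambda>v. - (inverse (q \<bullet> q) * (q \<bullet> v + v \<bullet> q) * inverse (q \<bullet> q))) =
    (\<lambda>v. - 2 * ((v \<bullet> q) * (inverse (q \<bullet> q) * inverse (q \<bullet> q))))"
    by (auto simp: inner_commute)
  ultimately show ?thesis by simp
qed

lemma has_derivative_radial:
  assumes "q \<noteq> 0" "(h has_real_derivative h') (at (ln (cmod q)))"
  shows "((\<lambda>q. h (ln (cmod q))) has_derivative (\<lambda>v. h' * ((v \<bullet> q) * inverse (q \<bullet> q)))) (at q)"
  using has_derivative_compose[OF has_derivative_ln_cmod[OF assms(1)] assms(2)[unfolded has_field_derivative_def]] .

text \<open>The second differential of a radial function is visibly symmetric in \<open>u\<close> and \<open>v\<close>, so that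
  \<open>d_qbar (d_q w)\<close> is real.\<close>

lemma has_derivative_radial_2:
  assumes "q \<noteq> 0" "(h' has_real_derivative h'') (at (ln (cmod q)))"
  shows "((\<lambda>q. h' (ln (cmod q)) * ((u \<bullet> q) * inverse (q \<bullet> q))) has_derivative
    (\<lambda>v. h' (ln (cmod q)) * ((u \<bullet> v) * inverse (q \<bullet> q) - 2 * ((u \<bullet> q) * (v \<bullet> q)) * (inverse (q \<bullet> q) * inverse (q \<bullet> q))) +
      h'' * ((u \<bullet> q) * (v \<bullet> q)) * (inverse (q \<bullet> q) * inverse (q \<bullet> q)))) (at q)"
proof -
  have "((\<lambda>q. h' (ln (cmod q)) * ((u \<bullet> q) * inverse (q \<bullet> q))) has_derivative
    (\<lambda>v. h' (ln (cmod q)) * ((u \<bullet> q) * (- 2 * ((v \<bullet> q) * (inverse (q \<bullet> q) * inverse (q \<bullet> q)))) + (u \<bullet> v) * inverse (q \<bullet> q)) +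
      h'' * ((v \<bullet> q) * inverse (q \<bullet> q)) * ((u \<bullet> q) * inverse (q \<bullet> q)))) (at q)"
    by (intro has_derivative_mult has_derivative_radial has_derivative_inverse_inner assms derivative_intros)
  then show ?thesis by (rule has_derivative_eq_rhs) (simp add: algebra_simps)
qed

context
  fixes r :: nat and k :: real and V V' :: "int \<Rightarrow> real \<Rightarrow> real"
  assumes dV: "\<And>i s. (V i has_real_derivative V' i s) (at s)"
    and dV': "\<And>i s. (V' i has_real_derivative k * exp (2 * s) * (exp (2 * (V i s - V (i - 1) s)) - exp (2 * (V (i + 1) s - V i s)))) (at s)"
begin

text \<open>Bootstrapping through the differential equation in one step: the generators are chosen
  so that the derivative of each is again a polynomial in the generators.\<close>

inductive_set radial_algebra :: "(complex \<Rightarrow> real) set" where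
  const: "(\<lambda>q. c) \<in> radial_algebra"
| inner: "(\<lambda>q. u \<bullet> q) \<in> radial_algebra"
| inv: "(\<lambda>q. inverse (q \<bullet> q)) \<in> radial_algebra"
| ln: "(\<lambda>q. ln (cmod q)) \<in> radial_algebra"
| V: "(\<lambda>q. V i (ln (cmod q))) \<in> radial_algebra"
| V': "(\<lambda>q. V' i (ln (cmod q))) \<in> radial_algebra"
| exp: "(\<lambda>q. exp (2 * (V i (ln (cmod q)) - V (i - 1) (ln (cmod q))))) \<in> radial_algebra"
| add: "f \<in> radial_algebra \<Longrightarrow> g \<in> radial_algebra \<Longrightarrow> (\<lambda>q. f q + g q) \<in> radial_algebra"
| mult: "f \<in> radial_algebra \<Longrightarrow> g \<in> radial_algebra \<Longrightarrow> (\<lambda>q. f q * g q) \<in> radial_algebra"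

lemma radial_algebra_uminus:
  assumes "f \<in> radial_algebra"
  shows "(\<lambda>q. - f q) \<in> radial_algebra"
  using mult[OF const[of "- 1"] assms] by simp

lemma radial_algebra_diff:
  assumes "f \<in> radial_algebra" "g \<in> radial_algebra"
  shows "(\<lambda>q. f q - g q) \<in> radial_algebra"
  using add[OF assms(1) radial_algebra_uminus[OF assms(2)]] by simp

lemma radial_algebra_derivative:
  assumes "f \<in> radial_algebra"
  shows "\<exists>G. (\<forall>v. G v \<in> radial_algebra) \<and> (\<forall>x\<in>Cstar. (f has_derivative (\<lambda>v. G v x)) (at x))"
  using assms
proof induction
  case (const c)
  show ?case by (rule exI[of _ "\<lambda>v q. 0"]) (auto intro: radial_algebra.const)
next
  case (inner u)
  show ?case
    by (rule exI[of _ "\<lambda>v q. u \<bullet> v"]) (auto intro!: radial_algebra.const derivative_eq_intros)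
next
  case inv
  show ?case
    by (rule exI[of _ "\<lambda>v q. - 2 * ((v \<bullet> q) * (inverse (q \<bullet> q) * inverse (q \<bullet> q)))"], intro conjI allI ballI)
      (intro radial_algebra.intros, intro has_derivative_inverse_inner, simp)
next
  case ln
  show ?case
    by (rule exI[of _ "\<lambda>v q. (v \<bullet> q) * inverse (q \<bullet> q)"], intro conjI allI ballI)
      (intro radial_algebra.intros, intro has_derivative_ln_cmod, simp)
next
  case (V i)
  show ?case
    by (rule exI[of _ "\<lambda>v q. V' i (ln (cmod q)) * ((v \<bullet> q) * inverse (q \<bullet> q))"], intro conjI allI ballI)
      (intro radial_algebra.intros, intro has_derivative_radial dV, simp)
next
  case (V' i)
  \<comment> \<open>The second derivative of \<open>V i\<close> in algebra form:
    \<open>exp (2 * s)\<close> becomes \<open>q \<bullet> q\<close>, and \<open>i + 1 - 1\<close>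
    keeps the second exponential in the shape of the generator \<open>exp\<close>.\<close>
  define g where "g = (\<lambda>q. k * (q \<bullet> q) * (exp (2 * (V i (ln (cmod q)) - V (i - 1) (ln (cmod q)))) -
    exp (2 * (V (i + 1) (ln (cmod q)) - V (i + 1 - 1) (ln (cmod q))))))"
  have qq: "q \<bullet> q = (1 \<bullet> q) * (1 \<bullet> q) + (\<i> \<bullet> q) * (\<i> \<bullet> q)" for q :: complex
    by (simp add: inner_complex_def)
  have "g \<in> radial_algebra"
    unfolding g_def by (subst qq) (intro radial_algebra_diff radial_algebra.intros)
  moreover have "((\<lambda>q. V' i (ln (cmod q))) has_derivative (\<lambda>v. g q * ((v \<bullet> q) * inverse (q \<bullet> q)))) (at q)" if "q \<noteq> 0" for q
  proof -
    have "exp (2 * ln (cmod q)) = q \<bullet> q"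
      using that by (simp add: exp_double dot_square_norm)
    then show ?thesis using has_derivative_radial[OF that dV'] by (simp add: g_def)
  qed
  ultimately show ?case
    by (intro exI[of _ "\<lambda>v q. g q * ((v \<bullet> q) * inverse (q \<bullet> q))"] conjI allI ballI radial_algebra.mult radial_algebra.inner radial_algebra.inv) auto
next
  case (exp i)
  have "((\<lambda>s. exp (2 * (V i s - V (i - 1) s))) has_real_derivative
    exp (2 * (V i s - V (i - 1) s)) * (2 * (V' i s - V' (i - 1) s))) (at s)" for s
    by (auto intro!: derivative_eq_intros dV)
  note d = has_derivative_radial[OF _ this]
  show ?case
    by (rule exI[of _ "\<lambda>v q. exp (2 * (V i (ln (cmod q)) - V (i - 1) (ln (cmod q)))) *
        (2 * (V' i (ln (cmod q)) - V' (i - 1) (ln (cmod q)))) * ((v \<bullet> q) * inverse (q \<bullet> q))"], intro conjI allI ballI)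
      (intro radial_algebra_diff radial_algebra.intros, rule d, simp)
next
  case (add f g)
  then obtain F G where
    F: "\<And>v. F v \<in> radial_algebra" "\<And>x. x \<in> Cstar \<Longrightarrow> (f has_derivative (\<lambda>v. F v x)) (at x)" and
    G: "\<And>v. G v \<in> radial_algebra" "\<And>x. x \<in> Cstar \<Longrightarrow> (g has_derivative (\<lambda>v. G v x)) (at x)" by blast
  show ?case
    by (rule exI[of _ "\<lambda>v q. F v q + G v q"], intro conjI allI ballI)
      (intro radial_algebra.add F G, intro has_derivative_add F G)
next
  case (mult f g)
  then obtain F G where
    F: "\<And>v. F v \<in> radial_algebra" "\<And>x. x \<in> Cstar \<Longrightarrow> (f has_derivative (\<lambda>v. F v x)) (at x)" and
    G: "\<And>v. G v \<in> radial_algebra" "\<And>x. x \<in> Cstar \<Longrightarrow> (g has_derivative (\<lambda>v. G v x)) (at x)" by blast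
  show ?case
    by (rule exI[of _ "\<lambda>v q. f q * G v q + F v q * g q"], intro conjI allI ballI)
      (intro radial_algebra.add radial_algebra.mult F G mult.hyps, intro has_derivative_mult F G)
qed

lemma radial_smooth: "Cinf_on Cstar (\<lambda>q. V i (ln (cmod q)) + \<mu> * ln (cmod q))"
  unfolding Cinf_on_def
proof
  fix n
  have "open Cstar" by auto
  moreover have "(\<lambda>q. V i (ln (cmod q)) + \<mu> * ln (cmod q)) \<in> radial_algebra" by (intro radial_algebra.intros)
  ultimately show "Ck_on n Cstar (\<lambda>q. V i (ln (cmod q)) + \<mu> * ln (cmod q))"
    by (rule Ck_on_of_derivative_closed) (rule radial_algebra_derivative)
qed

end

text \<open>4 d_qbar d_q is the Laplacian. The first-derivative terms cancel because log |q| is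
  harmonic, and its gradient has squared length \<open>1 / |q|^2\<close>.\<close>

lemma d_qbar_d_q_radial:
  fixes h h' :: "real \<Rightarrow> real"
  assumes "\<And>s. (h has_real_derivative h' s) (at s)" "\<And>s. (h' has_real_derivative h'' s) (at s)" "q \<noteq> 0"
    and f: "\<And>x. x \<noteq> 0 \<Longrightarrow> f x = h (ln (cmod x))"
  shows "d_qbar (d_q (\<lambda>z. complex_of_real (f z))) q = complex_of_real (h'' (ln (cmod q)) / (4 * (cmod q)\<^sup>2))"
proof -
  define F where "F v x = frechet_derivative f (at x) v" for v x
  define D where "D u v = h' (ln (cmod q)) * ((u \<bullet> v) * inverse (q \<bullet> q) - 2 * ((u \<bullet> q) * (v \<bullet> q)) * (inverse (q \<bullet> q) * inverse (q \<bullet> q))) +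
      h'' (ln (cmod q)) * ((u \<bullet> q) * (v \<bullet> q)) * (inverse (q \<bullet> q) * inverse (q \<bullet> q))" for u v
  have df: "(f has_derivative (\<lambda>v. h' (ln (cmod x)) * ((v \<bullet> x) * inverse (x \<bullet> x)))) (at x)" if "x \<noteq> 0" for x
    using has_derivative_radial[OF that assms(1)] that f
    by (subst has_derivative_cong_open[of "- {0}"]) auto
  have F: "F u x = h' (ln (cmod x)) * ((u \<bullet> x) * inverse (x \<bullet> x))" if "x \<noteq> 0" for u x
    unfolding F_def frechet_derivative_eqI[OF df[OF that]] by simp
  have dF: "(F u has_derivative (\<lambda>v. h' (ln (cmod x)) * ((u \<bullet> v) * inverse (x \<bullet> x) - 2 * ((u \<bullet> x) * (v \<bullet> x)) * (inverse (x \<bullet> x) * inverse (x \<bullet> x))) +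
      h'' (ln (cmod x)) * ((u \<bullet> x) * (v \<bullet> x)) * (inverse (x \<bullet> x) * inverse (x \<bullet> x)))) (at x)" if "x \<noteq> 0" for u x
    using has_derivative_radial_2[OF that assms(2)] that F
    by (subst has_derivative_cong_open[of "- {0}"]) auto
  have DD: "frechet_derivative (F u) (at q) v = D u v" for u v
    unfolding frechet_derivative_eqI[OF dF[OF assms(3)]] D_def by simp
  have "d_qbar (d_q (\<lambda>z. complex_of_real (f z))) q = Complex ((D 1 1 + D \<i> \<i>) / 4) ((D 1 \<i> - D \<i> 1) / 4)"
    using df dF assms(3) d_qbar_d_q_of_real[of f q] unfolding F_def[symmetric, abs_def] DD
    by (auto simp: differentiable_def)
  moreover have "D 1 \<i> = D \<i> 1" by (simp add: D_def inner_complex_def)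
  moreover have "D 1 1 + D \<i> \<i> = h'' (ln (cmod q)) / (cmod q)\<^sup>2"
  proof -
    have qq: "q \<bullet> q = (1 \<bullet> q) * (1 \<bullet> q) + (\<i> \<bullet> q) * (\<i> \<bullet> q)"
      by (simp add: inner_complex_def)
    have q0: "q \<bullet> q \<noteq> 0" using assms(3) by simp
    have "D 1 1 + D \<i> \<i> = h' (ln (cmod q)) * (2 * inverse (q \<bullet> q) - 2 * (q \<bullet> q) * (inverse (q \<bullet> q) * inverse (q \<bullet> q))) +
      h'' (ln (cmod q)) * (q \<bullet> q) * (inverse (q \<bullet> q) * inverse (q \<bullet> q))"
      unfolding D_def by (subst (13 17) qq) (simp add: algebra_simps inner_complex_def)
    also have "\<dots> = h'' (ln (cmod q)) / (q \<bullet> q)"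
    proof -
      have "(q \<bullet> q) * (inverse (q \<bullet> q) * inverse (q \<bullet> q)) = inverse (q \<bullet> q)"
        unfolding mult.assoc[symmetric] right_inverse[OF q0] by simp
      then show ?thesis by (simp only: mult.assoc divide_inverse) simp
    qed
    finally show ?thesis by (simp add: dot_square_norm)
  qed
  ultimately show ?thesis by (simp add: complex_eq_iff)
qed

text \<open>The half-line is closed because every positive \<epsilon> is granted, so \<beta> itself
  is attained. For the converse it is enough to test the O-condition along the positive reals, where
  its constant C contributes only \<open>ln C / s\<close>, which tends to 0.\<close>

lemma growth_exponents_eq:
  assumes \<phi>: "((\<lambda>s. \<phi> s / s) \<longlongrightarrow> - \<beta>) at_bot"
    and w: "\<And>q. q \<noteq> 0 \<Longrightarrow> cmod q ^ (i - 1) * exp (w i q) = exp (\<phi> (ln (cmod q)))"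
  shows "growth_exponents w i = {\<beta>..}"
proof (intro equalityI subsetI)
  fix c assume "c \<in> {\<beta>..}"
  then have c: "\<beta> \<le> c" by simp
  show "c \<in> growth_exponents w i"
    unfolding growth_exponents_def
  proof (intro CollectI allI impI)
    fix \<epsilon> :: real assume \<epsilon>: "\<epsilon> > 0"
    have "\<forall>\<^sub>F s in at_bot. - \<beta> - \<epsilon> < \<phi> s / s" using order_tendstoD(1)[OF \<phi>] \<epsilon> by simp
    with eventually_gt_at_bot[of "0::real"] have ev: "\<forall>\<^sub>F s in at_bot. \<phi> s \<le> (- c - \<epsilon>) * s"
    proof eventually_elim
      case (elim s)
      then have "\<phi> s < (- \<beta> - \<epsilon>) * s" by (simp add: neg_less_divide_eq)
      also have "\<dots> \<le> (- c - \<epsilon>) * s" using c elim by (intro mult_right_mono_neg) auto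
      finally show ?case by simp
    qed
    have "filterlim (\<lambda>q. ln (cmod q)) at_bot (at 0)"
    proof (rule filterlim_compose[OF ln_at_0])
      show "filterlim cmod (at_right 0) (at 0)"
        by (intro filterlim_at_withinI tendsto_norm_zero tendsto_ident_at) (auto simp: eventually_at_filter)
    qed
    from eventually_compose_filterlim[OF ev this]
    have "\<forall>\<^sub>F q in at 0. \<phi> (ln (cmod q)) \<le> (- c - \<epsilon>) * ln (cmod q)" .
    moreover have "\<forall>\<^sub>F q in at 0. q \<noteq> (0 :: complex)" by (simp add: eventually_at_filter)
    ultimately have "\<forall>\<^sub>F q in at 0. norm (cmod q ^ (i - 1) * exp (w i q)) \<le> 1 * norm (cmod q powr (- c - \<epsilon>))"
    proof eventually_elim
      case (elim q)
      then show ?case unfolding w[OF elim(2)] by (simp add: powr_def)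
    qed
    then show "(\<lambda>q. cmod q ^ (i - 1) * exp (w i q)) \<in> O[at 0](\<lambda>q. cmod q powr (- c - \<epsilon>))"
      by (rule bigoI)
  qed
next
  fix c assume c: "c \<in> growth_exponents w i"
  have "\<beta> \<le> c + \<epsilon>" if "\<epsilon> > 0" for \<epsilon>
  proof -
    have "(\<lambda>q. cmod q ^ (i - 1) * exp (w i q)) \<in> O[at 0](\<lambda>q. cmod q powr (- c - \<epsilon>))"
      using c that by (simp add: growth_exponents_def)
    then obtain C where C: "C > 0" "\<forall>\<^sub>F q in at 0. norm (cmod q ^ (i - 1) * exp (w i q)) \<le> C * norm (cmod q powr (- c - \<epsilon>))"
      by (rule landau_o.bigE)
    have "filterlim (\<lambda>s. complex_of_real (exp s)) (at 0) at_bot"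
      using tendsto_of_real[OF exp_at_bot, where 'a = complex] by (intro filterlim_atI) simp_all
    then have "\<forall>\<^sub>F s in at_bot. norm (cmod (of_real (exp s)) ^ (i - 1) * exp (w i (of_real (exp s)))) \<le> C * norm (cmod (of_real (exp s)) powr (- c - \<epsilon>))"
      using C(2) unfolding filterlim_iff by blast
    with eventually_gt_at_bot[of "0::real"] have "\<forall>\<^sub>F s in at_bot. ln C / s + (- c - \<epsilon>) \<le> \<phi> s / s"
    proof eventually_elim
      case (elim s)
      have "exp (\<phi> s) \<le> C * exp ((- c - \<epsilon>) * s)"
        using elim(2) w[of "of_real (exp s)"] by (simp add: powr_def)
      then have "ln (exp (\<phi> s)) \<le> ln (C * exp ((- c - \<epsilon>) * s))" using C(1) by (intro ln_mono) auto
      then have "\<phi> s \<le> ln C + (- c - \<epsilon>) * s" using C(1) by (simp add: ln_mult)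
      then have "(ln C + (- c - \<epsilon>) * s) / s \<le> \<phi> s / s" using elim(1) by (intro divide_right_mono_neg) auto
      then show ?case using elim(1) by (simp add: add_divide_distrib)
    qed
    moreover have "((\<lambda>s. ln C / s + (- c - \<epsilon>)) \<longlongrightarrow> 0 + (- c - \<epsilon>)) at_bot"
      by (intro tendsto_add tendsto_const tendsto_divide_0[OF tendsto_const] filterlim_at_bot_imp_at_infinity filterlim_ident)
    ultimately have "0 + (- c - \<epsilon>) \<le> - \<beta>" using tendsto_le[OF _ \<phi>] by auto
    then show ?thesis by simp
  qed
  then show "c \<in> {\<beta>..}" using field_le_epsilon by auto
qed

section \<open>Cyclic tuples as periodic families\<close>

lemma cyc_of_int_nat: "1 \<le> i \<Longrightarrow> i \<le> r \<Longrightarrow> cyc r w (int i) = w i"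
  by (simp add: cyc_def nat_diff_distrib mod_pos_pos_trivial)

lemma iper_cyc: "iper r (cyc r w)"
  by (simp add: iper_def cyc_def diff_add_eq[symmetric])

lemma cyc_of_iper:
  assumes "iper r x" "r \<ge> 1"
  shows "cyc r (\<lambda>i. x (int i)) k = x k"
proof -
  have "x ((k - 1) mod int r + 1) = x k"
    using iper_mod[OF iper_shift[OF assms(1), of 1], of "k - 1"] by simp
  then show ?thesis using assms(2) by (simp add: cyc_def add.commute)
qed

lemma cyc_cong: "r \<ge> 1 \<Longrightarrow> (\<And>i. i \<in> {1..r} \<Longrightarrow> w i = w' i) \<Longrightarrow> cyc r w k = cyc r w' k"
  by (simp add: cyc_def nat_less_iff Suc_le_eq)

lemma iper_sum_nat:
  fixes x :: "int \<Rightarrow> real"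
  assumes "iper r x" "r \<ge> 1"
  shows "(\<Sum>i=1..r. x (int i)) = (\<Sum>i\<in>{0..<int r}. x i)"
proof -
  have "(\<Sum>i=1..r. x (int i)) = (\<Sum>i\<in>{1..<1 + int r}. x i)"
    by (rule sum.reindex_bij_witness[of _ nat int]) auto
  then show ?thesis using iper_sum_window[OF assms] by simp
qed

lemma sum_reals_1: "(\<Sum>i=1..r. real i - 1) = real r * (real r - 1) / 2"
  by (induction r) (auto simp: field_simps)

text \<open>One r-th of the coefficient of \<open>ln (cmod q)\<close> in the trace condition;
  subtracting this harmonic term from each component makes the sum zero.\<close>

definition lift_slope :: "nat \<Rightarrow> real \<Rightarrow> real" where
  "lift_slope r a = - (real r - 1) / 2 - a / real r"

definition log_lift :: "nat \<Rightarrow> real \<Rightarrow> (nat \<Rightarrow> complex \<Rightarrow> real) \<Rightarrow> int \<Rightarrow> complex \<Rightarrow> real" where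
  "log_lift r a w i z = cyc r w i (exp z) - lift_slope r a * Re z"

lemma lift_slope_mult: "r \<ge> 1 \<Longrightarrow> real r * lift_slope r a = - (real r * (real r - 1) / 2) - a"
  by (simp add: lift_slope_def field_simps)

lemma vper_log_lift: "vper (log_lift r a w i)"
proof -
  have "exp (z + of_real (2 * pi) * \<i>) = exp z" for z
    using exp_two_pi_i by (simp add: exp_add mult_ac)
  then show ?thesis by (simp add: vper_def log_lift_def)
qed

text \<open>The Laplacian in z is \<open>exp (2 * Re z)\<close> times 4 d_qbar d_q, and the equation
  makes 2 d_qbar d_q equal to r^2 times the Toda term; together this is the constant 2 r^2.\<close>

lemma toda_on_log_lift:
  assumes "r \<ge> 1" "w \<in> toda_solutions r a"
  shows "toda_on (2 * (real r)\<^sup>2) r UNIV (log_lift r a w)"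
  unfolding toda_on_def
proof (intro conjI allI ballI)
  have w: "\<And>i. i \<in> {1..r} \<Longrightarrow> Cinf_on Cstar (w i)"
    "\<And>i q. i \<in> {1..r} \<Longrightarrow> q \<noteq> 0 \<Longrightarrow> 2 * d_qbar (d_q (\<lambda>z. complex_of_real (w i z))) q
           - complex_of_real (real r ^ 2 * exp (2 * (cyc r w (int i) q - cyc r w (int i - 1) q)))
           + complex_of_real (real r ^ 2 * exp (2 * (cyc r w (int i + 1) q - cyc r w (int i) q))) = 0"
    "\<And>q. q \<noteq> 0 \<Longrightarrow> (\<Sum>i=1..r. w i q) = (- (real r * (real r - 1) / 2) - a) * ln (cmod q)"
    using assms(2) unfolding toda_solutions_def by auto
  have idx: "\<exists>j\<in>{1..r}. \<exists>m. i = int j + int r * m" for i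
  proof (intro bexI exI)
    show "i = int (nat ((i - 1) mod int r) + 1) + int r * ((i - 1) div int r)"
      using assms(1) by simp
    have "(i - 1) mod int r < int r" using assms(1) by simp
    then show "nat ((i - 1) mod int r) + 1 \<in> {1..r}" using assms(1) by (simp add: nat_less_iff Suc_le_eq)
  qed
  have Ck: "\<And>x. x \<noteq> 0 \<Longrightarrow> w i differentiable (at x)"
    "\<And>v x. x \<noteq> 0 \<Longrightarrow> (\<lambda>x. frechet_derivative (w i) (at x) v) differentiable (at x)" if "i \<in> {1..r}" for i
  proof -
    have "Ck_on (Suc (Suc 0)) Cstar (w i)" using w(1)[OF that] unfolding Cinf_on_def by blast
    then show "\<And>x. x \<noteq> 0 \<Longrightarrow> w i differentiable (at x)"
      "\<And>v x. x \<noteq> 0 \<Longrightarrow> (\<lambda>x. frechet_derivative (w i) (at x) v) differentiable (at x)" by auto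
  qed
  show per: "iper r (\<lambda>i. log_lift r a w i z)" for z
    using iper_cyc[of r w] by (simp add: iper_def log_lift_def)
  show "(\<Sum>i\<in>{0..<int r}. log_lift r a w i z) = 0" for z
  proof -
    have "(\<Sum>i\<in>{0..<int r}. log_lift r a w i z) = (\<Sum>i=1..r. w i (exp z) - lift_slope r a * Re z)"
      unfolding iper_sum_nat[OF per assms(1), symmetric] by (intro sum.cong) (auto simp: log_lift_def cyc_of_int_nat)
    also have "\<dots> = (- (real r * (real r - 1) / 2) - a) * Re z - (real r * lift_slope r a) * Re z"
      using w(3)[of "exp z"] by (simp add: sum_subtractf norm_exp_eq_Re)
    also have "\<dots> = 0" using lift_slope_mult[OF assms(1)] by simp
    finally show ?thesis .
  qed
  show "continuous_on UNIV (log_lift r a w i)" for i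
  proof -
    obtain j m where j: "j \<in> {1..r}" "i = int j + int r * m" using idx by blast
    have "log_lift r a w i = (\<lambda>z. w j (exp z) - lift_slope r a * Re z)"
      using j cyc_of_int_nat[of j r w] iper_add_mult[OF iper_cyc, of r w "int j" m] by (auto simp: log_lift_def)
    moreover have "continuous_on Cstar (w j)"
      using Ck(1)[OF j(1)] by (intro continuous_at_imp_continuous_on) (auto intro: differentiable_imp_continuous_within)
    then have "continuous_on UNIV (\<lambda>z. w j (exp z))"
      by (rule continuous_on_compose2) (auto intro!: continuous_intros)
    ultimately show ?thesis by (auto intro!: continuous_intros)
  qed
  fix z i
  obtain j m where j: "j \<in> {1..r}" "i = int j + int r * m" using idx by blast
  define d where "d = frechet_derivative (\<lambda>x. frechet_derivative (w j) (at x) 1) (at (exp z)) 1 +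
    frechet_derivative (\<lambda>x. frechet_derivative (w j) (at x) \<i>) (at (exp z)) \<i>"
  have ci: "cyc r w i = w j" "cyc r w (i + 1) = cyc r w (int j + 1)" "cyc r w (i - 1) = cyc r w (int j - 1)"
    using j cyc_of_int_nat[of j r w] iper_add_mult[OF iper_cyc, of r w "int j" m]
      iper_add_mult[OF iper_cyc, of r w "int j + 1" m] iper_add_mult[OF iper_cyc, of r w "int j - 1" m]
    by (auto simp: algebra_simps)
  have "Re (d_qbar (d_q (\<lambda>z. complex_of_real (w j z))) (exp z)) = d / 4"
    using d_qbar_d_q_of_real[OF Ck[OF j(1)], of "exp z"] by (simp add: d_def)
  moreover have "Re (2 * d_qbar (d_q (\<lambda>z. complex_of_real (w j z))) (exp z)
           - complex_of_real (real r ^ 2 * exp (2 * (cyc r w (int j) (exp z) - cyc r w (int j - 1) (exp z))))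
           + complex_of_real (real r ^ 2 * exp (2 * (cyc r w (int j + 1) (exp z) - cyc r w (int j) (exp z))))) = Re 0"
    using w(2)[OF j(1), of "exp z"] by (intro arg_cong[of _ _ Re]) simp
  moreover have "toda_term (\<lambda>x. exp (2 * x)) (\<lambda>i. log_lift r a w i z) i =
    exp (2 * (cyc r w (int j) (exp z) - cyc r w (int j - 1) (exp z))) - exp (2 * (cyc r w (int j + 1) (exp z) - cyc r w (int j) (exp z)))"
    using j(1) by (simp add: toda_term_def log_lift_def ci cyc_of_int_nat)
  ultimately have d: "d = 2 * (real r)\<^sup>2 * toda_term (\<lambda>x. exp (2 * x)) (\<lambda>i. log_lift r a w i z) i"
    by (simp add: right_diff_distrib)
  have "has_lap (\<lambda>z. w j (exp z) - (0 + lift_slope r a * Re z)) z (exp (2 * Re z) * d - 0)"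
    unfolding d_def by (intro has_lap_diff has_lap_comp_exp Ck[OF j(1)] has_lap_Re[OF has_d2_linear])
  then show "has_lap (log_lift r a w i) z (2 * (real r)\<^sup>2 * exp (2 * Re z) * toda_term (\<lambda>x. exp (2 * x)) (\<lambda>j. log_lift r a w j z) i)"
    by (simp add: d log_lift_def[abs_def] ci mult_ac)
qed

text \<open>\<open>Ln q\<close> is a preimage of q under exp with real part
  \<open>ln (cmod q)\<close>; \<open>toda_radial\<close> moves it to the real axis.\<close>

lemma toda_solution_radial:
  assumes "r \<ge> 1" "w \<in> toda_solutions r a" "i \<in> {1..r}" "q \<noteq> 0"
  shows "w i q = log_lift r a w (int i) (of_real (ln (cmod q))) + lift_slope r a * ln (cmod q)"
proof -
  have "log_lift r a w (int i) (Ln q) = log_lift r a w (int i) (of_real (ln (cmod q)))"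
    using assms by (intro toda_radial[OF assms(1) _ toda_on_log_lift[OF assms(1,2)] vper_log_lift]) auto
  moreover have "w i q = log_lift r a w (int i) (Ln q) + lift_slope r a * ln (cmod q)"
    using assms(3,4) by (simp add: log_lift_def cyc_of_int_nat)
  ultimately show ?thesis by simp
qed

text \<open>The summand \<open>real i - 1\<close> comes from the frame factor
  \<open>cmod q ^ (i - 1)\<close>.\<close>

lemma radial_growth:
  assumes "i \<ge> 1" "\<And>q. q \<noteq> 0 \<Longrightarrow> w i q = V (ln (cmod q)) + \<mu> * ln (cmod q)"
    and V: "((\<lambda>s. V s / s) \<longlongrightarrow> - \<nu>) at_bot"
  shows "growth_exponents w i = {\<nu> - \<mu> - (real i - 1)..}"
proof (rule growth_exponents_eq)
  have "((\<lambda>s. (real i - 1) + V s / s + \<mu>) \<longlongrightarrow> (real i - 1) + - \<nu> + \<mu>) at_bot"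
    by (intro tendsto_intros V)
  moreover have "\<forall>\<^sub>F s in at_bot. (real i - 1) + V s / s + \<mu> = ((real i - 1) * s + V s + \<mu> * s) / s"
    using eventually_gt_at_bot[of "0::real"] by eventually_elim (simp add: add_divide_distrib)
  ultimately have "((\<lambda>s. ((real i - 1) * s + V s + \<mu> * s) / s) \<longlongrightarrow> (real i - 1) + - \<nu> + \<mu>) at_bot"
    by (rule Lim_transform_eventually)
  then show "((\<lambda>s. ((real i - 1) * s + V s + \<mu> * s) / s) \<longlongrightarrow> - (\<nu> - \<mu> - (real i - 1))) at_bot"
    by (simp add: algebra_simps)
  fix q :: complex assume "q \<noteq> 0"
  then have "cmod q ^ (i - 1) = exp ((real i - 1) * ln (cmod q))"
    using assms(1) by (simp add: powr_realpow[symmetric] powr_def of_nat_diff)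
  then show "cmod q ^ (i - 1) * exp (w i q) = exp ((real i - 1) * ln (cmod q) + V (ln (cmod q)) + \<mu> * ln (cmod q))"
    using assms(2)[OF \<open>q \<noteq> 0\<close>] by (simp add: exp_add)
qed

section \<open>Weights, slopes and the bijection\<close>

lemma parabolic_weights_eq:
  assumes "i \<in> {1..r}" "growth_exponents w i = {\<beta>..}"
  shows "parabolic_weights r w i = \<beta>"
  using assms by (simp add: parabolic_weights_def) (rule Least_equality, auto)

lemma toda_solution_slopes:
  assumes "r \<ge> 1" "w \<in> toda_solutions r a"
  shows "\<exists>\<nu>. iper r \<nu> \<and> (\<Sum>i\<in>{0..<int r}. \<nu> i) = 0 \<and> (\<forall>i. \<nu> i - \<nu> (i - 1) \<le> 1) \<and>
    (\<forall>i. ((\<lambda>s. log_lift r a w i (of_real s) / s) \<longlongrightarrow> - \<nu> i) at_bot) \<and>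
    (\<forall>i\<in>{1..r}. growth_exponents w i = {\<nu> (int i) - lift_slope r a - (real i - 1)..})"
proof -
  have "2 * (real r)\<^sup>2 > 0" using assms(1) by simp
  from toda_slopes[OF assms(1) this toda_on_log_lift[OF assms] vper_log_lift]
  obtain \<nu> where \<nu>: "iper r \<nu>" "(\<Sum>i\<in>{0..<int r}. \<nu> i) = 0" "\<And>i. \<nu> i - \<nu> (i - 1) \<le> 1"
    "\<And>i. ((\<lambda>s. log_lift r a w i (of_real s) / s) \<longlongrightarrow> - \<nu> i) at_bot" by blast
  have "growth_exponents w i = {\<nu> (int i) - lift_slope r a - (real i - 1)..}" if "i \<in> {1..r}" for i
    by (rule radial_growth[where V = "\<lambda>s. log_lift r a w (int i) (of_real s)"])
      (use that toda_solution_radial[OF assms that] \<nu>(4) in auto)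
  with \<nu> show ?thesis by blast
qed

lemma parabolic_weights_in_weight_set:
  assumes "r \<ge> 1" "w \<in> toda_solutions r a"
  shows "parabolic_weights r w \<in> weight_set r a"
proof -
  obtain \<nu> where \<nu>: "iper r \<nu>" "(\<Sum>i\<in>{0..<int r}. \<nu> i) = 0" "\<And>i. \<nu> i - \<nu> (i - 1) \<le> 1"
    "\<And>i. ((\<lambda>s. log_lift r a w i (of_real s) / s) \<longlongrightarrow> - \<nu> i) at_bot"
    "\<And>i. i \<in> {1..r} \<Longrightarrow> growth_exponents w i = {\<nu> (int i) - lift_slope r a - (real i - 1)..}"
    using toda_solution_slopes[OF assms] by blast
  have pw: "parabolic_weights r w i = \<nu> (int i) - lift_slope r a - (real i - 1)" if "i \<in> {1..r}" for i
    by (rule parabolic_weights_eq[OF that \<nu>(5)[OF that]])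
  have "parabolic_weights r w (i + 1) \<le> parabolic_weights r w i" if "i \<in> {1..<r}" for i
    using that pw[of i] pw[of "i + 1"] \<nu>(3)[of "int i + 1"] by (simp add: add.commute)
  \<comment> \<open>The slope condition across the end of the cycle, from index 0, which stands for
    r, to index 1.\<close>
  moreover have "parabolic_weights r w r \<ge> parabolic_weights r w 1 - real r"
    using assms(1) pw[of 1] pw[of r] \<nu>(3)[of 1] \<nu>(1)[unfolded iper_def, rule_format, of 0] by simp
  moreover have "(\<Sum>i=1..r. parabolic_weights r w i) = a"
  proof -
    have "(\<Sum>i=1..r. parabolic_weights r w i) = (\<Sum>i=1..r. \<nu> (int i)) - real r * lift_slope r a - (\<Sum>i=1..r. real i - 1)"
      using pw by (simp add: sum_subtractf)
    then show ?thesis using iper_sum_nat[OF \<nu>(1) assms(1)] \<nu>(2) lift_slope_mult[OF assms(1), of a] sum_reals_1[of r] by simp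
  qed
  moreover have "parabolic_weights r w \<in> {1..r} \<rightarrow>\<^sub>E UNIV" by (simp add: parabolic_weights_def)
  ultimately show ?thesis by (simp add: weight_set_def)
qed

text \<open>The weights determine the slopes at 1..r and hence everywhere. Extensionality then turns
  agreement on the domains into equality.\<close>

lemma parabolic_weights_inj:
  assumes "r \<ge> 1" "w \<in> toda_solutions r a" "w' \<in> toda_solutions r a" "parabolic_weights r w = parabolic_weights r w'"
  shows "w = w'"
proof -
  obtain \<nu> where \<nu>: "iper r \<nu>" "(\<Sum>i\<in>{0..<int r}. \<nu> i) = 0" "\<And>i. \<nu> i - \<nu> (i - 1) \<le> 1"
    "\<And>i. ((\<lambda>s. log_lift r a w i (of_real s) / s) \<longlongrightarrow> - \<nu> i) at_bot"
    "\<And>i. i \<in> {1..r} \<Longrightarrow> growth_exponents w i = {\<nu> (int i) - lift_slope r a - (real i - 1)..}"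
    using toda_solution_slopes[OF assms(1,2)] by blast
  obtain \<nu>' where \<nu>': "iper r \<nu>'" "(\<Sum>i\<in>{0..<int r}. \<nu>' i) = 0" "\<And>i. \<nu>' i - \<nu>' (i - 1) \<le> 1"
    "\<And>i. ((\<lambda>s. log_lift r a w' i (of_real s) / s) \<longlongrightarrow> - \<nu>' i) at_bot"
    "\<And>i. i \<in> {1..r} \<Longrightarrow> growth_exponents w' i = {\<nu>' (int i) - lift_slope r a - (real i - 1)..}"
    using toda_solution_slopes[OF assms(1,3)] by blast
  have "\<nu> (int i) = \<nu>' (int i)" if "i \<in> {1..r}" for i
    using parabolic_weights_eq[OF that \<nu>(5)[OF that]] parabolic_weights_eq[OF that \<nu>'(5)[OF that]] assms(4) by simp
  then have "cyc r (\<lambda>i. \<nu> (int i)) k = cyc r (\<lambda>i. \<nu>' (int i)) k" for k by (intro cyc_cong assms(1))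
  then have "\<nu> k = \<nu>' k" for k unfolding cyc_of_iper[OF \<nu>(1) assms(1)] cyc_of_iper[OF \<nu>'(1) assms(1)] .
  then have \<nu>'2: "((\<lambda>s. log_lift r a w' i (of_real s) / s) \<longlongrightarrow> - \<nu> i) at_bot" for i using \<nu>'(4) by simp
  have k: "2 * (real r)\<^sup>2 > 0" using assms(1) by simp
  have eq: "log_lift r a w i z = log_lift r a w' i z" for i z
    by (rule toda_unique[OF assms(1) k toda_on_log_lift[OF assms(1,2)] vper_log_lift
          toda_on_log_lift[OF assms(1,3)] vper_log_lift \<nu>(4) \<nu>'2])
  have E: "w \<in> {1..r} \<rightarrow>\<^sub>E (Cstar \<rightarrow>\<^sub>E UNIV)" "w' \<in> {1..r} \<rightarrow>\<^sub>E (Cstar \<rightarrow>\<^sub>E UNIV)"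
    using assms(2,3) by (auto simp: toda_solutions_def)
  show ?thesis
  proof (rule PiE_ext[OF E])
    fix i assume i: "i \<in> {1..r}"
    show "w i = w' i"
    proof (rule PiE_ext[OF PiE_mem[OF E(1) i] PiE_mem[OF E(2) i]])
      fix q assume "q \<in> Cstar"
      then have q: "q \<noteq> 0" by simp
      show "w i q = w' i q"
        unfolding toda_solution_radial[OF assms(1,2) i q] toda_solution_radial[OF assms(1,3) i q] eq by simp
    qed
  qed
qed

lemma toda_solution_of_radial:
  fixes V :: "int \<Rightarrow> real \<Rightarrow> real" and a :: real
  assumes "r \<ge> 1" "toda_on (2 * (real r)\<^sup>2) r UNIV (\<lambda>i z. V i (Re z))"
  defines "w \<equiv> \<lambda>i\<in>{1..r}. \<lambda>q\<in>Cstar. V (int i) (ln (cmod q)) + lift_slope r a * ln (cmod q)"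
  shows "w \<in> toda_solutions r a"
proof -
  define k where "k = 2 * (real r)\<^sup>2"
  define \<mu> where "\<mu> = lift_slope r a"
  have per: "iper r (\<lambda>i. V i s)" for s using toda_onD(1)[OF assms(2), of "of_real s"] by simp
  define V' where "V' i = deriv (V i)" for i
  have d: "(V i has_real_derivative V' i s) (at s)"
    "(V' i has_real_derivative k * exp (2 * s) * (exp (2 * (V i s - V (i - 1) s)) - exp (2 * (V (i + 1) s - V i s)))) (at s)" for i s
    using toda_on_radial_ode[OF assms(2), of i s] unfolding V'_def k_def by simp_all
  have wi: "w i q = V (int i) (ln (cmod q)) + \<mu> * ln (cmod q)" if "i \<in> {1..r}" "q \<noteq> 0" for i q
    using that by (simp add: w_def \<mu>_def)
  have cw: "cyc r w j q = V j (ln (cmod q)) + \<mu> * ln (cmod q)" if "q \<noteq> 0" for j q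
  proof -
    have "cyc r w j q = cyc r (\<lambda>i. V (int i) (ln (cmod q)) + \<mu> * ln (cmod q)) j"
      using cyc_cong[OF assms(1), of "\<lambda>i. w i q" "\<lambda>i. V (int i) (ln (cmod q)) + \<mu> * ln (cmod q)" j] wi that
      by (simp add: cyc_def)
    also have "\<dots> = V j (ln (cmod q)) + \<mu> * ln (cmod q)"
      by (rule cyc_of_iper[OF _ assms(1)]) (use per in \<open>simp add: iper_def\<close>)
    finally show ?thesis .
  qed
  have "w \<in> {1..r} \<rightarrow>\<^sub>E (Cstar \<rightarrow>\<^sub>E UNIV)" by (auto simp: w_def)
  moreover have "Cinf_on Cstar (w i)" if "i \<in> {1..r}" for i
  proof -
    have "Ck_on n Cstar (w i) \<longleftrightarrow> Ck_on n Cstar (\<lambda>q. V (int i) (ln (cmod q)) + \<mu> * ln (cmod q))" for n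
      by (rule Ck_on_cong) (use wi[OF that] in auto)
    then show ?thesis using radial_smooth[OF d] by (simp add: Cinf_on_def)
  qed
  moreover have "2 * d_qbar (d_q (\<lambda>z. complex_of_real (w i z))) q
           - complex_of_real (real r ^ 2 * exp (2 * (cyc r w (int i) q - cyc r w (int i - 1) q)))
           + complex_of_real (real r ^ 2 * exp (2 * (cyc r w (int i + 1) q - cyc r w (int i) q))) = 0"
    if "i \<in> {1..r}" "q \<in> Cstar" for i q
  proof -
    have q: "q \<noteq> 0" using that by simp
    define T where "T s = exp (2 * (V (int i) s - V (int i - 1) s)) - exp (2 * (V (int i + 1) s - V (int i) s))" for s
    have "d_qbar (d_q (\<lambda>z. complex_of_real (w i z))) q =
      complex_of_real (k * exp (2 * ln (cmod q)) * T (ln (cmod q)) / (4 * (cmod q)\<^sup>2))"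
    proof (rule d_qbar_d_q_radial[where h = "\<lambda>s. V (int i) s + \<mu> * s" and h' = "\<lambda>s. V' (int i) s + \<mu>"])
      show "((\<lambda>s. V (int i) s + \<mu> * s) has_real_derivative V' (int i) s + \<mu>) (at s)" for s
        by (auto intro!: derivative_eq_intros d)
      show "((\<lambda>s. V' (int i) s + \<mu>) has_real_derivative k * exp (2 * s) * T s) (at s)" for s
        using DERIV_add[OF d(2)[of "int i" s] DERIV_const[of \<mu>]] by (simp add: T_def)
    qed (use q wi[OF that(1)] in auto)
    also have "\<dots> = complex_of_real ((real r)\<^sup>2 * T (ln (cmod q)) / 2)"
    proof -
      have "exp (2 * ln (cmod q)) = (cmod q)\<^sup>2" using q by (simp add: exp_double)
      then show ?thesis using q by (simp add: k_def)
    qed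
    finally have e: "d_qbar (d_q (\<lambda>z. complex_of_real (w i z))) q = complex_of_real ((real r)\<^sup>2 * T (ln (cmod q)) / 2)" .
    show ?thesis unfolding cw[OF q] e T_def by (simp add: field_simps)
  qed
  moreover have "(\<Sum>i=1..r. w i q) = (- (real r * (real r - 1) / 2) - a) * ln (cmod q)" if "q \<in> Cstar" for q
  proof -
    have "(\<Sum>i=1..r. w i q) = (\<Sum>i=1..r. V (int i) (ln (cmod q)) + \<mu> * ln (cmod q))"
      using wi that by (intro sum.cong) auto
    also have "\<dots> = (\<Sum>i\<in>{0..<int r}. V i (ln (cmod q))) + real r * \<mu> * ln (cmod q)"
      using iper_sum_nat[OF per assms(1)] by (simp add: sum.distrib)
    also have "(\<Sum>i\<in>{0..<int r}. V i (ln (cmod q))) = 0"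
      using toda_onD(2)[OF assms(2), of "of_real (ln (cmod q))"] by simp
    finally show ?thesis using lift_slope_mult[OF assms(1), of a] by (simp add: \<mu>_def)
  qed
  ultimately show ?thesis unfolding toda_solutions_def by blast
qed

lemma parabolic_weights_surj:
  assumes "r \<ge> 1" "b \<in> weight_set r a"
  shows "\<exists>w\<in>toda_solutions r a. parabolic_weights r w = b"
proof -
  define \<mu> where "\<mu> = lift_slope r a"
  \<comment> \<open>The formula for the weights in terms of the slopes, solved for the
    slopes.\<close>
  define \<nu> where "\<nu> = cyc r (\<lambda>i. b i + \<mu> + (real i - 1))"
  have b: "\<And>i. i \<in> {1..<r} \<Longrightarrow> b (i + 1) \<le> b i" "b 1 - real r \<le> b r" "(\<Sum>i=1..r. b i) = a" "b \<in> {1..r} \<rightarrow>\<^sub>E UNIV"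
    using assms(2) by (auto simp: weight_set_def)
  have per: "iper r \<nu>" unfolding \<nu>_def by (rule iper_cyc)
  have \<nu>i: "\<nu> (int i) = b i + \<mu> + (real i - 1)" if "i \<in> {1..r}" for i
    using that cyc_of_int_nat[of i r] by (simp add: \<nu>_def)
  have sum: "(\<Sum>i\<in>{0..<int r}. \<nu> i) = 0"
  proof -
    have "(\<Sum>i\<in>{0..<int r}. \<nu> i) = (\<Sum>i=1..r. b i + \<mu> + (real i - 1))"
      unfolding iper_sum_nat[OF per assms(1), symmetric] using \<nu>i by (intro sum.cong) auto
    also have "\<dots> = a + real r * \<mu> + (\<Sum>i=1..r. real i - 1)" using b(3) by (simp add: sum.distrib)
    finally show ?thesis using lift_slope_mult[OF assms(1), of a] sum_reals_1[of r] by (simp add: \<mu>_def)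
  qed
  \<comment> \<open>Only j in 0..r-1 has to be checked: j = 1 is the wrap-around inequality of
    \<open>weight_set\<close>, and j = 0 is the step from r - 1 to r, trivial for r = 1.\<close>
  have step: "\<nu> i - \<nu> (i - 1) \<le> 1" for i
  proof -
    have "iper r (\<lambda>i. \<nu> i - \<nu> (i - 1))" using per iper_shift[OF per, of "- 1"] by (simp add: iper_def)
    from iper_range[OF this assms(1), of i] obtain j where j: "j \<in> {0..<int r}" "\<nu> j - \<nu> (j - 1) = \<nu> i - \<nu> (i - 1)" by auto
    have "\<nu> j - \<nu> (j - 1) \<le> 1"
    proof (cases "j \<ge> 2")
      case True
      define n where "n = nat (j - 1)"
      have n: "j - 1 = int n" "j = int (n + 1)" "n \<in> {1..<r}" using True j(1) by (auto simp: n_def)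
      then show ?thesis using b(1)[OF n(3)] \<nu>i[of n] \<nu>i[of "n + 1"] by simp
    next
      case False
      then consider "j = 0" | "j = 1" using j(1) by force
      then show ?thesis
      proof cases
        assume "j = 1"
        moreover have "\<nu> 0 = \<nu> (int r)" using per[unfolded iper_def, rule_format, of 0] by simp
        ultimately show ?thesis using b(2) \<nu>i[of 1] \<nu>i[of r] assms(1) by simp
      next
        assume "j = 0"
        have e: "\<nu> 0 = \<nu> (int r)" "\<nu> (- 1) = \<nu> (int r - 1)"
          using per[unfolded iper_def, rule_format, of 0] per[unfolded iper_def, rule_format, of "- 1"] by (simp_all add: add.commute)
        show ?thesis
        proof (cases "r = 1")
          case True
          then show ?thesis using e \<open>j = 0\<close> by simp
        next
          case False
          then have n: "r - 1 \<in> {1..<r}" "int r - 1 = int (r - 1)" "r - 1 + 1 = r" using assms(1) by auto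
          then show ?thesis using e \<open>j = 0\<close> b(1)[OF n(1)] \<nu>i[of "r - 1"] \<nu>i[of r] by (simp add: of_nat_diff)
        qed
      qed
    qed
    then show ?thesis using j(2) by simp
  qed
  have "2 * (real r)\<^sup>2 > 0" using assms(1) by simp
  from toda_exists[OF assms(1) this per sum step] obtain V where
    V: "toda_on (2 * (real r)\<^sup>2) r UNIV (\<lambda>i z. V i (Re z))" "\<And>i. ((\<lambda>s. V i s / s) \<longlongrightarrow> - \<nu> i) at_bot" by blast
  define w where "w = (\<lambda>i\<in>{1..r}. \<lambda>q\<in>Cstar. V (int i) (ln (cmod q)) + \<mu> * ln (cmod q))"
  have "w \<in> toda_solutions r a" unfolding w_def \<mu>_def by (rule toda_solution_of_radial[OF assms(1) V(1)])
  moreover have "parabolic_weights r w = b"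
  proof (rule PiE_ext[of _ "{1..r}" "\<lambda>_. UNIV"])
    show "parabolic_weights r w \<in> {1..r} \<rightarrow>\<^sub>E UNIV" by (simp add: parabolic_weights_def)
    fix i assume i: "i \<in> {1..r}"
    have "growth_exponents w i = {\<nu> (int i) - \<mu> - (real i - 1)..}"
      by (rule radial_growth[OF _ _ V(2)]) (use i in \<open>auto simp: w_def\<close>)
    from parabolic_weights_eq[OF i this] show "parabolic_weights r w i = b i" using \<nu>i[OF i] by simp
  qed (rule b(4))
  ultimately show ?thesis by blast
qed

text \<open>The first conjunct is the well-definedness of the weights: the minimum exists, so
  \<open>LEAST\<close> in \<open>parabolic_weights\<close> denotes it.\<close>

theorem theorem3p34:
  fixes r :: nat and a :: real
  assumes "r \<ge> 1"
  shows "(\<forall>w\<in>toda_solutions r a. \<forall>i\<in>{1..r}.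
            \<exists>c\<in>growth_exponents w i. \<forall>c'\<in>growth_exponents w i. c \<le> c')
       \<and> bij_betw (parabolic_weights r) (toda_solutions r a) (weight_set r a)
       \<and> (\<forall>w\<in>toda_solutions r a. \<forall>i\<in>{1..r}. \<forall>q\<in>Cstar. \<forall>q'\<in>Cstar.
            cmod q = cmod q' \<longrightarrow> w i q = w i q')"
proof (intro conjI ballI impI)
  fix w i assume w: "w \<in> toda_solutions r a" and i: "i \<in> {1..r}"
  obtain \<nu> where \<nu>: "iper r \<nu>" "(\<Sum>i\<in>{0..<int r}. \<nu> i) = 0" "\<And>i. \<nu> i - \<nu> (i - 1) \<le> 1"
    "\<And>i. ((\<lambda>s. log_lift r a w i (of_real s) / s) \<longlongrightarrow> - \<nu> i) at_bot"
    "\<And>i. i \<in> {1..r} \<Longrightarrow> growth_exponents w i = {\<nu> (int i) - lift_slope r a - (real i - 1)..}"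
    using toda_solution_slopes[OF assms w] by blast
  from this(5)[OF i] show "\<exists>c\<in>growth_exponents w i. \<forall>c'\<in>growth_exponents w i. c \<le> c'" by auto
next
  show "bij_betw (parabolic_weights r) (toda_solutions r a) (weight_set r a)"
    unfolding bij_betw_def
  proof (intro conjI inj_onI equalityI subsetI)
    show "w = w'" if "w \<in> toda_solutions r a" "w' \<in> toda_solutions r a" "parabolic_weights r w = parabolic_weights r w'" for w w'
      by (rule parabolic_weights_inj[OF assms that])
    show "b \<in> weight_set r a" if "b \<in> parabolic_weights r ` toda_solutions r a" for b
      using that parabolic_weights_in_weight_set[OF assms] by blast
    show "b \<in> parabolic_weights r ` toda_solutions r a" if "b \<in> weight_set r a" for b
      using parabolic_weights_surj[OF assms that] by blast
  qed
next
  fix w i q q' assume "w \<in> toda_solutions r a" "i \<in> {1..r}" "q \<in> Cstar" "q' \<in> Cstar" "cmod q = cmod q'"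
  then show "w i q = w i q'"
    using toda_solution_radial[OF assms, of w a i q] toda_solution_radial[OF assms, of w a i q'] by simp
qed

end
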